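(* The following problem is (algorithmically) decidable. Input: a finite relational structure $\mathbb{A}$ with finite signature and a subset $B\subseteq A$. Question: is $B$ an absorbing subuniverse of the polymorphism algebra $\mathrm{Pol}\,\mathbb{A}$?
   Context: The relations of $\mathbb{A}$ are given in the input by lists of their tuples. $\mathrm{Pol}\,\mathbb{A}$ denotes the algebra with universe $A$ whose operations are all polymorphisms of $\mathbb{A}$ (finitary operations on $A$ preserving all relations of $\mathbb{A}$); its term operations are exactly the polymorphisms of $\mathbb{A}$. A subuniverse $B$ of an algebra $\mathbf{A}$ is absorbing if $\mathbf{A}$ has an idempotent term operation $t$ (i.e. $t(x,\dots,x)\approx x$) of some arity such that $t(a_1,\dots,a_n)\in B$ whenever all but at most one of the $a_i\in A$ belong to $B$. *)

theory Defs
  imports Main "HOL-Library.Nat_Bijection"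
begin

text \<open>Arities are not tracked by the syntax. A function applied to too few arguments is
  undefined; superfluous arguments are ignored by the basic functions. For each fixed number of
  arguments this gives exactly Kleene's partial recursive functions.\<close>

datatype recf =
    Zero
  | Succ
  | Proj nat
  | Comp recf "recf list"
  | PrimRec recf recf
  | Mu recf

fun rec_apply :: "recf \<Rightarrow> nat list \<Rightarrow> nat option" where
  "rec_apply Zero xs = Some 0"
| "rec_apply Succ xs = (case xs of [] \<Rightarrow> None | x # _ \<Rightarrow> Some (Suc x))"
| "rec_apply (Proj i) xs = (if i < length xs then Some (xs ! i) else None)"
| "rec_apply (Comp f gs) xs =
     Option.bind (those (map (\<lambda>g. rec_apply g xs) gs)) (\<lambda>ys. rec_apply f ys)"
| "rec_apply (PrimRec f g) xs =
     (case xs of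
        [] \<Rightarrow> None
      | n # ys \<Rightarrow>
          rec_nat (rec_apply f ys)
            (\<lambda>m r. Option.bind r (\<lambda>v. rec_apply g (m # v # ys))) n)"
| "rec_apply (Mu f) xs =
     (if \<exists>y. rec_apply f (y # xs) = Some 0 \<and>
           (\<forall>z<y. \<exists>v. rec_apply f (z # xs) = Some (Suc v))
      then Some (LEAST y. rec_apply f (y # xs) = Some 0)
      else None)"

definition decidable :: "nat set \<Rightarrow> bool" where
  "decidable S \<longleftrightarrow> (\<exists>f. \<forall>x. rec_apply f [x] = Some (if x \<in> S then 1 else 0))"

text \<open>An operation of arity \<open>n\<close> on a set \<open>A\<close> is represented by a function on lists of which only
  the values at lists of length \<open>n\<close> over \<open>A\<close> are relevant.\<close>

definition tuples :: "'a set \<Rightarrow> nat \<Rightarrow> 'a list set" where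
  "tuples A n = {xs. length xs = n \<and> set xs \<subseteq> A}"

record 'a algebra =
  carrier :: "'a set"
  ops :: "(nat \<times> ('a list \<Rightarrow> 'a)) set"

inductive term_op :: "'a algebra \<Rightarrow> nat \<Rightarrow> ('a list \<Rightarrow> 'a) \<Rightarrow> bool"
  for \<A> :: "'a algebra" and n :: nat where
  proj: "i < n \<Longrightarrow> term_op \<A> n (\<lambda>xs. xs ! i)"
| comp: "(m, f) \<in> ops \<A> \<Longrightarrow> length gs = m \<Longrightarrow> \<forall>g\<in>set gs. term_op \<A> n g \<Longrightarrow>
         term_op \<A> n (\<lambda>xs. f (map (\<lambda>g. g xs) gs))"

definition subuniverse :: "'a set \<Rightarrow> 'a algebra \<Rightarrow> bool" where
  "subuniverse B \<A> \<longleftrightarrow>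
     B \<subseteq> carrier \<A> \<and> (\<forall>(n, f)\<in>ops \<A>. \<forall>xs\<in>tuples B n. f xs \<in> B)"

definition idempotent_op :: "'a set \<Rightarrow> nat \<Rightarrow> ('a list \<Rightarrow> 'a) \<Rightarrow> bool" where
  "idempotent_op A n t \<longleftrightarrow> (\<forall>a\<in>A. t (replicate n a) = a)"

definition absorbing_subuniverse :: "'a set \<Rightarrow> 'a algebra \<Rightarrow> bool" where
  "absorbing_subuniverse B \<A> \<longleftrightarrow>
     subuniverse B \<A> \<and>
     (\<exists>n t. term_op \<A> n t \<and> idempotent_op (carrier \<A>) n t \<and>
        (\<forall>xs\<in>tuples (carrier \<A>) n. card {i. i < n \<and> xs ! i \<notin> B} \<le> 1 \<longrightarrow> t xs \<in> B))"

text \<open>A finite signature is a list of relation symbols; the structure gives for each symbol its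
  arity and its interpretation.\<close>

record 'a rel_structure =
  universe :: "'a set"
  rels :: "(nat \<times> 'a list set) list"

definition finite_rel_structure :: "'a rel_structure \<Rightarrow> bool" where
  "finite_rel_structure S \<longleftrightarrow>
     finite (universe S) \<and> (\<forall>(k, R)\<in>set (rels S). R \<subseteq> tuples (universe S) k)"

definition preserves :: "nat \<Rightarrow> ('a list \<Rightarrow> 'a) \<Rightarrow> nat \<Rightarrow> 'a list set \<Rightarrow> bool" where
  "preserves n f k R \<longleftrightarrow>
     (\<forall>ts\<in>tuples R n. map (\<lambda>j. f (map (\<lambda>t. t ! j) ts)) [0..<k] \<in> R)"

text \<open>As usual for clones, operations have positive arity. In particular the empty set is a
  subuniverse of every polymorphism algebra.\<close>

definition polymorphism :: "'a rel_structure \<Rightarrow> nat \<Rightarrow> ('a list \<Rightarrow> 'a) \<Rightarrow> bool" where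
  "polymorphism S n f \<longleftrightarrow>
     0 < n \<and> (\<forall>xs\<in>tuples (universe S) n. f xs \<in> universe S) \<and>
     (\<forall>(k, R)\<in>set (rels S). preserves n f k R)"

definition Pol :: "'a rel_structure \<Rightarrow> 'a algebra" where
  "Pol S = \<lparr>carrier = universe S, ops = {(n, f). polymorphism S n f}\<rparr>"

text \<open>In an input, the elements of the structure are named by natural numbers; the universe and
  the subset are given by lists of elements, and each relation by its arity and a list of its
  tuples.\<close>

definition input_structure :: "nat list \<Rightarrow> (nat \<times> nat list list) list \<Rightarrow> nat rel_structure" where
  "input_structure us rs =
     \<lparr>universe = set us, rels = map (\<lambda>(k, ts). (k, set ts)) rs\<rparr>"

definition encode_rel :: "nat \<times> nat list list \<Rightarrow> nat" where
  "encode_rel r = prod_encode (fst r, list_encode (map list_encode (snd r)))"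

definition encode_input :: "nat list \<Rightarrow> (nat \<times> nat list list) list \<Rightarrow> nat list \<Rightarrow> nat" where
  "encode_input us rs bs =
     prod_encode (list_encode us, prod_encode (list_encode (map encode_rel rs), list_encode bs))"

lemma inj_encode_rel: "inj encode_rel"
  by (auto intro!: injI simp: encode_rel_def prod_eq_iff list_encode_eq
      inj_map_eq_map[OF inj_list_encode])

lemma encode_input_eq_iff:
  "encode_input us rs bs = encode_input us' rs' bs' \<longleftrightarrow> us = us' \<and> rs = rs' \<and> bs = bs'"
  by (simp add: encode_input_def list_encode_eq inj_map_eq_map[OF inj_encode_rel])

definition absorption_problem :: "nat set" where
  "absorption_problem =
     {encode_input us rs bs | us rs bs.
        finite_rel_structure (input_structure us rs) \<and>
        set bs \<subseteq> universe (input_structure us rs) \<and>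
        absorbing_subuniverse (set bs) (Pol (input_structure us rs))}"

end

(* A subuniverse B of A is Jonsson absorbing if there are ternary idempotent operations d_0, ..., d_(n-1)
   with d_i(B, A, B) <= B, d_0(x, x, y) = x, d_i(x, y, y) = d_(i+1)(x, x, y) and d_(n-1)(x, y, y) = y.
   Absorption gives such a chain at once. Conversely, a chain gives an absorbing operation of every arity N
   above an explicit bound. Such an operation is a solution of a constraint network P whose variables are the
   N-tuples over the relations of the structure, subject to labels (the words with at most one letter
   outside B have to be mapped into B); the i-th projection violates only the labels whose exceptional letter
   is the i-th.

   (1) A tree-shaped consequence of the network that contradicts the labels needs many labels, hence has a long
   branch, on which the pair of admissible value sets (from below, from above) repeats. Pumping the repeated
   segment and applying the chain yields a contradiction. So the labels lead to a nonempty arc-consistent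
   subnetwork Q with d_i(Q, P, Q) <= Q.

   (2) Q is shrunk to single values. If some Q_x has a proper nonempty subset C with d_i(C, P_x, C) <= C,
   propagate C along the walks of a terminal strongly connected component; the result is well defined because
   closed walks of P can be reversed and walks of P between cycles of Q are turned by the chain into walks of
   Q. Otherwise the unary polynomials of Q built from the d_i and solutions of P act transitively on
   Q_x, a loop lemma for absorbed reflexive digraphs yields one that is not injective, and Q is retracted
   to the image of an idempotent power.

   Hence absorption can be decided by searching for an absorbing operation of one computable arity, which
   is a bounded formula about codes of finite lists. *)

theory Submission
  imports Defs "HOL-Library.FuncSet"
begin

section \<open>Jonsson chains and walks\<close>

text \<open>The chain may be arbitrarily long, since nothing is known about the arity of the given
  absorbing operation. Decidability rests on a threshold for \<open>N\<close> that ignores this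
  length: it only counts the values of the variables. The types that may not repeat on a branch are
  pairs of sets of values, and each branching into two subtrees with labels uses up a new type, so a
  minimal contradiction has at most \<open>2 ^ card (Pow Val \<times> Pow Val)\<close> labels. With
  more than that many projections, one of them violates none of these labels.

  The domains and constraints of the network are not the relations themselves but the traces on them
  of the idempotent polymorphisms of arity \<open>N\<close>. So idempotence costs no labels, and
  every allowed pair lies on a global solution. The latter is what makes closed walks of
  \<open>P\<close> reversible, lets the middle argument of an operation be transported along an
  edge, and supplies constants for the polynomials. The price is that the final values are
  compatible along edges only; edges from a tuple of a relation to its columns are chosen because
  this much already determines a polymorphism.\<close>

lemma idempotent_funpow:
  assumes "finite X" "\<And>x. x \<in> X \<Longrightarrow> f x \<in> X"
  shows "\<exists>K>0. \<forall>x\<in>X. (f ^^ K) ((f ^^ K) x) = (f ^^ K) x"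
proof -
  have inX: "(f ^^ i) x \<in> X" if "x \<in> X" for i x
    using that by (induction i) (auto simp: assms(2))
  define g where "g i = restrict (f ^^ i) X" for i
  have "range g \<subseteq> (\<Pi>\<^sub>E x\<in>X. X)" using inX by (auto simp: g_def)
  then have "finite (range g)" by (rule finite_subset) (simp add: finite_PiE assms(1))
  then have "\<not> inj g" using finite_imageD infinite_UNIV_nat by blast
  then obtain i0 j0 where "i0 \<noteq> j0" "g i0 = g j0" by (auto simp: inj_def)
  then obtain i j where ij: "i < j" "g i = g j" by (metis linorder_neqE_nat)
  define p where "p = j - i"
  have p: "p > 0" using ij by (simp add: p_def)
  have step: "(f ^^ (k + p)) x = (f ^^ k) x" if "x \<in> X" "k \<ge> i" for k x
  proof -
    have "(f ^^ j) x = (f ^^ i) x" using ij(2) that(1) unfolding g_def by (metis restrict_apply')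
    then have "(f ^^ (k - i)) ((f ^^ j) x) = (f ^^ (k - i)) ((f ^^ i) x)" by simp
    then show ?thesis using that ij(1) by (simp add: p_def flip: funpow_add comp_apply[of "f ^^ _"])
  qed
  have mult: "(f ^^ (k + m * p)) x = (f ^^ k) x" if "x \<in> X" "k \<ge> i" for k m x
  proof (induction m)
    case (Suc m)
    have "(f ^^ (k + Suc m * p)) x = (f ^^ ((k + m * p) + p)) x" by (simp add: algebra_simps)
    then show ?case using step[of x "k + m * p"] that Suc by simp
  qed simp
  \<comment> \<open>A multiple of the period \<open>p\<close> that is not below the preperiod
    \<open>i\<close>, so that iterating twice equals iterating once.\<close>
  let ?K = "Suc i * p"
  have "?K \<ge> i" using p by (cases p) auto
  then have "\<forall>x\<in>X. (f ^^ ?K) ((f ^^ ?K) x) = (f ^^ ?K) x"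
    using mult[of _ ?K "Suc i"] by (metis comp_apply funpow_add)
  then show ?thesis using p by (intro exI[of _ ?K]) auto
qed

lemma funpow_fixed_mult: "(f ^^ K) x = x \<Longrightarrow> (f ^^ (K * m)) x = x"
  by (induction m) (auto simp: funpow_add)

definition jonsson_on :: "'a set \<Rightarrow> nat \<Rightarrow> (nat \<Rightarrow> 'a \<Rightarrow> 'a \<Rightarrow> 'a \<Rightarrow> 'a) \<Rightarrow> bool" where
  "jonsson_on S n D \<longleftrightarrow> 0 < n \<and> (\<forall>a\<in>S. \<forall>b\<in>S. D 0 a a b = a \<and> D (n - 1) a b b = b \<and>
     (\<forall>i. Suc i < n \<longrightarrow> D i a b b = D (Suc i) a a b))"

text \<open>\<open>D\<close> and \<open>D'\<close> may differ because \<open>E\<close> will relate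
  the values of two variables, each with operations of its own.\<close>

definition absorbs_rel :: "nat \<Rightarrow> (nat \<Rightarrow> 'a \<Rightarrow> 'a \<Rightarrow> 'a \<Rightarrow> 'a) \<Rightarrow>
    (nat \<Rightarrow> 'b \<Rightarrow> 'b \<Rightarrow> 'b \<Rightarrow> 'b) \<Rightarrow> ('a \<times> 'b) set \<Rightarrow> ('a \<times> 'b) set \<Rightarrow> bool" where
  "absorbs_rel n D D' E F \<longleftrightarrow> (\<forall>i<n. \<forall>a a' b b' c c'. (a, a') \<in> E \<longrightarrow> (b, b') \<in> F \<longrightarrow> (c, c') \<in> E \<longrightarrow>
     (D i a b c, D' i a' b' c') \<in> E)"

lemma jonsson_on_subset: "jonsson_on S n D \<Longrightarrow> T \<subseteq> S \<Longrightarrow> jonsson_on T n D"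
  unfolding jonsson_on_def by blast

lemma jonsson_on_idem:
  assumes "jonsson_on S n D" "a \<in> S" "i < n" shows "D i a a a = a"
  using assms(3)
proof (induction i)
  case 0 then show ?case using assms unfolding jonsson_on_def by blast
next
  case (Suc i) then show ?case using assms unfolding jonsson_on_def by (metis Suc_lessD)
qed

lemma absorbs_rel_comp:
  "absorbs_rel n D D' E F \<Longrightarrow> absorbs_rel n D' D'' E' F' \<Longrightarrow> absorbs_rel n D D'' (E O E') (F O F')"
  unfolding absorbs_rel_def by (blast intro: relcompI)

lemma absorbs_rel_Id: "absorbs_rel n D D Id Id"
  unfolding absorbs_rel_def by blast

lemma absorbs_rel_pow: "absorbs_rel n D D E F \<Longrightarrow> absorbs_rel n D D (E ^^ m) (F ^^ m)"
  by (induction m) (auto intro: absorbs_rel_comp simp: absorbs_rel_Id)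

text \<open>The loop at \<open>l\<close>, the pair \<open>(l, r)\<close> and the loop at
  \<open>r\<close> yield an edge from \<open>D i l l r\<close> to \<open>D i l r r\<close>; the
  Jonsson identities make the end of each such edge the start of the next.\<close>

lemma jonsson_walk:
  assumes J: "jonsson_on S n D" and A: "absorbs_rel n D D E F"
    and S: "l \<in> S" "r \<in> S" and l: "(l, l) \<in> E" and r: "(r, r) \<in> E" and lr: "(l, r) \<in> F"
  shows "(l, r) \<in> E ^^ n"
proof -
  have step: "(D i l l r, D i l r r) \<in> E" if "i < n" for i
    using A l r lr that unfolding absorbs_rel_def by blast
  have "(l, D i l r r) \<in> E ^^ Suc i" if "i < n" for i
    using that
  proof (induction i)
    case 0
    have "D 0 l l r = l" using J S unfolding jonsson_on_def by blast
    then show ?case using step[of 0] 0 by auto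
  next
    case (Suc i)
    have "D i l r r = D (Suc i) l l r" using J S Suc.prems unfolding jonsson_on_def by blast
    then show ?case using Suc step[of "Suc i"] by (metis Suc_lessD relpow_Suc_I)
  qed
  from this[of "n - 1"] show ?thesis using J S unfolding jonsson_on_def by force
qed

lemma relpow_add_I: "(a, b) \<in> R ^^ i \<Longrightarrow> (b, c) \<in> R ^^ j \<Longrightarrow> (a, c) \<in> R ^^ (i + j)"
  by (auto simp: relpow_add)

lemma relpow_le_of_refl:
  assumes "(a, b) \<in> R ^^ i" "i \<le> j" "(b, b) \<in> R" shows "(a, b) \<in> R ^^ j"
proof -
  have "(b, b) \<in> R ^^ k" for k using assms(3) by (induction k) auto
  from relpow_add_I[OF assms(1) this[of "j - i"]] show ?thesis using assms(2) by simp
qed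

lemma relpow_mult_I: "(a, a) \<in> R ^^ m \<Longrightarrow> (a, a) \<in> R ^^ (m * k)"
  by (induction k) (auto intro: relpow_add_I)

lemma funpow_succ_relpow:
  assumes "\<And>x. x \<in> X \<Longrightarrow> f x \<in> X \<and> (x, f x) \<in> E" "x \<in> X"
  shows "(x, (f ^^ k) x) \<in> E ^^ k \<and> (f ^^ k) x \<in> X"
  using assms by (induction k) auto

lemma funpow_pred_relpow:
  assumes "\<And>x. x \<in> X \<Longrightarrow> f x \<in> X \<and> (f x, x) \<in> E" "x \<in> X"
  shows "((f ^^ k) x, x) \<in> E ^^ k \<and> (f ^^ k) x \<in> X"
proof (induction k)
  case (Suc k)
  then show ?case using assms(1)[of "(f ^^ k) x"] relpow_Suc_I2[of "f ((f ^^ k) x)"] by auto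
qed (use assms in auto)

text \<open>\<open>f\<close> chooses successors in \<open>L\<close>, \<open>g\<close> predecessors
  in \<open>R\<close>, and \<open>M\<close> is a product of their idempotent exponents. The points
  \<open>(f ^^ M) x\<close> and \<open>(g ^^ M) x\<close> therefore lie on closed
  \<open>E\<close>-walks of one common length \<open>M\<close>.\<close>

lemma common_period:
  assumes "finite L" "finite R"
    and "\<And>x. x \<in> L \<Longrightarrow> \<exists>y\<in>L. (x, y) \<in> E" "\<And>x. x \<in> R \<Longrightarrow> \<exists>y\<in>R. (y, x) \<in> E"
  shows "\<exists>M f g. M > 0 \<and> (\<forall>x\<in>L. f x \<in> L \<and> (x, f x) \<in> E) \<and> (\<forall>x\<in>R. g x \<in> R \<and> (g x, x) \<in> E) \<and>
    (\<forall>x\<in>L. (f ^^ M) ((f ^^ M) x) = (f ^^ M) x) \<and> (\<forall>x\<in>R. (g ^^ M) ((g ^^ M) x) = (g ^^ M) x)"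
proof -
  from assms(3) obtain f where f: "\<And>x. x \<in> L \<Longrightarrow> f x \<in> L \<and> (x, f x) \<in> E" by metis
  from assms(4) obtain g where g: "\<And>x. x \<in> R \<Longrightarrow> g x \<in> R \<and> (g x, x) \<in> E" by metis
  obtain K where K: "K > 0" "\<And>x. x \<in> L \<Longrightarrow> (f ^^ K) ((f ^^ K) x) = (f ^^ K) x"
    using idempotent_funpow[of L f] assms f by blast
  obtain K' where K': "K' > 0" "\<And>x. x \<in> R \<Longrightarrow> (g ^^ K') ((g ^^ K') x) = (g ^^ K') x"
    using idempotent_funpow[of R g] assms g by blast
  have aux: "(h ^^ (k * m)) ((h ^^ (k * m)) x) = (h ^^ (k * m)) x"
    if h: "(h ^^ k) ((h ^^ k) x) = (h ^^ k) x" and m: "m > 0" for h :: "'a \<Rightarrow> 'a" and k m x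
  proof -
    obtain m' where m': "m = Suc m'" using m by (cases m) auto
    have a: "(h ^^ (k * m)) x = (h ^^ k) x"
      unfolding m' using funpow_fixed_mult[OF h, of m'] by (simp add: funpow_add funpow_swap1 add.commute flip: funpow_add)
        (metis add.commute comp_apply funpow_add)
    show ?thesis using funpow_fixed_mult[OF h, of m] a by simp
  qed
  have "\<forall>x\<in>L. (f ^^ (K * K')) ((f ^^ (K * K')) x) = (f ^^ (K * K')) x"
    using aux[of K f _ K'] K K' by blast
  moreover have "\<forall>x\<in>R. (g ^^ (K * K')) ((g ^^ (K * K')) x) = (g ^^ (K * K')) x"
    using aux[of K' g _ K] K K' by (simp add: mult.commute)
  moreover have "K * K' > 0" using K K' by simp
  ultimately show ?thesis using f g by blast
qed

text \<open>Write \<open>L = q * p + r\<close> with \<open>r < p \<le> q\<close>; of the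
  \<open>q\<close> rounds of length \<open>p\<close>, exactly \<open>r\<close> are replaced by
  rounds of length \<open>Suc p\<close>.\<close>

lemma relpow_consecutive:
  assumes "(a, a) \<in> R ^^ p" "(a, a) \<in> R ^^ Suc p" "0 < p" "p * p \<le> L"
  shows "(a, a) \<in> R ^^ L"
proof -
  define q r where "q = L div p" and "r = L mod p"
  have "r < p" using assms(3) by (simp add: r_def)
  moreover have "p \<le> q" using assms(3,4) by (simp add: q_def less_eq_div_iff_mult_less_eq)
  ultimately have "p * (q - r) + Suc p * r = L"
    using div_mult_mod_eq[of L p] by (simp add: q_def r_def algebra_simps diff_mult_distrib2)
  then show ?thesis using relpow_add_I[OF relpow_mult_I[OF assms(1), of "q - r"] relpow_mult_I[OF assms(2), of r]]
    by simp
qed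

text \<open>If \<open>g\<close> chooses predecessors, then \<open>D i (g y) (g y) (g (g y))\<close> is a predecessor of
  \<open>D i y (g y) (g y)\<close>; following the chain reaches \<open>g y\<close> from \<open>g\<^sup>n y\<close> in \<open>n\<close> steps instead of
  \<open>n - 1\<close>. Hence there are closed walks of two consecutive lengths.\<close>

lemma absorbed_loop:
  assumes "finite S" "S \<noteq> {}" "E \<subseteq> S \<times> S" "\<forall>b\<in>S. \<exists>a. (a, b) \<in> E" "jonsson_on S n D"
    "absorbs_rel n D D E (E \<union> Id_on S)"
  shows "\<exists>a\<in>S. (a, a) \<in> E"
  using assms
proof (induction S arbitrary: E rule: finite_psubset_induct)
  case (psubset S)
  note E = psubset.prems(2) and J = psubset.prems(4)
  have n: "n > 0" using J by (simp add: jonsson_on_def)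
  have D: "(D i a b c, D i a' b' c') \<in> E" if "i < n" "(a, a') \<in> E" "(b, b') \<in> E \<union> Id_on S" "(c, c') \<in> E"
    for i a a' b b' c c' using psubset.prems(5) that unfolding absorbs_rel_def by blast
  have smaller: ?case
    if T: "T \<subset> S" "T \<noteq> {}" "\<forall>t\<in>T. \<exists>a\<in>T. (a, t) \<in> E"
      "\<forall>i<n. \<forall>a\<in>T. \<forall>b\<in>T. \<forall>c\<in>T. D i a b c \<in> T" for T
  proof -
    have "\<exists>a\<in>T. (a, a) \<in> E \<inter> T \<times> T"
    proof (rule psubset.IH)
      show "jonsson_on T n D" using J T(1) jonsson_on_subset by blast
      show "absorbs_rel n D D (E \<inter> T \<times> T) (E \<inter> T \<times> T \<union> Id_on T)"
        unfolding absorbs_rel_def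
      proof (intro allI impI)
        fix i a a' b b' c c'
        assume *: "i < n" "(a, a') \<in> E \<inter> T \<times> T" "(b, b') \<in> E \<inter> T \<times> T \<union> Id_on T" "(c, c') \<in> E \<inter> T \<times> T"
        then have "(D i a b c, D i a' b' c') \<in> E" by (intro D) (use T(1) in auto)
        then show "(D i a b c, D i a' b' c') \<in> E \<inter> T \<times> T" using * T(4) by blast
      qed
    qed (use T in auto)
    then show ?thesis using T(1) by blast
  qed
  from psubset.prems(3) obtain g where g: "\<And>x. x \<in> S \<Longrightarrow> g x \<in> S \<and> (g x, x) \<in> E"
    using E by (metis mem_Sigma_iff subsetD)
  obtain M where M: "M > 0" "\<And>x. x \<in> S \<Longrightarrow> (g ^^ M) ((g ^^ M) x) = (g ^^ M) x"
    using idempotent_funpow[of S g] psubset.hyps(1) g by blast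
  obtain z where z: "z \<in> S" using psubset.prems(1) by blast
  define y where "y = (g ^^ M) z"
  have gS: "(g ^^ k) x \<in> S" if "x \<in> S" for k x using funpow_pred_relpow[of S g E x k] g that by blast
  have y: "y \<in> S" "(g ^^ M) y = y" using gS z M(2) by (auto simp: y_def)
  have walk: "((g ^^ Suc i) x, D i x (g x) (g x)) \<in> E ^^ Suc i" if "i < n" "x \<in> S" for i x
    using that
  proof (induction i arbitrary: x)
    case 0
    have "D 0 (g x) (g x) (g (g x)) = g x" using J g 0 unfolding jonsson_on_def by blast
    then show ?case using D[of 0 "g x" x "g x" "g x" "g (g x)" "g x"] 0 g by auto
  next
    case (Suc i)
    have "D i (g x) (g (g x)) (g (g x)) = D (Suc i) (g x) (g x) (g (g x))"
      using J g Suc.prems unfolding jonsson_on_def by blast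
    moreover have "(D (Suc i) (g x) (g x) (g (g x)), D (Suc i) x (g x) (g x)) \<in> E"
      using Suc.prems g by (intro D) auto
    moreover have "((g ^^ Suc i) (g x), D i (g x) (g (g x)) (g (g x))) \<in> E ^^ Suc i"
      using Suc g by auto
    ultimately have "((g ^^ Suc i) (g x), D (Suc i) x (g x) (g x)) \<in> E ^^ Suc (Suc i)"
      using relpow_Suc_I by metis
    then show ?case by (simp only: funpow_Suc_right comp_apply)
  qed
  define a where "a = (g ^^ n) y"
  \<comment> \<open>As \<open>y\<close> is fixed by \<open>g ^^ M\<close> and
    \<open>k + n = Suc (M * n)\<close>, \<open>k\<close> predecessor steps lead from
    \<open>a\<close> to \<open>g y\<close>. This closes both walks from \<open>a\<close> to
    \<open>g y\<close>, of lengths \<open>n\<close> and \<open>n - 1\<close>.\<close>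
  define k where "k = M * n - n + 1"
  have a: "a \<in> S" using gS y by (simp add: a_def)
  have w1: "(a, g y) \<in> E ^^ n"
  proof -
    have "D (n - 1) y (g y) (g y) = g y" using J y g unfolding jonsson_on_def by blast
    then show ?thesis using walk[of "n - 1" y] n y by (simp add: a_def)
  qed
  have w2: "(a, g y) \<in> E ^^ (n - 1)"
  proof -
    have "a = (g ^^ (n - 1)) (g y)" using n by (metis Suc_pred' a_def comp_apply funpow_Suc_right)
    then show ?thesis using funpow_pred_relpow[of S g E "g y" "n - 1"] g y by simp
  qed
  have w3: "(g y, a) \<in> E ^^ k"
  proof -
    have "(g ^^ k) a = (g ^^ (k + n)) y" by (simp add: a_def funpow_add)
    also have "k + n = Suc (M * n)" using M(1) by (simp add: k_def)
    also have "(g ^^ Suc (M * n)) y = g y" using funpow_fixed_mult[OF y(2), of n] by simp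
    finally show ?thesis using funpow_pred_relpow[of S g E a k] g a by simp
  qed
  define p where "p = n - 1 + k"
  have "p > 0" "Suc p = n + k" using n by (auto simp: p_def k_def)
  moreover have "(a, a) \<in> E ^^ p" using relpow_add_I[OF w2 w3] by (simp add: p_def)
  moreover have "(a, a) \<in> E ^^ (n + k)" using relpow_add_I[OF w1 w3] .
  ultimately have closed: "(a, a) \<in> E ^^ L" if "p * p \<le> L" for L
    using relpow_consecutive[of a p E L] that by metis
  define R where "R i = (E ^^ i) `` {a}" for i
  have R_Suc: "R (Suc i) = E `` R i" for i by (auto simp: R_def)
  have RS: "R i \<subseteq> S" for i by (induction i) (use R_Suc E a in \<open>auto simp: R_def\<close>)
  have Rcl: "\<forall>j<n. \<forall>b\<in>R i. \<forall>c\<in>R i. \<forall>d\<in>R i. D j b c d \<in> R i" for i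
  proof (intro allI impI ballI)
    fix j b c d assume *: "j < n" "b \<in> R i" "c \<in> R i" "d \<in> R i"
    have "absorbs_rel n D D E E" using psubset.prems(5) unfolding absorbs_rel_def by blast
    then have "(D j a a a, D j b c d) \<in> E ^^ i"
      using absorbs_rel_pow[of n D E E i] * unfolding absorbs_rel_def R_def by blast
    then show "D j b c d \<in> R i" using jonsson_on_idem[OF J a *(1)] by (simp add: R_def)
  qed
  define Rch where "Rch = (\<Union>i. R i)"
  have fin: "finite Rch" using RS psubset.hyps(1) unfolding Rch_def by (meson UN_least finite_subset)
  define m where "m b = (LEAST i. b \<in> R i)" for b
  define L1 where "L1 = p * p + sum m Rch"
  \<comment> \<open>A shortest walk from \<open>a\<close> to \<open>b\<close> is padded in front by
    a closed walk at \<open>a\<close>; \<open>L1\<close> leaves at least \<open>p * p\<close> steps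
    for the padding, whatever \<open>b\<close> is.\<close>
  have stable: "R L = Rch" if "L1 \<le> L" for L
  proof
    show "R L \<subseteq> Rch" by (auto simp: Rch_def)
    show "Rch \<subseteq> R L"
    proof
      fix b assume b: "b \<in> Rch"
      then have "b \<in> R (m b)" unfolding m_def Rch_def by (auto intro: LeastI)
      then have ab: "(a, b) \<in> E ^^ m b" by (simp add: R_def)
      have le: "m b \<le> sum m Rch" using b fin by (simp add: member_le_sum)
      then have "(a, a) \<in> E ^^ (L - m b)" using that by (intro closed) (simp add: L1_def)
      from relpow_add_I[OF this ab] show "b \<in> R L" using le that by (simp add: R_def L1_def)
    qed
  qed
  show ?case
  proof (cases "Rch = S")
    case False
    show ?thesis
    proof (rule smaller[of Rch])
      show "Rch \<subset> S" using False RS by (auto simp: Rch_def)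
      show "Rch \<noteq> {}" using closed[of "p * p"] by (auto simp: Rch_def R_def)
      show "\<forall>t\<in>Rch. \<exists>a\<in>Rch. (a, t) \<in> E" using stable[of L1] stable[of "Suc L1"] R_Suc[of L1] by auto
      show "\<forall>i<n. \<forall>a\<in>Rch. \<forall>b\<in>Rch. \<forall>c\<in>Rch. D i a b c \<in> Rch" using Rcl[of L1] stable[of L1] by simp
    qed
  next
    case True
    \<comment> \<open>If everything is reachable, the last layer that is not yet all of
      \<open>S\<close> is mapped by \<open>E\<close> onto \<open>S\<close>, so each of its own
      points has a predecessor in it.\<close>
    define i where "i = (LEAST i. R i = S)"
    have RiS: "R i = S" unfolding i_def by (rule LeastI[of _ L1]) (use stable[of L1] True in simp)
    show ?thesis
    proof (cases i)
      case 0
      then have "S = {a}" using RiS by (simp add: R_def)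
      then show ?thesis using g by auto
    next
      case (Suc i')
      have ne: "R i' \<noteq> S" using not_less_Least[of i' "\<lambda>i. R i = S"] Suc by (simp add: i_def)
      have img: "E `` R i' = S" using RiS Suc R_Suc by simp
      show ?thesis
      proof (rule smaller[of "R i'"])
        show "R i' \<subset> S" using ne RS by auto
        show "R i' \<noteq> {}" using img psubset.prems(1) by auto
        show "\<forall>t\<in>R i'. \<exists>a\<in>R i'. (a, t) \<in> E" using img RS by blast
      qed (rule Rcl)
    qed
  qed
qed

section \<open>Arc-consistent subnetworks\<close>

lemma relpow_relpow_rtrancl: "(a, b) \<in> (R ^^ m) ^^ n \<Longrightarrow> (a, b) \<in> R\<^sup>*"
proof (induction n arbitrary: b)
  case (Suc n)
  then obtain c where "(a, c) \<in> R\<^sup>*" "(c, b) \<in> R ^^ m" by auto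
  then show ?case by (meson relpow_imp_rtrancl rtrancl_trans)
qed simp

locale csp =
  fixes V :: "'v set" and Ed :: "('v \<times> 'v) set" and Sol :: "('v \<Rightarrow> 'a) set"
  assumes finite_V: "finite V" and Ed_sub: "Ed \<subseteq> V \<times> V" and sym_Ed: "sym Ed"
    and finite_image_Sol: "v \<in> V \<Longrightarrow> finite ((\<lambda>s. s v) ` Sol)"
begin

definition P :: "'v \<Rightarrow> 'a set" where "P v = (\<lambda>s. s v) ` Sol"

definition C :: "'v \<Rightarrow> 'v \<Rightarrow> ('a \<times> 'a) set" where "C u v = (\<lambda>s. (s u, s v)) ` Sol"

text \<open>The operations are indexed by the variable, and the Jonsson identities are only required
  on \<open>Q v\<close>, because a retraction of \<open>Q\<close> will be composed with them: it
  differs from variable to variable and fixes nothing but its image.\<close>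

definition jonsson_sub ::
  "('v \<Rightarrow> 'a set) \<Rightarrow> nat \<Rightarrow> (nat \<Rightarrow> 'v \<Rightarrow> 'a \<Rightarrow> 'a \<Rightarrow> 'a \<Rightarrow> 'a) \<Rightarrow> bool" where
  "jonsson_sub Q n D \<longleftrightarrow>
     (\<forall>v\<in>V. Q v \<subseteq> P v \<and> Q v \<noteq> {} \<and> jonsson_on (Q v) n (\<lambda>i. D i v)) \<and>
     (\<forall>v\<in>V. \<forall>i<n. \<forall>a\<in>Q v. \<forall>b\<in>P v. \<forall>c\<in>Q v. D i v a b c \<in> Q v) \<and>
     (\<forall>u v. (u, v) \<in> Ed \<longrightarrow> (\<forall>a\<in>Q u. \<exists>b\<in>Q v. (a, b) \<in> C u v)) \<and>
     (\<forall>u v. (u, v) \<in> Ed \<longrightarrow> absorbs_rel n (\<lambda>i. D i u) (\<lambda>i. D i v) (C u v \<inter> Q u \<times> Q v) (C u v))"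

lemma C_converse: "(a, b) \<in> C u v \<Longrightarrow> (b, a) \<in> C v u"
  by (auto simp: C_def)

lemma C_P: "(a, b) \<in> C u v \<Longrightarrow> a \<in> P u \<and> b \<in> P v"
  by (auto simp: C_def P_def)

lemma finite_P: "v \<in> V \<Longrightarrow> finite (P v)"
  using finite_image_Sol by (simp add: P_def)

lemma Ed_V: "(u, v) \<in> Ed \<Longrightarrow> u \<in> V \<and> v \<in> V"
  using Ed_sub by blast

lemma Ed_sym: "(u, v) \<in> Ed \<Longrightarrow> (v, u) \<in> Ed"
  using sym_Ed by (meson symD)

lemma
  assumes "jonsson_sub Q n D"
  shows jonsson_sub_P: "v \<in> V \<Longrightarrow> Q v \<subseteq> P v"
    and jonsson_sub_ne: "v \<in> V \<Longrightarrow> Q v \<noteq> {}"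
    and jonsson_sub_chain: "v \<in> V \<Longrightarrow> jonsson_on (Q v) n (\<lambda>i. D i v)"
    and jonsson_sub_closed:
      "v \<in> V \<Longrightarrow> i < n \<Longrightarrow> a \<in> Q v \<Longrightarrow> b \<in> P v \<Longrightarrow> c \<in> Q v \<Longrightarrow> D i v a b c \<in> Q v"
    and jonsson_sub_arc: "(u, v) \<in> Ed \<Longrightarrow> a \<in> Q u \<Longrightarrow> \<exists>b\<in>Q v. (a, b) \<in> C u v"
    and jonsson_sub_abs: "(u, v) \<in> Ed \<Longrightarrow>
      absorbs_rel n (\<lambda>i. D i u) (\<lambda>i. D i v) (C u v \<inter> Q u \<times> Q v) (C u v)"
  using assms unfolding jonsson_sub_def by blast+

lemma jonsson_sub_finite: "jonsson_sub Q n D \<Longrightarrow> v \<in> V \<Longrightarrow> finite (Q v)"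
  using jonsson_sub_P finite_P finite_subset by metis

lemma jonsson_sub_arc_back:
  "jonsson_sub Q n D \<Longrightarrow> (u, v) \<in> Ed \<Longrightarrow> b \<in> Q v \<Longrightarrow> \<exists>a\<in>Q u. (a, b) \<in> C u v"
  by (meson C_converse Ed_sym jonsson_sub_arc)

text \<open>\<open>E\<close> and \<open>F\<close> are the relations between \<open>u\<close> and \<open>v\<close> defined by a walk from \<open>u\<close> to \<open>v\<close> inside
  \<open>Q\<close> and inside \<open>P\<close>.\<close>

inductive pat :: "('v \<Rightarrow> 'a set) \<Rightarrow> 'v \<Rightarrow> 'v \<Rightarrow> ('a \<times> 'a) set \<Rightarrow> ('a \<times> 'a) set \<Rightarrow> bool"
  for Q u where
  base: "u \<in> V \<Longrightarrow> pat Q u u (Id_on (Q u)) (Id_on (P u))"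
| step: "pat Q u v E F \<Longrightarrow> (v, w) \<in> Ed \<Longrightarrow> pat Q u w (E O (C v w \<inter> Q v \<times> Q w)) (F O C v w)"

lemma pat_V: "pat Q u v E F \<Longrightarrow> u \<in> V \<and> v \<in> V"
  by (induction rule: pat.induct) (auto dest: Ed_V)

lemma pat_sub: "pat Q u v E F \<Longrightarrow> E \<subseteq> Q u \<times> Q v \<and> F \<subseteq> P u \<times> P v"
  by (induction rule: pat.induct) (auto dest: C_P)

lemma pat_mono: "pat Q u v E F \<Longrightarrow> jonsson_sub Q n D \<Longrightarrow> E \<subseteq> F"
proof (induction rule: pat.induct)
  case base
  then show ?case using jonsson_sub_P[of Q n D u] by auto
qed auto

lemma pat_Sol: "pat Q u v E F \<Longrightarrow> s \<in> Sol \<Longrightarrow> (s u, s v) \<in> F"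
proof (induction rule: pat.induct)
  case (step v E F w)
  then have "(s v, s w) \<in> C v w" by (auto simp: C_def)
  then show ?case using step by auto
qed (auto simp: P_def)

lemma pat_abs:
  assumes "pat Q u v E F" "jonsson_sub Q n D"
  shows "absorbs_rel n (\<lambda>i. D i u) (\<lambda>i. D i v) E F"
  using assms
proof (induction rule: pat.induct)
  case base
  then show ?case using jonsson_sub_closed[OF base(2,1)] unfolding absorbs_rel_def by blast
next
  case (step v E F w)
  then show ?case by (intro absorbs_rel_comp[OF _ jonsson_sub_abs]) auto
qed

lemma pat_total: "pat Q u v E F \<Longrightarrow> jonsson_sub Q n D \<Longrightarrow> a \<in> Q u \<Longrightarrow> \<exists>b\<in>Q v. (a, b) \<in> E"
proof (induction rule: pat.induct)
  case (step v E F w)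
  then obtain b where "b \<in> Q v" "(a, b) \<in> E" by blast
  then show ?case using jonsson_sub_arc[OF step(4,2)] by blast
qed auto

lemma pat_onto: "pat Q u v E F \<Longrightarrow> jonsson_sub Q n D \<Longrightarrow> b \<in> Q v \<Longrightarrow> \<exists>a\<in>Q u. (a, b) \<in> E"
proof (induction arbitrary: b rule: pat.induct)
  case (step v E F w)
  then obtain c where "c \<in> Q v" "(c, b) \<in> C v w" using jonsson_sub_arc_back[of Q n D v w b] by blast
  then show ?case using step.IH[of c] step.prems by blast
qed auto

lemma pat_trans:
  assumes "pat Q v w E' F'" "pat Q u v E F" shows "pat Q u w (E O E') (F O F')"
  using assms
proof (induction rule: pat.induct)
  case base
  then have "E O Id_on (Q v) = E" "F O Id_on (P v) = F" using pat_sub by blast+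
  then show ?case using base by simp
next
  case (step w' E' F' w)
  from pat.step[OF this(3)[OF step.prems] this(2)] show ?case by (simp only: O_assoc)
qed

text \<open>Every pair of a constraint lies on a global solution, so a step of a closed walk can be
  undone by following the walk once around along that solution.\<close>

lemma pat_reversible_aux:
  assumes "pat Q u v E F" "\<And>s. s \<in> Sol \<Longrightarrow> (s v, s u) \<in> G" "(a, b) \<in> F" "(c, b) \<in> F"
  shows "(c, a) \<in> (F O G)\<^sup>*"
  using assms
proof (induction arbitrary: G b c rule: pat.induct)
  case (step v E F w)
  obtain b0 where b0: "(a, b0) \<in> F" "(b0, b) \<in> C v w" using step.prems by blast
  then obtain s where s: "s \<in> Sol" "b0 = s v" "b = s w" by (auto simp: C_def)
  have "(s u, a) \<in> (F O (C v w O G))\<^sup>*"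
  proof (rule step.IH)
    show "(t v, t u) \<in> C v w O G" if "t \<in> Sol" for t
      using step.prems(1)[OF that] that by (auto simp: C_def)
    show "(s u, b0) \<in> F" using pat_Sol[OF step.hyps(1) s(1)] s by simp
  qed (rule b0)
  then have "(s u, a) \<in> ((F O C v w) O G)\<^sup>*" by (simp only: O_assoc)
  moreover have "(c, s u) \<in> (F O C v w) O G" using step.prems(1,3) s by blast
  ultimately show ?case by (meson converse_rtrancl_into_rtrancl)
qed auto

lemma pat_reversible:
  assumes "pat Q u u E F" "(a, b) \<in> F\<^sup>*" shows "(b, a) \<in> F\<^sup>*"
  using assms(2)
proof (induction rule: rtrancl_induct)
  case (step b c)
  have "c \<in> P u" using step pat_sub[OF assms(1)] by blast
  then obtain s where s: "s \<in> Sol" "c = s u" by (auto simp: P_def)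
  have "(c, b) \<in> (F O Id)\<^sup>*"
    by (rule pat_reversible_aux[OF assms(1)]) (use step s pat_Sol[OF assms(1) s(1)] in auto)
  then show ?case using step by simp
qed simp

text \<open>From \<open>a\<close>, \<open>E\<close>-steps lead to a point \<open>l\<close> on a
  closed \<open>E\<close>-walk; backwards from an \<open>E1\<close>-predecessor \<open>a'\<close> of
  \<open>a\<close> they lead to a point \<open>r\<close> on another one. These walks also run in
  \<open>P\<close>, where they can be reversed, so \<open>F\<close> leads from \<open>l\<close> to
  \<open>r\<close>. The chain turns this into an \<open>E\<close>-walk, which closes the circuit
  through \<open>a\<close>, \<open>l\<close>, \<open>r\<close>, \<open>a'\<close>.\<close>

lemma pat_return:
  assumes J: "jonsson_sub Q n D" and p: "pat Q y y E1 F1" and q: "pat Q y y E2 F2" and a: "a \<in> Q y"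
  shows "\<exists>j. (a, a) \<in> (E1 O E2) ^^ j O E1"
proof -
  define E F where "E = E1 O E2" and "F = F1 O F2"
  have pE: "pat Q y y E F" unfolding E_def F_def by (rule pat_trans[OF q p])
  have y: "y \<in> V" using pat_V[OF p] by simp
  have fin: "finite (Q y)" using J y jonsson_sub_finite by blast
  have t1: "\<exists>z\<in>Q y. (x, z) \<in> E" if "x \<in> Q y" for x using pat_total[OF pE J that] .
  have t2: "\<exists>z\<in>Q y. (z, x) \<in> E" if "x \<in> Q y" for x using pat_onto[OF pE J that] .
  obtain M f g where M: "M > 0"
    "\<forall>x\<in>Q y. f x \<in> Q y \<and> (x, f x) \<in> E" "\<forall>x\<in>Q y. g x \<in> Q y \<and> (g x, x) \<in> E"
    "\<forall>x\<in>Q y. (f ^^ M) ((f ^^ M) x) = (f ^^ M) x" "\<forall>x\<in>Q y. (g ^^ M) ((g ^^ M) x) = (g ^^ M) x"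
    using common_period[OF fin fin t1 t2] by blast
  obtain a' where a': "a' \<in> Q y" "(a', a) \<in> E1" using pat_onto[OF p J a] by blast
  define l r where "l = (f ^^ M) a" and "r = (g ^^ M) a'"
  have l: "l \<in> Q y" "(a, l) \<in> E ^^ M" "(l, l) \<in> E ^^ M"
    using funpow_succ_relpow[of "Q y" f E a M] funpow_succ_relpow[of "Q y" f E l M] M a by (auto simp: l_def)
  have r: "r \<in> Q y" "(r, a') \<in> E ^^ M" "(r, r) \<in> E ^^ M"
    using funpow_pred_relpow[of "Q y" g E a' M] funpow_pred_relpow[of "Q y" g E r M] M a' by (auto simp: r_def)
  have EF: "E \<subseteq> F" using pat_mono[OF pE J] .
  have "(a, l) \<in> E\<^sup>*" "(r, a') \<in> E\<^sup>*" using l r relpow_imp_rtrancl by blast+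
  then have "(a, l) \<in> F\<^sup>*" "(r, a') \<in> F\<^sup>*" using rtrancl_mono[OF EF] by blast+
  then have 1: "(l, a) \<in> F\<^sup>*" "(a', r) \<in> F\<^sup>*" using pat_reversible[OF pE] by blast+
  have refl: "(b, b) \<in> F2" "(b, b) \<in> F" if "b \<in> Q y" for b
  proof -
    have "b \<in> P y" using jonsson_sub_P[OF J y] that by blast
    then obtain s where s: "s \<in> Sol" "b = s y" by (auto simp: P_def)
    show "(b, b) \<in> F2" "(b, b) \<in> F" using pat_Sol[OF q s(1)] pat_Sol[OF pE s(1)] s by auto
  qed
  have "(a', a) \<in> F" using a' a refl pat_mono[OF p J] by (auto simp: F_def)
  then have "(a, a') \<in> F\<^sup>*" using pat_reversible[OF pE] by blast
  then have "(l, r) \<in> F\<^sup>*" using 1 by (meson rtrancl_trans)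
  then obtain k where "(l, r) \<in> F ^^ k" using rtrancl_imp_relpow by blast
  \<comment> \<open>The chain needs the loops at \<open>l\<close> and \<open>r\<close> and the
    \<open>F\<close>-walk in the same power; since \<open>F\<close> is reflexive on
    \<open>Q y\<close>, the walk can wait until its length is a multiple of
    \<open>M\<close>.\<close>
  then have lr: "(l, r) \<in> F ^^ (M * k)"
    by (rule relpow_le_of_refl) (use M(1) refl r in auto)
  have "(l, r) \<in> (E ^^ (M * k)) ^^ n"
    by (rule jonsson_walk[OF jonsson_sub_chain[OF J y] absorbs_rel_pow[OF pat_abs[OF pE J]] l(1) r(1)])
      (use l r lr relpow_mult_I in auto)
  then have "(l, r) \<in> E\<^sup>*" by (rule relpow_relpow_rtrancl)
  moreover have "(a, l) \<in> E\<^sup>*" "(r, a') \<in> E\<^sup>*" using l r relpow_imp_rtrancl by blast+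
  ultimately have "(a, a') \<in> E\<^sup>*" by (meson rtrancl_trans)
  then obtain j where "(a, a') \<in> E ^^ j" using rtrancl_imp_relpow by blast
  then show ?thesis using a' unfolding E_def by blast
qed

end

text \<open>A point with the smallest set of reachable points will do: whatever it reaches must
  reach just as much.\<close>

lemma exists_terminal:
  assumes "finite X" "x \<in> X" "R \<subseteq> X \<times> X"
  obtains t where "t \<in> X" "\<And>u. (t, u) \<in> R\<^sup>* \<Longrightarrow> (u, t) \<in> R\<^sup>*"
proof -
  have sub: "R\<^sup>* `` {y} \<subseteq> X" if "y \<in> X" for y
  proof
    fix z assume "z \<in> R\<^sup>* `` {y}"
    then have "(y, z) \<in> R\<^sup>*" by simp
    then show "z \<in> X" using that assms(3) by (induction rule: rtrancl_induct) auto
  qed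
  obtain t where t: "t \<in> X" "\<And>y. y \<in> X \<Longrightarrow> card (R\<^sup>* `` {t}) \<le> card (R\<^sup>* `` {y})"
    using ex_min_if_finite[of "(\<lambda>y. card (R\<^sup>* `` {y})) ` X"] assms by (metis (no_types, lifting) arg_min_if_finite(1) arg_min_least empty_iff)
  show ?thesis
  proof (rule that[OF t(1)])
    fix u assume u: "(t, u) \<in> R\<^sup>*"
    then have "u \<in> X" using sub t(1) by blast
    moreover have "R\<^sup>* `` {u} \<subseteq> R\<^sup>* `` {t}" using u by (auto intro: rtrancl_trans)
    moreover have "finite (R\<^sup>* `` {t})" using sub[OF t(1)] assms(1) finite_subset by blast
    ultimately have "R\<^sup>* `` {u} = R\<^sup>* `` {t}" using t(2)[of u] by (meson card_seteq)
    then show "(u, t) \<in> R\<^sup>*" by blast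
  qed
qed

section \<open>Shrinking along closed subsets\<close>

context csp
begin

definition closed_sub where
  "closed_sub n D v X \<longleftrightarrow> (\<forall>i<n. \<forall>a\<in>X. \<forall>b\<in>P v. \<forall>c\<in>X. D i v a b c \<in> X)"

text \<open>A middle argument \<open>b\<close> in \<open>P v\<close> is the value of some global
  solution, whose value at \<open>u\<close> is the matching middle argument there.\<close>

lemma closed_sub_Image:
  assumes J: "jonsson_sub Q n D" and e: "(u, v) \<in> Ed" and X: "X \<subseteq> Q u" "closed_sub n D u X"
  shows "closed_sub n D v ((C u v \<inter> Q u \<times> Q v) `` X)"
  unfolding closed_sub_def
proof (intro allI impI ballI)
  fix i a b c
  assume i: "i < n" and b: "b \<in> P v"
    and "a \<in> (C u v \<inter> Q u \<times> Q v) `` X" "c \<in> (C u v \<inter> Q u \<times> Q v) `` X"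
  then obtain a' c' where a': "a' \<in> X" "(a', a) \<in> C u v \<inter> Q u \<times> Q v"
    and c': "c' \<in> X" "(c', c) \<in> C u v \<inter> Q u \<times> Q v" by blast
  obtain b' where b': "(b', b) \<in> C u v" using b by (auto simp: P_def C_def)
  have "(D i u a' b' c', D i v a b c) \<in> C u v \<inter> Q u \<times> Q v"
    using jonsson_sub_abs[OF J e] i a' b' c' unfolding absorbs_rel_def by blast
  moreover have "D i u a' b' c' \<in> X" using X(2) i a' c' C_P[OF b'] unfolding closed_sub_def by blast
  ultimately show "D i v a b c \<in> (C u v \<inter> Q u \<times> Q v) `` X" by blast
qed

definition proper_closed where
  "proper_closed Q n D = {(v, X). v \<in> V \<and> X \<subset> Q v \<and> X \<noteq> {} \<and> closed_sub n D v X}"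

text \<open>An image that is all of \<open>Q v\<close> is no vertex of this graph: it puts no
  restriction on \<open>v\<close>, and propagation stops there.\<close>

definition closed_step where
  "closed_step Q n D = {((u, X), (v, Y)). (u, v) \<in> Ed \<and> Y = (C u v \<inter> Q u \<times> Q v) `` X \<and>
     (u, X) \<in> proper_closed Q n D \<and> (v, Y) \<in> proper_closed Q n D}"

lemma closed_step_pat:
  assumes "(p, q) \<in> (closed_step Q n D)\<^sup>*" "p \<in> proper_closed Q n D"
  shows "\<exists>E F. pat Q (fst p) (fst q) E F \<and> snd q = E `` snd p"
  using assms
proof (induction rule: rtrancl_induct)
  case base
  then have "pat Q (fst p) (fst p) (Id_on (Q (fst p))) (Id_on (P (fst p)))" "snd p = Id_on (Q (fst p)) `` snd p"
    by (auto simp: proper_closed_def intro: pat.base)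
  then show ?case by blast
next
  case (step q r)
  then obtain E F where EF: "pat Q (fst p) (fst q) E F" "snd q = E `` snd p" by blast
  let ?C = "C (fst q) (fst r)"
  have e: "(fst q, fst r) \<in> Ed" "snd r = (?C \<inter> Q (fst q) \<times> Q (fst r)) `` snd q"
    using step(2) by (auto simp: closed_step_def)
  have "snd r = (E O (?C \<inter> Q (fst q) \<times> Q (fst r))) `` snd p"
    unfolding e(2) EF(2) by (rule relcomp_Image[symmetric])
  then show ?case using pat.step[OF EF(1) e(1)] by blast
qed

text \<open>\<open>pat_return\<close> leads each \<open>a\<close> in \<open>X\<close> back to itself
  by rounds that map \<open>X\<close> to \<open>X\<close>, followed by a final passage from
  \<open>X\<close> to \<open>Y\<close>. Hence a strongly connected component carries at most one set
  per variable.\<close>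

lemma closed_step_unique:
  assumes J: "jonsson_sub Q n D" and p: "(y, X) \<in> proper_closed Q n D" "(y, Y) \<in> proper_closed Q n D"
    and XY: "((y, X), (y, Y)) \<in> (closed_step Q n D)\<^sup>*" and YX: "((y, Y), (y, X)) \<in> (closed_step Q n D)\<^sup>*"
  shows "X \<subseteq> Y"
proof
  obtain E1 F1 where 1: "pat Q y y E1 F1" "Y = E1 `` X" using closed_step_pat[OF XY p(1)] by auto
  obtain E2 F2 where 2: "pat Q y y E2 F2" "X = E2 `` Y" using closed_step_pat[OF YX p(2)] by auto
  fix a assume a: "a \<in> X"
  then have "a \<in> Q y" using p by (auto simp: proper_closed_def)
  from pat_return[OF J 1(1) 2(1) this] obtain j where j: "(a, a) \<in> (E1 O E2) ^^ j O E1" by blast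
  have "((E1 O E2) ^^ j) `` X = X"
  proof (induction j)
    case (Suc j)
    have "(E1 O E2) `` X = X" using 1(2) 2(2) by (simp add: relcomp_Image)
    then show ?case using Suc by (simp add: relcomp_Image)
  qed simp
  then show "a \<in> Y" using j a 1(2) by blast
qed

lemma shrink_closed:
  assumes J: "jonsson_sub Q n D" and p0: "p0 \<in> proper_closed Q n D"
  shows "\<exists>Q'. jonsson_sub Q' n D \<and> (\<forall>v\<in>V. Q' v \<subseteq> Q v) \<and> (\<exists>v\<in>V. Q' v \<noteq> Q v)"
proof -
  let ?\<Pi> = "proper_closed Q n D" and ?R = "closed_step Q n D"
  have "?\<Pi> \<subseteq> Sigma V (\<lambda>v. Pow (Q v))" by (auto simp: proper_closed_def)
  moreover have "finite (Sigma V (\<lambda>v. Pow (Q v)))"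
    using finite_V jonsson_sub_finite[OF J] by (intro finite_SigmaI) auto
  ultimately have "finite ?\<Pi>" by (rule finite_subset)
  moreover have "?R \<subseteq> ?\<Pi> \<times> ?\<Pi>" by (auto simp: closed_step_def)
  ultimately obtain t where t: "t \<in> ?\<Pi>" "\<And>u. (t, u) \<in> ?R\<^sup>* \<Longrightarrow> (u, t) \<in> ?R\<^sup>*"
    using exists_terminal p0 by metis
  define S where "S = ?R\<^sup>* `` {t}"
  have S\<Pi>: "p \<in> ?\<Pi>" if "p \<in> S" for p
  proof -
    have "(t, p) \<in> ?R\<^sup>*" using that by (simp add: S_def)
    then show ?thesis using t(1) by (induction rule: rtrancl_induct) (auto simp: closed_step_def)
  qed
  have uniq: "X = Y" if "(y, X) \<in> S" "(y, Y) \<in> S" for y X Y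
  proof -
    have "(t, (y, X)) \<in> ?R\<^sup>*" "(t, (y, Y)) \<in> ?R\<^sup>*" using that by (auto simp: S_def)
    then have "((y, X), (y, Y)) \<in> ?R\<^sup>*" "((y, Y), (y, X)) \<in> ?R\<^sup>*" using t(2) by (meson rtrancl_trans)+
    then show ?thesis using closed_step_unique[OF J S\<Pi> S\<Pi>] that by blast
  qed
  define Q' where "Q' v = (if \<exists>X. (v, X) \<in> S then THE X. (v, X) \<in> S else Q v)" for v
  have Q'S: "Q' v = X" if "(v, X) \<in> S" for v X
  proof -
    have "(THE X. (v, X) \<in> S) = X" using that uniq by (intro the_equality) blast+
    then show ?thesis using that by (auto simp: Q'_def)
  qed
  have Q'_sub: "Q' v \<subseteq> Q v" if "v \<in> V" for v
  proof (cases "\<exists>X. (v, X) \<in> S")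
    case True
    then show ?thesis using Q'S S\<Pi> by (fastforce simp: proper_closed_def)
  qed (simp add: Q'_def)
  have Q'_ne: "Q' v \<noteq> {}" if "v \<in> V" for v
  proof (cases "\<exists>X. (v, X) \<in> S")
    case True
    then show ?thesis using Q'S S\<Pi> by (fastforce simp: proper_closed_def)
  qed (use jonsson_sub_ne[OF J that] in \<open>simp add: Q'_def\<close>)
  have Q'_cl: "closed_sub n D v (Q' v)" if "v \<in> V" for v
  proof (cases "\<exists>X. (v, X) \<in> S")
    case True
    then show ?thesis using Q'S S\<Pi> by (fastforce simp: proper_closed_def)
  qed (use jonsson_sub_closed[OF J that] in \<open>simp add: Q'_def closed_sub_def\<close>)
  \<comment> \<open>Arc consistency is shown against the direction of the edge. If \<open>u\<close>
    is restricted to \<open>X\<close>, the image of \<open>X\<close> is either all of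
    \<open>Q v\<close> or again a member of \<open>S\<close>, so in both cases it covers
    \<open>Q' v\<close>. If \<open>u\<close> is unrestricted, arc consistency of \<open>Q\<close>
    suffices. Symmetry of \<open>Ed\<close> then gives the other direction.\<close>
  have arc_back: "\<exists>a\<in>Q' u. (a, b) \<in> C u v" if e: "(u, v) \<in> Ed" and b: "b \<in> Q' v" for u v b
  proof (cases "\<exists>X. (u, X) \<in> S")
    case True
    then obtain X where X: "(u, X) \<in> S" by blast
    then have Xp: "X \<subset> Q u" "X \<noteq> {}" "closed_sub n D u X" using S\<Pi> by (auto simp: proper_closed_def)
    define Y where "Y = (C u v \<inter> Q u \<times> Q v) `` X"
    have "Y \<noteq> {}" using Xp jonsson_sub_arc[OF J e] unfolding Y_def by blast
    moreover have "closed_sub n D v Y" unfolding Y_def using closed_sub_Image[OF J e] Xp by blast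
    moreover have "Y \<subseteq> Q v" by (auto simp: Y_def)
    ultimately have "Y = Q v \<or> (v, Y) \<in> ?\<Pi>" using Ed_V[OF e] by (auto simp: proper_closed_def)
    then have "Q' v \<subseteq> Y"
    proof
      assume "(v, Y) \<in> ?\<Pi>"
      then have "((u, X), (v, Y)) \<in> ?R" using e S\<Pi>[OF X] by (auto simp: closed_step_def Y_def)
      then have "(v, Y) \<in> S" using X unfolding S_def by (simp add: rtrancl.rtrancl_into_rtrancl)
      then show ?thesis using Q'S by simp
    qed (use Q'_sub Ed_V[OF e] in auto)
    then show ?thesis using b Q'S[OF X] by (auto simp: Y_def)
  next
    case False
    then have "Q' u = Q u" by (simp add: Q'_def)
    moreover have "b \<in> Q v" using Q'_sub Ed_V[OF e] b by blast
    ultimately show ?thesis using jonsson_sub_arc_back[OF J e] by simp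
  qed
  have "jonsson_sub Q' n D"
    unfolding jonsson_sub_def
  proof (intro conjI ballI allI impI)
    fix v assume v: "v \<in> V"
    show "Q' v \<subseteq> P v" using Q'_sub[OF v] jonsson_sub_P[OF J v] by blast
    show "Q' v \<noteq> {}" using Q'_ne[OF v] .
    show "jonsson_on (Q' v) n (\<lambda>i. D i v)" using jonsson_on_subset[OF jonsson_sub_chain[OF J v] Q'_sub[OF v]] .
    fix i a b c assume "i < n" "a \<in> Q' v" "b \<in> P v" "c \<in> Q' v"
    then show "D i v a b c \<in> Q' v" using Q'_cl[OF v] by (simp add: closed_sub_def)
  next
    fix u v a assume "(u, v) \<in> Ed" "a \<in> Q' u"
    then show "\<exists>b\<in>Q' v. (a, b) \<in> C u v" using arc_back[of v u a] Ed_sym C_converse by blast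
  next
    fix u v assume e: "(u, v) \<in> Ed"
    show "absorbs_rel n (\<lambda>i. D i u) (\<lambda>i. D i v) (C u v \<inter> Q' u \<times> Q' v) (C u v)"
      unfolding absorbs_rel_def
    proof (intro allI impI)
      fix i a a' b b' c c'
      assume *: "i < n" "(a, a') \<in> C u v \<inter> Q' u \<times> Q' v" "(b, b') \<in> C u v" "(c, c') \<in> C u v \<inter> Q' u \<times> Q' v"
      then have "(D i u a b c, D i v a' b' c') \<in> C u v"
        using jonsson_sub_abs[OF J e] Q'_sub Ed_V[OF e] unfolding absorbs_rel_def by blast
      then show "(D i u a b c, D i v a' b' c') \<in> C u v \<inter> Q' u \<times> Q' v"
        using * Q'_cl Ed_V[OF e] C_P[OF *(3)] unfolding closed_sub_def by blast
    qed
  qed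
  moreover have "\<exists>v\<in>V. Q' v \<noteq> Q v"
  proof -
    obtain v X where vX: "t = (v, X)" by (cases t)
    then have "Q' v = X" by (intro Q'S) (simp add: S_def)
    then show ?thesis using t(1) vX by (auto simp: proper_closed_def)
  qed
  ultimately show ?thesis using Q'_sub by blast
qed


section \<open>Retractions by unary polynomials\<close>

definition endo :: "('v \<Rightarrow> 'a set) \<Rightarrow> ('v \<Rightarrow> 'a \<Rightarrow> 'a) \<Rightarrow> bool" where
  "endo Q g \<longleftrightarrow> (\<forall>v\<in>V. \<forall>a\<in>Q v. g v a \<in> Q v) \<and>
     (\<forall>u v. (u, v) \<in> Ed \<longrightarrow> (\<forall>a\<in>Q u. \<forall>b\<in>Q v. (a, b) \<in> C u v \<longrightarrow> (g u a, g v b) \<in> C u v))"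

lemma endo_funpow: "endo Q g \<Longrightarrow> endo Q (\<lambda>v. g v ^^ k)"
proof (induction k)
  case (Suc k)
  then have k: "endo Q (\<lambda>v. g v ^^ k)" by simp
  show ?case unfolding endo_def
  proof (intro conjI ballI allI impI)
    fix v a assume "v \<in> V" "a \<in> Q v"
    then show "(g v ^^ Suc k) a \<in> Q v" using Suc.prems k by (simp add: endo_def)
  next
    fix u v a b assume *: "(u, v) \<in> Ed" "a \<in> Q u" "b \<in> Q v" "(a, b) \<in> C u v"
    then have "(g u ^^ k) a \<in> Q u" "(g v ^^ k) b \<in> Q v" "((g u ^^ k) a, (g v ^^ k) b) \<in> C u v"
      using k Ed_V[OF *(1)] by (auto simp: endo_def)
    then show "((g u ^^ Suc k) a, (g v ^^ Suc k) b) \<in> C u v" using Suc.prems *(1) by (simp add: endo_def)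
  qed
qed (simp add: endo_def)

text \<open>An idempotent power \<open>h\<close> of \<open>g\<close> retracts \<open>Q\<close> to
  its image. There \<open>h\<close> composed with \<open>D\<close> is again a chain, since
  \<open>h\<close> fixes the image pointwise; the image at \<open>x\<close> is proper since
  \<open>h\<close> identifies \<open>a\<close> and \<open>b\<close>.\<close>

lemma shrink_endo:
  assumes J: "jonsson_sub Q n D" and g: "endo Q g" and x: "x \<in> V" "a \<in> Q x" "b \<in> Q x" "a \<noteq> b" "g x a = g x b"
  shows "\<exists>Q' D'. jonsson_sub Q' n D' \<and> (\<forall>v\<in>V. Q' v \<subseteq> Q v) \<and> (\<exists>v\<in>V. Q' v \<noteq> Q v)"
proof -
  \<comment> \<open>Acting on pairs of a variable and a value yields one exponent for all
    variables.\<close>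
  define H where "H p = (fst p, g (fst p) (snd p))" for p
  have Hk: "(H ^^ k) (v, c) = (v, (g v ^^ k) c)" for k v c by (induction k) (auto simp: H_def)
  have "finite (Sigma V Q)" using finite_V jonsson_sub_finite[OF J] by blast
  moreover have "H p \<in> Sigma V Q" if "p \<in> Sigma V Q" for p using g that by (auto simp: H_def endo_def)
  ultimately obtain K where K: "K > 0" "\<forall>p\<in>Sigma V Q. (H ^^ K) ((H ^^ K) p) = (H ^^ K) p"
    using idempotent_funpow by blast
  define h where "h v = g v ^^ K" for v
  have hh: "h v (h v c) = h v c" if "v \<in> V" "c \<in> Q v" for v c
  proof -
    have "(H ^^ K) ((H ^^ K) (v, c)) = (H ^^ K) (v, c)" using K(2) that by blast
    then show ?thesis by (simp add: Hk h_def)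
  qed
  have h: "endo Q h" unfolding h_def by (rule endo_funpow[OF g])
  then have hQ: "h v c \<in> Q v" if "v \<in> V" "c \<in> Q v" for v c using that by (simp add: endo_def)
  have hC: "(h u c, h v d) \<in> C u v" if "(u, v) \<in> Ed" "c \<in> Q u" "d \<in> Q v" "(c, d) \<in> C u v" for u v c d
    using h that by (simp add: endo_def)
  define Q' where "Q' v = h v ` Q v" for v
  define D' where "D' i v c d e = h v (D i v c d e)" for i v c d e
  have Q'Q: "Q' v \<subseteq> Q v" if "v \<in> V" for v using hQ that by (auto simp: Q'_def)
  have h_fix: "h v c = c" if "v \<in> V" "c \<in> Q' v" for v c using that hh by (auto simp: Q'_def)
  have cl: "D' i v c d e \<in> Q' v" if "v \<in> V" "i < n" "c \<in> Q' v" "d \<in> P v" "e \<in> Q' v" for i v c d e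
  proof -
    have "D i v c d e \<in> Q v" using jonsson_sub_closed[OF J that(1,2) _ that(4)] Q'Q[OF that(1)] that(3,5) by blast
    then show ?thesis by (simp add: Q'_def D'_def)
  qed
  have "jonsson_sub Q' n D'"
    unfolding jonsson_sub_def
  proof (intro conjI ballI allI impI)
    fix v assume v: "v \<in> V"
    show "Q' v \<subseteq> P v" using Q'Q[OF v] jonsson_sub_P[OF J v] by blast
    show "Q' v \<noteq> {}" using jonsson_sub_ne[OF J v] by (simp add: Q'_def)
    have "jonsson_on (Q' v) n (\<lambda>i. D i v)" using jonsson_on_subset[OF jonsson_sub_chain[OF J v] Q'Q[OF v]] .
    then show "jonsson_on (Q' v) n (\<lambda>i. D' i v)" using h_fix[OF v] unfolding jonsson_on_def D'_def by metis
    fix i c d e assume "i < n" "c \<in> Q' v" "d \<in> P v" "e \<in> Q' v"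
    then show "D' i v c d e \<in> Q' v" using cl v by blast
  next
    fix u v c assume e: "(u, v) \<in> Ed" "c \<in> Q' u"
    then obtain c0 where c0: "c0 \<in> Q u" "c = h u c0" by (auto simp: Q'_def)
    then obtain d0 where "d0 \<in> Q v" "(c0, d0) \<in> C u v" using jonsson_sub_arc[OF J e(1)] by blast
    then show "\<exists>d\<in>Q' v. (c, d) \<in> C u v" using hC[OF e(1) c0(1)] c0 by (auto simp: Q'_def)
  next
    fix u v assume e: "(u, v) \<in> Ed"
    then have uv: "u \<in> V" "v \<in> V" using Ed_V by auto
    show "absorbs_rel n (\<lambda>i. D' i u) (\<lambda>i. D' i v) (C u v \<inter> Q' u \<times> Q' v) (C u v)"
      unfolding absorbs_rel_def
    proof (intro allI impI)
      fix i c c' d d' e e'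
      assume *: "i < n" "(c, c') \<in> C u v \<inter> Q' u \<times> Q' v" "(d, d') \<in> C u v" "(e, e') \<in> C u v \<inter> Q' u \<times> Q' v"
      then have "(D i u c d e, D i v c' d' e') \<in> C u v \<inter> Q u \<times> Q v"
        using jonsson_sub_abs[OF J \<open>(u, v) \<in> Ed\<close>] Q'Q uv unfolding absorbs_rel_def by blast
      then have "(D' i u c d e, D' i v c' d' e') \<in> C u v" using hC[OF \<open>(u, v) \<in> Ed\<close>] by (auto simp: D'_def)
      then show "(D' i u c d e, D' i v c' d' e') \<in> C u v \<inter> Q' u \<times> Q' v" using cl uv * C_P[OF *(3)] by blast
    qed
  qed
  moreover have "Q' x \<noteq> Q x"
  proof
    assume "Q' x = Q x"
    then have "h x a = a" "h x b = b" using h_fix x by auto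
    moreover have "h x a = h x b" using K(1) x(5) by (cases K) (auto simp: h_def funpow_Suc_right simp del: funpow.simps)
    ultimately show False using x by simp
  qed
  ultimately show ?thesis using Q'Q x(1) by blast
qed

text \<open>One map per variable, built in the same way everywhere. Constants are global solutions,
  so that all edges are respected; their values lie in \<open>P\<close> and not always in
  \<open>Q\<close>, so they may only enter as middle arguments.\<close>

inductive upoly :: "nat \<Rightarrow> (nat \<Rightarrow> 'v \<Rightarrow> 'a \<Rightarrow> 'a \<Rightarrow> 'a \<Rightarrow> 'a) \<Rightarrow> ('v \<Rightarrow> 'a \<Rightarrow> 'a) \<Rightarrow> bool" for n D where
  upoly_id: "upoly n D (\<lambda>v a. a)"
| upoly_const: "upoly n D g \<Longrightarrow> upoly n D g' \<Longrightarrow> s \<in> Sol \<Longrightarrow> i < n \<Longrightarrow>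
    upoly n D (\<lambda>v a. D i v (g v a) (s v) (g' v a))"
| upoly_comp: "upoly n D g \<Longrightarrow> upoly n D g' \<Longrightarrow> upoly n D g'' \<Longrightarrow> i < n \<Longrightarrow>
    upoly n D (\<lambda>v a. D i v (g v a) (g' v a) (g'' v a))"

lemma upoly_endo:
  assumes "upoly n D g" and J: "jonsson_sub Q n D" shows "endo Q g"
  using assms(1)
proof (induction rule: upoly.induct)
  case upoly_id
  show ?case by (simp add: endo_def)
next
  case (upoly_const g g' s i)
  have s: "s v \<in> P v" "(s u, s v) \<in> C u v" for u v using upoly_const(3) by (auto simp: P_def C_def)
  show ?case unfolding endo_def
  proof (intro conjI ballI allI impI)
    fix v a assume "v \<in> V" "a \<in> Q v"
    then show "D i v (g v a) (s v) (g' v a) \<in> Q v"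
      using upoly_const jonsson_sub_closed[OF J] s by (simp add: endo_def)
  next
    fix u v a b assume *: "(u, v) \<in> Ed" "a \<in> Q u" "b \<in> Q v" "(a, b) \<in> C u v"
    then have "(g u a, g v b) \<in> C u v \<inter> Q u \<times> Q v" "(g' u a, g' v b) \<in> C u v \<inter> Q u \<times> Q v"
      using upoly_const.IH Ed_V[OF *(1)] by (simp_all add: endo_def)
    then show "(D i u (g u a) (s u) (g' u a), D i v (g v b) (s v) (g' v b)) \<in> C u v"
      using jonsson_sub_abs[OF J *(1)] s(2)[of u v] upoly_const(4) unfolding absorbs_rel_def by blast
  qed
next
  case (upoly_comp g g' g'' i)
  show ?case unfolding endo_def
  proof (intro conjI ballI allI impI)
    fix v a assume "v \<in> V" "a \<in> Q v"
    then show "D i v (g v a) (g' v a) (g'' v a) \<in> Q v"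
      using upoly_comp jonsson_sub_closed[OF J] jonsson_sub_P[OF J \<open>v \<in> V\<close>] by (simp add: endo_def subset_iff)
  next
    fix u v a b assume *: "(u, v) \<in> Ed" "a \<in> Q u" "b \<in> Q v" "(a, b) \<in> C u v"
    then have "(g u a, g v b) \<in> C u v \<inter> Q u \<times> Q v" "(g' u a, g' v b) \<in> C u v" "(g'' u a, g'' v b) \<in> C u v \<inter> Q u \<times> Q v"
      using upoly_comp.IH Ed_V[OF *(1)] by (simp_all add: endo_def)
    then show "(D i u (g u a) (g' u a) (g'' u a), D i v (g v b) (g' v b) (g'' v b)) \<in> C u v"
      using jonsson_sub_abs[OF J *(1)] upoly_comp(4) unfolding absorbs_rel_def by blast
  qed
qed

text \<open>If no proper subset of \<open>Q x\<close> is closed, then the unary polynomials with constants from \<open>Sol\<close>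
  act transitively on \<open>Q x\<close>, and the orbit of a pair of distinct points contains a loop.\<close>

lemma not_injective_upoly:
  assumes J: "jonsson_sub Q n D" and x: "x \<in> V" "s \<in> Q x" "s' \<in> Q x"
    and min: "\<And>X. (x, X) \<notin> proper_closed Q n D"
  shows "\<exists>g. upoly n D g \<and> g x s = g x s'"
proof -
  define E where "E = {(g x s, g x s') | g. upoly n D g}"
  define T where "T = {g x s' | g. upoly n D g}"
  have TI: "g x s' \<in> T" and EI: "(g x s, g x s') \<in> E" if "upoly n D g" for g
    using that by (auto simp: T_def E_def)
  have gQ: "g x c \<in> Q x" if "upoly n D g" "c \<in> Q x" for g c
    using upoly_endo[OF that(1) J] x(1) that(2) by (simp add: endo_def)
  have "s' \<in> T" using TI[OF upoly_id] .
  moreover have "T \<subseteq> Q x" using gQ x by (auto simp: T_def)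
  moreover have "closed_sub n D x T"
    unfolding closed_sub_def
  proof (intro allI impI ballI)
    fix i a b c assume i: "i < n" and "a \<in> T" "b \<in> P x" "c \<in> T"
    then obtain g g' t where g: "upoly n D g" "upoly n D g'" "t \<in> Sol" "a = g x s'" "c = g' x s'" "b = t x"
      by (auto simp: T_def P_def)
    show "D i x a b c \<in> T" using TI[OF upoly_const[OF g(1-3) i]] g by simp
  qed
  \<comment> \<open>Transitivity: the orbit of \<open>s'\<close> is closed and nonempty, so it is
    not proper. Every point of \<open>Q x\<close> thus has an \<open>E\<close>-predecessor.\<close>
  ultimately have T: "T = Q x" using min[of T] x(1) by (auto simp: proper_closed_def)
  have "\<exists>a\<in>Q x. (a, a) \<in> E"
  proof (rule absorbed_loop)
    show "finite (Q x)" "Q x \<noteq> {}" using jonsson_sub_finite[OF J x(1)] x(2) by auto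
    show "E \<subseteq> Q x \<times> Q x" using gQ x by (auto simp: E_def)
    show "\<forall>b\<in>Q x. \<exists>a. (a, b) \<in> E" unfolding T[symmetric] by (auto simp: E_def T_def)
    show "jonsson_on (Q x) n (\<lambda>i. D i x)" using jonsson_sub_chain[OF J x(1)] .
    show "absorbs_rel n (\<lambda>i. D i x) (\<lambda>i. D i x) E (E \<union> Id_on (Q x))"
      unfolding absorbs_rel_def
    proof (intro allI impI)
      fix i a a' b b' c c'
      assume i: "i < n" and a: "(a, a') \<in> E" and b: "(b, b') \<in> E \<union> Id_on (Q x)" and c: "(c, c') \<in> E"
      from a obtain g where g: "upoly n D g" "a = g x s" "a' = g x s'" by (auto simp: E_def)
      from c obtain h where h: "upoly n D h" "c = h x s" "c' = h x s'" by (auto simp: E_def)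
      from b show "(D i x a b c, D i x a' b' c') \<in> E"
      proof
        assume "(b, b') \<in> E"
        then obtain k where k: "upoly n D k" "b = k x s" "b' = k x s'" by (auto simp: E_def)
        show ?thesis using EI[OF upoly_comp[OF g(1) k(1) h(1) i]] g h k by simp
      next
        \<comment> \<open>A diagonal pair in the middle is a constant, realised by a solution
          through \<open>b\<close>; this makes \<open>E\<close> absorbed by the reflexive relation
          as well.\<close>
        assume "(b, b') \<in> Id_on (Q x)"
        then have "b = b'" "b \<in> P x" using jonsson_sub_P[OF J x(1)] by auto
        then obtain t where t: "t \<in> Sol" "b = t x" "b' = t x" by (auto simp: P_def)
        show ?thesis using EI[OF upoly_const[OF g(1) h(1) t(1) i]] g h t by simp
      qed
    qed
  qed
  then show ?thesis by (auto simp: E_def)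
qed

theorem jonsson_sub_solution:
  assumes "jonsson_sub Q n D"
  shows "\<exists>q. (\<forall>v\<in>V. q v \<in> Q v) \<and> (\<forall>(u, v)\<in>Ed. (q u, q v) \<in> C u v)"
  using assms
proof (induction "\<Sum>v\<in>V. card (Q v)" arbitrary: Q D rule: less_induct)
  case less
  note J = less.prems
  have reduce: ?case
    if Q': "jonsson_sub Q' n D'" "\<forall>v\<in>V. Q' v \<subseteq> Q v" "\<exists>v\<in>V. Q' v \<noteq> Q v" for Q' D'
  proof -
    obtain w where w: "w \<in> V" "Q' w \<subset> Q w" using Q' by blast
    have "(\<Sum>v\<in>V. card (Q' v)) < (\<Sum>v\<in>V. card (Q v))"
    proof (rule sum_strict_mono_ex1[OF finite_V])
      show "\<forall>v\<in>V. card (Q' v) \<le> card (Q v)" using Q'(2) jonsson_sub_finite[OF J] by (simp add: card_mono)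
      show "\<exists>v\<in>V. card (Q' v) < card (Q v)" using w jonsson_sub_finite[OF J] psubset_card_mono by blast
    qed
    from less.hyps[OF this Q'(1)] show ?thesis using Q'(2) by blast
  qed
  show ?case
  proof (cases "\<exists>x\<in>V. \<exists>a\<in>Q x. \<exists>b\<in>Q x. a \<noteq> b")
    case True
    then obtain x a b where x: "x \<in> V" "a \<in> Q x" "b \<in> Q x" "a \<noteq> b" by blast
    show ?thesis
    proof (cases "\<exists>X. (x, X) \<in> proper_closed Q n D")
      case True
      then show ?thesis using shrink_closed[OF J] reduce by blast
    next
      case False
      then obtain g where "upoly n D g" "g x a = g x b" using not_injective_upoly[OF J x(1-3)] by blast
      then show ?thesis using shrink_endo[OF J upoly_endo[OF _ J] x] reduce by blast
    qed
  next
    case False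
    \<comment> \<open>All \<open>Q v\<close> are singletons now, and arc consistency alone makes
      their elements compatible.\<close>
    define q where "q v = (SOME a. a \<in> Q v)" for v
    have q: "q v \<in> Q v" if "v \<in> V" for v using jonsson_sub_ne[OF J that] by (simp add: q_def some_in_eq)
    have "(q u, q v) \<in> C u v" if e: "(u, v) \<in> Ed" for u v
    proof -
      obtain b where "b \<in> Q v" "(q u, b) \<in> C u v" using jonsson_sub_arc[OF J e] q Ed_V[OF e] by blast
      then show ?thesis using False q Ed_V[OF e] by metis
    qed
    then show ?thesis using q by blast
  qed
qed

end

section \<open>Labelled networks\<close>

lemma relpow_subset:
  fixes E :: "('a \<times> 'a) set"
  shows "(a, b) \<in> E ^^ k \<Longrightarrow> E \<subseteq> F \<Longrightarrow> (a, b) \<in> F ^^ k"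
  by (induction k arbitrary: b) auto

text \<open>The type of a node of a tree is the pair of the set of values admitted by the subtree below the node
  and the set of values admitted by the rest of the tree. A segment connects the types of two nodes of a
  branch; \<open>F\<close> arises from \<open>E\<close> by dropping the labels between them.\<close>

definition weak_seg where
  "weak_seg n D p q E F \<longleftrightarrow> E \<subseteq> F \<and> absorbs_rel n D D E F \<and> E `` snd p \<subseteq> snd q \<and>
     (\<forall>r\<in>snd q. \<exists>r0\<in>snd p. (r0, r) \<in> E) \<and> (\<forall>l\<in>fst p. \<exists>l1\<in>fst q. (l, l1) \<in> E)"

definition seg where
  "seg n D p q \<longleftrightarrow> (\<exists>E F. weak_seg n D p q E F \<and> (\<exists>u\<in>snd p. \<exists>w\<in>fst q. (u, w) \<in> F))"

text \<open>The pair witnessing \<open>seg\<close> is prolonged by an \<open>E'\<close>-step, and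
  \<open>E' \<subseteq> F'\<close>. So \<open>seg\<close> is inherited by all nodes further down the
  branch.\<close>

lemma seg_weak_seg:
  assumes "seg n D p q" "weak_seg n D q r E' F'" shows "seg n D p r"
proof -
  obtain E F u w where EF: "weak_seg n D p q E F" "u \<in> snd p" "w \<in> fst q" "(u, w) \<in> F"
    using assms(1) unfolding seg_def by blast
  obtain z where z: "z \<in> fst r" "(w, z) \<in> E'" using assms(2) EF(3) unfolding weak_seg_def by blast
  have 1: "E \<subseteq> F" "absorbs_rel n D D E F" "E `` snd p \<subseteq> snd q" "\<forall>r\<in>snd q. \<exists>r0\<in>snd p. (r0, r) \<in> E"
    "\<forall>l\<in>fst p. \<exists>l1\<in>fst q. (l, l1) \<in> E" using EF(1) unfolding weak_seg_def by blast+
  have 2: "E' \<subseteq> F'" "absorbs_rel n D D E' F'" "E' `` snd q \<subseteq> snd r" "\<forall>r\<in>snd r. \<exists>r0\<in>snd q. (r0, r) \<in> E'"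
    "\<forall>l\<in>fst q. \<exists>l1\<in>fst r. (l, l1) \<in> E'" using assms(2) unfolding weak_seg_def by blast+
  have "weak_seg n D p r (E O E') (F O F')"
    unfolding weak_seg_def
  proof (intro conjI)
    show "E O E' \<subseteq> F O F'" using 1(1) 2(1) by blast
    show "absorbs_rel n D D (E O E') (F O F')" using absorbs_rel_comp[OF 1(2) 2(2)] .
    show "(E O E') `` snd p \<subseteq> snd r" using 1(3) 2(3) by blast
    show "\<forall>x\<in>snd r. \<exists>r0\<in>snd p. (r0, x) \<in> E O E'" using 1(4) 2(4) by (meson relcompI)
    show "\<forall>l\<in>fst p. \<exists>l1\<in>fst r. (l, l1) \<in> E O E'" using 1(5) 2(5) by (meson relcompI)
  qed
  moreover have "(u, z) \<in> F O F'" using EF(4) z(2) 2(1) by blast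
  ultimately show ?thesis using EF(2) z(1) unfolding seg_def by blast
qed

text \<open>A repeated type can be pumped: walks of \<open>E\<close> circulate inside \<open>R\<close> and inside \<open>L\<close>, the relation \<open>F\<close>
  leads from \<open>R\<close> to \<open>L\<close>, so by the Jonsson chain \<open>E\<close> itself leads from \<open>R\<close> to \<open>L\<close>.\<close>

lemma seg_pump:
  assumes "seg n D (L, R) (L, R)" and J: "jonsson_on S n D" and S: "L \<subseteq> S" "R \<subseteq> S" "finite S"
  shows "L \<inter> R \<noteq> {}"
proof -
  obtain E F u w where EF: "E \<subseteq> F" "absorbs_rel n D D E F" "E `` R \<subseteq> R"
    "\<forall>r\<in>R. \<exists>r0\<in>R. (r0, r) \<in> E" "\<forall>l\<in>L. \<exists>l1\<in>L. (l, l1) \<in> E" and u: "u \<in> R" and w: "w \<in> L" and uw: "(u, w) \<in> F"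
    using assms(1) unfolding seg_def weak_seg_def by auto
  have "finite L" "finite R" using S finite_subset by blast+
  then obtain M f g where M: "M > 0" "\<forall>x\<in>L. f x \<in> L \<and> (x, f x) \<in> E" "\<forall>x\<in>R. g x \<in> R \<and> (g x, x) \<in> E"
    "\<forall>x\<in>L. (f ^^ M) ((f ^^ M) x) = (f ^^ M) x" "\<forall>x\<in>R. (g ^^ M) ((g ^^ M) x) = (g ^^ M) x"
    using common_period[of L R E] EF(4,5) by blast
  define l where "l = (f ^^ M) w"
  \<comment> \<open>The exponent is \<open>M - 1\<close> so that the walk through \<open>r\<close>,
    \<open>u'\<close>, \<open>u\<close>, \<open>w\<close>, \<open>l\<close>, of lengths
    \<open>M\<close>, \<open>M - 1\<close>, \<open>1\<close> and \<open>M\<close>, has total length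
    \<open>M * 3\<close>, for which \<open>r\<close> and \<open>l\<close> have loops.\<close>
  define u' where "u' = (g ^^ (M - 1)) u"
  define r where "r = (g ^^ M) u'"
  have l: "l \<in> L" "(w, l) \<in> E ^^ M" "(l, l) \<in> E ^^ M"
    using funpow_succ_relpow[of L f E w M] funpow_succ_relpow[of L f E l M] M w by (auto simp: l_def)
  have u': "u' \<in> R" "(u', u) \<in> E ^^ (M - 1)"
    using funpow_pred_relpow[of R g E u "M - 1"] M u by (auto simp: u'_def)
  have r: "r \<in> R" "(r, u') \<in> E ^^ M" "(r, r) \<in> E ^^ M"
    using funpow_pred_relpow[of R g E u' M] funpow_pred_relpow[of R g E r M] M u' by (auto simp: r_def)
  have "(r, u) \<in> E ^^ (M + (M - 1))" using r u' relpow_add_I by metis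
  then have "(r, w) \<in> F ^^ Suc (M + (M - 1))" using relpow_subset[OF _ EF(1)] uw by auto
  then have "(r, l) \<in> F ^^ (Suc (M + (M - 1)) + M)" using relpow_subset[OF l(2) EF(1)] relpow_add_I by metis
  moreover have "Suc (M + (M - 1)) + M = M * 3" using M(1) by simp
  ultimately have "(r, l) \<in> F ^^ (M * 3)" by metis
  then have "(r, l) \<in> (E ^^ (M * 3)) ^^ n"
    using jonsson_walk[OF J absorbs_rel_pow[OF EF(2)], of r l "M * 3"] relpow_mult_I[OF r(3), of 3]
      relpow_mult_I[OF l(3), of 3] r l S by blast
  then have "(r, l) \<in> E\<^sup>*" by (rule relpow_relpow_rtrancl)
  then have "l \<in> R" using r(1) EF(3) by (induction rule: rtrancl_induct) auto
  then show ?thesis using l by blast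
qed

text \<open>A tree stands for a formula in one free variable, the value at its root:
  \<open>Meet\<close> is conjunction, \<open>Step\<close> an existential quantifier along an edge,
  and only \<open>Lab\<close> uses a label.\<close>

datatype 'v tree = Top 'v | Lab 'v | Meet "'v tree" "'v tree" | Step 'v "'v tree"

fun root :: "'v tree \<Rightarrow> 'v" where
  "root (Top v) = v" | "root (Lab v) = v" | "root (Meet s t) = root s" | "root (Step v t) = v"

fun nlab :: "'v tree \<Rightarrow> nat" where
  "nlab (Top v) = 0" | "nlab (Lab v) = 1" | "nlab (Meet s t) = nlab s + nlab t" | "nlab (Step v t) = nlab t"

fun labs :: "'v tree \<Rightarrow> 'v set" where
  "labs (Top v) = {}" | "labs (Lab v) = {v}" | "labs (Meet s t) = labs s \<union> labs t" | "labs (Step v t) = labs t"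

lemma finite_labs: "finite (labs t)"
  by (induction t) auto

lemma card_labs: "card (labs t) \<le> nlab t"
proof (induction t)
  case (Meet s t)
  then show ?case using card_Un_le[of "labs s" "labs t"] by simp
qed auto

text \<open>The colour of a label tells which of the \<open>N\<close> solutions may violate it. Any
  labels that miss one of the \<open>N\<close> colours are therefore satisfied jointly, and
  \<open>N\<close> exceeds the number of labels in a minimal contradiction.\<close>

locale labelled_csp = csp V Ed Sol for V :: "'v set" and Ed and Sol :: "('v \<Rightarrow> 'a) set" +
  fixes n :: nat and D :: "nat \<Rightarrow> 'a \<Rightarrow> 'a \<Rightarrow> 'a \<Rightarrow> 'a" and Val :: "'a set"
    and Labs :: "'v set" and B :: "'v \<Rightarrow> 'a set" and col :: "'v \<Rightarrow> nat" and N :: nat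
  assumes finite_Val: "finite Val" and P_Val: "v \<in> V \<Longrightarrow> P v \<subseteq> Val"
    and chain: "v \<in> V \<Longrightarrow> jonsson_on (P v) n D"
    and D_Sol: "i < n \<Longrightarrow> s1 \<in> Sol \<Longrightarrow> s2 \<in> Sol \<Longrightarrow> s3 \<in> Sol \<Longrightarrow>
      \<exists>s\<in>Sol. \<forall>v\<in>V. s v = D i (s1 v) (s2 v) (s3 v)"
    and Labs: "Labs \<subseteq> V"
    and D_B: "v \<in> Labs \<Longrightarrow> i < n \<Longrightarrow> a \<in> B v \<inter> P v \<Longrightarrow> b \<in> P v \<Longrightarrow> c \<in> B v \<inter> P v \<Longrightarrow> D i a b c \<in> B v"
    and colour: "k < N \<Longrightarrow> \<exists>s\<in>Sol. \<forall>v\<in>Labs. col v \<noteq> k \<longrightarrow> s v \<in> B v"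
    and N: "2 ^ card (Pow Val \<times> Pow Val) < N"
begin

lemma D_P: "v \<in> V \<Longrightarrow> i < n \<Longrightarrow> a \<in> P v \<Longrightarrow> b \<in> P v \<Longrightarrow> c \<in> P v \<Longrightarrow> D i a b c \<in> P v"
proof -
  assume v: "v \<in> V" and i: "i < n" and "a \<in> P v" "b \<in> P v" "c \<in> P v"
  then obtain s1 s2 s3 where "s1 \<in> Sol" "s2 \<in> Sol" "s3 \<in> Sol" and abc: "a = s1 v" "b = s2 v" "c = s3 v"
    by (auto simp: P_def)
  then obtain s where "s \<in> Sol" "\<forall>v\<in>V. s v = D i (s1 v) (s2 v) (s3 v)" using D_Sol[OF i] by blast
  then show ?thesis using v abc by (auto simp: P_def intro!: image_eqI[of _ _ s])
qed

lemma D_C: "u \<in> V \<Longrightarrow> v \<in> V \<Longrightarrow> absorbs_rel n D D (C u v) (C u v)"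
  unfolding absorbs_rel_def
proof (intro allI impI)
  fix i a a' b b' c c'
  assume uv: "u \<in> V" "v \<in> V" and i: "i < n" and "(a, a') \<in> C u v" "(b, b') \<in> C u v" "(c, c') \<in> C u v"
  then obtain s1 s2 s3 where "s1 \<in> Sol" "s2 \<in> Sol" "s3 \<in> Sol"
    and abc: "a = s1 u" "b = s2 u" "c = s3 u" "a' = s1 v" "b' = s2 v" "c' = s3 v"
    by (auto simp: C_def)
  then obtain s where "s \<in> Sol" "\<forall>v\<in>V. s v = D i (s1 v) (s2 v) (s3 v)" using D_Sol[OF i] by blast
  then show "(D i a b c, D i a' b' c') \<in> C u v" using uv abc by (auto simp: C_def intro!: image_eqI[of _ _ s])
qed

fun wf_tree :: "'v tree \<Rightarrow> bool" where
  "wf_tree (Top v) \<longleftrightarrow> v \<in> V"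
| "wf_tree (Lab v) \<longleftrightarrow> v \<in> Labs"
| "wf_tree (Meet s t) \<longleftrightarrow> wf_tree s \<and> wf_tree t \<and> root s = root t"
| "wf_tree (Step v t) \<longleftrightarrow> wf_tree t \<and> (v, root t) \<in> Ed"

fun sem :: "'v tree \<Rightarrow> 'a set" where
  "sem (Top v) = P v"
| "sem (Lab v) = B v \<inter> P v"
| "sem (Meet s t) = sem s \<inter> sem t"
| "sem (Step v t) = {a. \<exists>b\<in>sem t. (a, b) \<in> C v (root t)}"

lemma root_V: "wf_tree t \<Longrightarrow> root t \<in> V"
  by (induction t) (use Labs Ed_V in auto)

lemma sem_P: "wf_tree t \<Longrightarrow> sem t \<subseteq> P (root t)"
  by (induction t) (auto dest: C_P)

lemma sem_closed:
  "wf_tree t \<Longrightarrow> i < n \<Longrightarrow> a \<in> sem t \<Longrightarrow> b \<in> P (root t) \<Longrightarrow> c \<in> sem t \<Longrightarrow> D i a b c \<in> sem t"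
proof (induction t arbitrary: a b c)
  case (Lab v)
  then show ?case using D_B[of v i a b c] D_P[of v i a b c] Labs by auto
next
  case (Step v t)
  then obtain a' c' where a': "a' \<in> sem t" "(a, a') \<in> C v (root t)" and c': "c' \<in> sem t" "(c, c') \<in> C v (root t)"
    by auto
  obtain b' where b': "(b, b') \<in> C v (root t)" using Step.prems(4) by (auto simp: P_def C_def)
  then have "D i a' b' c' \<in> sem t" using Step a' c' C_P[OF b'] by auto
  moreover have "(D i a b c, D i a' b' c') \<in> C v (root t)"
    using D_C[of v "root t"] Ed_V[of v "root t"] Step.prems a' b' c' unfolding absorbs_rel_def by auto
  ultimately show ?case by auto
qed (auto simp: D_P)

text \<open>\<open>R\<close> is what the rest of the tree admits at the root of \<open>s\<close>.
  Minimality in the number of labels guarantees that dropping labels restores consistency, and it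
  passes to subtrees when \<open>R\<close> is adapted.\<close>

definition critical :: "'v tree \<Rightarrow> 'a set \<Rightarrow> bool" where
  "critical s R \<longleftrightarrow> R \<inter> sem s = {} \<and>
     (\<forall>s'. wf_tree s' \<longrightarrow> root s' = root s \<longrightarrow> nlab s' < nlab s \<longrightarrow> R \<inter> sem s' \<noteq> {})"

text \<open>On descending to \<open>s\<close>, the sibling \<open>t\<close> becomes part of the
  rest. If \<open>t\<close> carries a label, \<open>s\<close> alone has fewer labels than the whole,
  so minimality yields a common value of \<open>R\<close> and \<open>sem s\<close>; this is the pair
  that \<open>seg\<close> asks for.\<close>

lemma critical_Meet:
  assumes wf: "wf_tree (Meet s t)" and cr: "critical (Meet s t) R"
  shows "critical s (R \<inter> sem t)"
    and "\<exists>E F. weak_seg n D (sem (Meet s t), R) (sem s, R \<inter> sem t) E F"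
    and "0 < nlab t \<Longrightarrow> seg n D (sem (Meet s t), R) (sem s, R \<inter> sem t)"
proof -
  show "critical s (R \<inter> sem t)"
    unfolding critical_def
  proof (intro conjI allI impI)
    show "R \<inter> sem t \<inter> sem s = {}" using cr by (auto simp: critical_def)
    fix s' assume "wf_tree s'" "root s' = root s" "nlab s' < nlab s"
    then have "R \<inter> sem (Meet s' t) \<noteq> {}" using cr wf unfolding critical_def by (metis add_less_mono1 nlab.simps(3) root.simps(3) wf_tree.simps(3))
    then show "R \<inter> sem t \<inter> sem s' \<noteq> {}" by auto
  qed
  have w: "weak_seg n D (sem (Meet s t), R) (sem s, R \<inter> sem t) (Id_on (sem t)) (Id_on (P (root t)))"
    using sem_P[of t] sem_closed[of t] wf by (auto simp: weak_seg_def absorbs_rel_def)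
  then show "\<exists>E F. weak_seg n D (sem (Meet s t), R) (sem s, R \<inter> sem t) E F" by blast
  show "seg n D (sem (Meet s t), R) (sem s, R \<inter> sem t)" if "0 < nlab t"
  proof -
    have "R \<inter> sem s \<noteq> {}" using cr wf that by (auto simp: critical_def)
    then obtain u where "u \<in> R" "u \<in> sem s" by blast
    moreover from this have "(u, u) \<in> Id_on (P (root t))" using sem_P[of s] wf by auto
    ultimately show ?thesis unfolding seg_def using w by (metis fst_conv snd_conv)
  qed
qed

lemma critical_commute:
  assumes "wf_tree (Meet s t)" "critical (Meet s t) R" shows "critical (Meet t s) R"
  using assms by (auto simp: critical_def add.commute Int_commute)

lemma critical_Step:
  assumes wf: "wf_tree (Step v t)" and cr: "critical (Step v t) R"
  shows "critical t (C v (root t) `` R)"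
    and "\<exists>E F. weak_seg n D (sem (Step v t), R) (sem t, C v (root t) `` R) E F"
proof -
  show "critical t (C v (root t) `` R)"
    unfolding critical_def
  proof (intro conjI allI impI)
    show "C v (root t) `` R \<inter> sem t = {}" using cr by (auto simp: critical_def)
    fix s' assume s': "wf_tree s'" "root s' = root t" "nlab s' < nlab t"
    then have "wf_tree (Step v s')" "root (Step v s') = root (Step v t)" "nlab (Step v s') < nlab (Step v t)"
      using wf by auto
    then have "R \<inter> sem (Step v s') \<noteq> {}" using cr unfolding critical_def by blast
    then show "C v (root t) `` R \<inter> sem s' \<noteq> {}" using s'(2) by auto
  qed
  have "weak_seg n D (sem (Step v t), R) (sem t, C v (root t) `` R) (C v (root t)) (C v (root t))"
    using D_C[of v "root t"] Ed_V[of v "root t"] wf by (auto simp: weak_seg_def)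
  then show "\<exists>E F. weak_seg n D (sem (Step v t), R) (sem t, C v (root t) `` R) E F" by blast
qed

lemma nlab_le:
  assumes "wf_tree s" "critical s R" "R \<subseteq> P (root s)" "U \<subseteq> Pow Val \<times> Pow Val" "\<forall>p\<in>U. seg n D p (sem s, R)"
  shows "nlab s \<le> 2 ^ (card (Pow Val \<times> Pow Val) - card U)"
  using assms
proof (induction s arbitrary: R U)
  case (Meet s t)
  let ?T = "card (Pow Val \<times> Pow Val)" and ?p = "(sem (Meet s t), R)"
  have wf: "wf_tree s" "wf_tree t" "wf_tree (Meet t s)" using Meet.prems(1) by auto
  have cr: "critical (Meet t s) R" using critical_commute Meet.prems by blast
  have sem_eq: "sem (Meet t s) = sem (Meet s t)" by auto
  note s = critical_Meet[OF Meet.prems(1,2)]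
  note t = critical_Meet[OF wf(3) cr, unfolded sem_eq]
  have R: "R \<inter> sem s \<subseteq> P (root t)" "R \<inter> sem t \<subseteq> P (root s)" using Meet.prems(1,3) by auto
  have Us: "\<forall>p\<in>U. seg n D p (sem s, R \<inter> sem t)" using s(2) Meet.prems(5) seg_weak_seg by blast
  have Ut: "\<forall>p\<in>U. seg n D p (sem t, R \<inter> sem s)" using t(2) Meet.prems(5) seg_weak_seg by blast
  show ?case
  proof (cases "nlab s = 0 \<or> nlab t = 0")
    case True
    then show ?thesis
      using Meet.IH(1)[OF wf(1) s(1) R(2) Meet.prems(4) Us] Meet.IH(2)[OF wf(2) t(1) R(1) Meet.prems(4) Ut]
      by auto
  next
    case False
    let ?U = "insert ?p U"
    have v: "root (Meet s t) \<in> V" using root_V[OF Meet.prems(1)] .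
    have sub: "sem (Meet s t) \<subseteq> P (root (Meet s t))" using sem_P[OF Meet.prems(1)] .
    have U: "?U \<subseteq> Pow Val \<times> Pow Val" using sub P_Val[OF v] Meet.prems(3,4) by blast
    have fin: "finite (Pow Val \<times> Pow Val)" using finite_Val by simp
    have "?p \<notin> U"
    proof
      assume "?p \<in> U"
      then have "seg n D ?p ?p" using Meet.prems(5) by blast
      then have "sem (Meet s t) \<inter> R \<noteq> {}"
        using seg_pump[OF _ chain[OF v] sub Meet.prems(3) finite_P[OF v]] by blast
      then show False using Meet.prems(2) by (auto simp: critical_def)
    qed
    then have cU: "card ?U = Suc (card U)" using U fin finite_subset by (metis card_insert_disjoint finite_insert)
    have "card ?U \<le> ?T" using U fin card_mono by blast
    then have pow: "2 ^ (?T - card U) = 2 * 2 ^ (?T - card ?U)" using cU by (metis Suc_diff_le diff_Suc_Suc power_Suc)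
    have "nlab s \<le> 2 ^ (?T - card ?U)"
      by (rule Meet.IH(1)[OF wf(1) s(1) R(2) U]) (use Us s(3) False in auto)
    moreover have "nlab t \<le> 2 ^ (?T - card ?U)"
      by (rule Meet.IH(2)[OF wf(2) t(1) R(1) U]) (use Ut t(3) False in auto)
    ultimately show ?thesis unfolding pow by simp
  qed
next
  case (Step v t)
  note t = critical_Step[OF Step.prems(1,2)]
  have "C v (root t) `` R \<subseteq> P (root t)" by (auto dest: C_P)
  moreover have "\<forall>p\<in>U. seg n D p (sem t, C v (root t) `` R)" using t(2) Step.prems(5) seg_weak_seg by blast
  ultimately show ?case using Step.IH[OF _ t(1)] Step.prems by auto
qed auto

text \<open>An inconsistent tree with fewest labels is critical for the whole domain at its root, so
  it has fewer than \<open>N\<close> labels. Some colour is missing among them, and the solution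
  belonging to that colour satisfies the tree.\<close>

lemma sem_nonempty:
  assumes "wf_tree t" shows "sem t \<noteq> {}"
proof
  assume "sem t = {}"
  then obtain t0 where t0: "wf_tree t0" "sem t0 = {}"
    and min: "\<And>s. wf_tree s \<Longrightarrow> sem s = {} \<Longrightarrow> nlab t0 \<le> nlab s"
    using ex_has_least_nat[of "\<lambda>t. wf_tree t \<and> sem t = {}" t nlab] assms by blast
  have "critical t0 (P (root t0))"
    unfolding critical_def using t0(2) min sem_P by (metis Int_absorb1 Int_empty_right linorder_not_less)
  then have "nlab t0 \<le> 2 ^ (card (Pow Val \<times> Pow Val) - card ({} :: ('a set \<times> 'a set) set))"
    using t0(1) by (intro nlab_le) auto
  then have "card (labs t0) < N" using card_labs[of t0] N by simp
  then have "card (col ` labs t0) < card {..<N}" using card_image_le[OF finite_labs, of col t0] by simp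
  then have "\<not> {..<N} \<subseteq> col ` labs t0" using finite_labs[of t0] card_mono[of "col ` labs t0" "{..<N}"] by auto
  then obtain k where k: "k < N" "k \<notin> col ` labs t0" by auto
  obtain s where s: "s \<in> Sol" "\<forall>v\<in>Labs. col v \<noteq> k \<longrightarrow> s v \<in> B v" using colour[OF k(1)] by blast
  have "wf_tree t \<Longrightarrow> k \<notin> col ` labs t \<Longrightarrow> s (root t) \<in> sem t" for t
  proof (induction t)
    case (Step v t)
    then have "s (root t) \<in> sem t" "(s v, s (root t)) \<in> C v (root t)" using s by (auto simp: C_def)
    then show ?case by auto
  qed (use s in \<open>auto simp: P_def\<close>)
  then show False using t0 k by blast
qed

theorem labelled_solution:
  "\<exists>q. (\<forall>v\<in>V. q v \<in> P v) \<and> (\<forall>v\<in>Labs. q v \<in> B v) \<and> (\<forall>(u, v)\<in>Ed. (q u, q v) \<in> C u v)"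
proof -
  \<comment> \<open>Since trees with the same root can be joined by \<open>Meet\<close>, a smallest
    \<open>sem\<close> at \<open>v\<close> is contained in all others; it is the set of values that
    no tree excludes.\<close>
  have "\<exists>t. (wf_tree t \<and> root t = v) \<and> (\<forall>t'. wf_tree t' \<and> root t' = v \<longrightarrow> card (sem t) \<le> card (sem t'))" if "v \<in> V" for v
    by (rule ex_has_least_nat[of _ "Top v"]) (use that in simp)
  then obtain tm where tm: "\<And>v. v \<in> V \<Longrightarrow> wf_tree (tm v)" "\<And>v. v \<in> V \<Longrightarrow> root (tm v) = v"
    and min: "\<And>v t'. v \<in> V \<Longrightarrow> wf_tree t' \<Longrightarrow> root t' = v \<Longrightarrow> card (sem (tm v)) \<le> card (sem t')" by metis
  define Q where "Q v = sem (tm v)" for v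
  have QP: "Q v \<subseteq> P v" if "v \<in> V" for v using sem_P[OF tm(1)[OF that]] tm(2)[OF that] by (simp add: Q_def)
  have Q: "Q v \<subseteq> sem t" if "wf_tree t" "root t = v" "v \<in> V" for t v
  proof -
    have "card (Q v) \<le> card (sem (Meet (tm v) t))" unfolding Q_def using that tm by (intro min) auto
    moreover have "finite (Q v)" using QP finite_P that(3) finite_subset by metis
    ultimately have "sem (Meet (tm v) t) = Q v" by (intro card_seteq) (auto simp: Q_def)
    then show ?thesis by (auto simp: Q_def)
  qed
  have Qcl: "D i a b c \<in> Q v" if "v \<in> V" "i < n" "a \<in> Q v" "b \<in> P v" "c \<in> Q v" for v i a b c
    using sem_closed[OF tm(1)[OF that(1)]] tm(2)[OF that(1)] that by (auto simp: Q_def)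
  have "jonsson_sub Q n (\<lambda>i v. D i)"
    unfolding jonsson_sub_def
  proof (intro conjI ballI allI impI)
    fix v assume v: "v \<in> V"
    show "Q v \<subseteq> P v" using QP[OF v] .
    show "Q v \<noteq> {}" using sem_nonempty tm(1)[OF v] by (simp add: Q_def)
    show "jonsson_on (Q v) n D" using jonsson_on_subset[OF chain[OF v] QP[OF v]] .
    fix i a b c assume "i < n" "a \<in> Q v" "b \<in> P v" "c \<in> Q v"
    then show "D i a b c \<in> Q v" using Qcl[OF v] by blast
  next
    fix u v a assume e: "(u, v) \<in> Ed" "a \<in> Q u"
    have "Q u \<subseteq> sem (Step u (tm v))" using e(1) Ed_V[OF e(1)] tm by (intro Q) auto
    then show "\<exists>b\<in>Q v. (a, b) \<in> C u v" using e(2) Ed_V[OF e(1)] tm by (auto simp: Q_def)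
  next
    fix u v assume e: "(u, v) \<in> Ed"
    then have uv: "u \<in> V" "v \<in> V" using Ed_V by auto
    show "absorbs_rel n D D (C u v \<inter> Q u \<times> Q v) (C u v)"
      unfolding absorbs_rel_def
    proof (intro allI impI)
      fix i a a' b b' c c'
      assume *: "i < n" "(a, a') \<in> C u v \<inter> Q u \<times> Q v" "(b, b') \<in> C u v" "(c, c') \<in> C u v \<inter> Q u \<times> Q v"
      then have "(D i a b c, D i a' b' c') \<in> C u v" using D_C[OF uv] unfolding absorbs_rel_def by blast
      then show "(D i a b c, D i a' b' c') \<in> C u v \<inter> Q u \<times> Q v" using Qcl uv * C_P[OF *(3)] by blast
    qed
  qed
  then obtain q where q: "\<forall>v\<in>V. q v \<in> Q v" "\<forall>(u, v)\<in>Ed. (q u, q v) \<in> C u v"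
    using jonsson_sub_solution by blast
  moreover have "q v \<in> B v" if "v \<in> Labs" for v
    using Q[of "Lab v" v] q(1) that Labs by auto
  ultimately show ?thesis using QP by blast
qed

end

section \<open>Polymorphism algebras\<close>

lemma polymorphism_comp:
  assumes f: "polymorphism S m f" and gs: "length gs = m" "\<forall>g\<in>set gs. polymorphism S n g" and n: "0 < n"
  shows "polymorphism S n (\<lambda>xs. f (map (\<lambda>g. g xs) gs))"
  unfolding polymorphism_def
proof (intro conjI ballI)
  fix xs assume "xs \<in> tuples (universe S) n"
  then have "map (\<lambda>g. g xs) gs \<in> tuples (universe S) m" using gs by (auto simp: tuples_def polymorphism_def)
  then show "f (map (\<lambda>g. g xs) gs) \<in> universe S" using f by (simp add: polymorphism_def)
next
  fix kR assume "kR \<in> set (rels S)"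
  then obtain k R where kR: "kR = (k, R)" "(k, R) \<in> set (rels S)" by (metis surj_pair)
  have "preserves n (\<lambda>xs. f (map (\<lambda>g. g xs) gs)) k R"
    unfolding preserves_def
  proof
    fix ts assume ts: "ts \<in> tuples R n"
    define us where "us = map (\<lambda>g. map (\<lambda>j. g (map (\<lambda>t. t ! j) ts)) [0..<k]) gs"
    have "us \<in> tuples R m"
      using gs kR(2) ts by (fastforce simp: us_def tuples_def polymorphism_def preserves_def)
    then have "map (\<lambda>j. f (map (\<lambda>t. t ! j) us)) [0..<k] \<in> R"
      using f kR(2) by (fastforce simp: polymorphism_def preserves_def)
    moreover have "map (\<lambda>j. f (map (\<lambda>t. t ! j) us)) [0..<k] =
        map (\<lambda>j. f (map (\<lambda>g. g (map (\<lambda>t. t ! j) ts)) gs)) [0..<k]"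
      by (auto simp: us_def comp_def)
    ultimately show "map (\<lambda>j. f (map (\<lambda>g. g (map (\<lambda>t. t ! j) ts)) gs)) [0..<k] \<in> R" by simp
  qed
  then show "case kR of (k, R) \<Rightarrow> preserves n (\<lambda>xs. f (map (\<lambda>g. g xs) gs)) k R" using kR by simp
qed (rule n)

lemma polymorphism_proj:
  assumes S: "finite_rel_structure S" and i: "i < n" shows "polymorphism S n (\<lambda>xs. xs ! i)"
  unfolding polymorphism_def
proof (intro conjI ballI)
  fix kR assume "kR \<in> set (rels S)"
  then obtain k R where kR: "kR = (k, R)" "(k, R) \<in> set (rels S)" by (metis surj_pair)
  have "preserves n (\<lambda>xs. xs ! i) k R"
    unfolding preserves_def
  proof
    fix ts assume "ts \<in> tuples R n"
    then have ts: "length ts = n" "ts ! i \<in> R" using i by (auto simp: tuples_def)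
    then have "length (ts ! i) = k" using S kR(2) by (fastforce simp: finite_rel_structure_def tuples_def)
    then have "map (\<lambda>j. map (\<lambda>t. t ! j) ts ! i) [0..<k] = ts ! i" using ts i by (intro nth_equalityI) auto
    then show "map (\<lambda>j. map (\<lambda>t. t ! j) ts ! i) [0..<k] \<in> R" using ts by simp
  qed
  then show "case kR of (k, R) \<Rightarrow> preserves n (\<lambda>xs. xs ! i) k R" using kR by simp
qed (use i in \<open>auto simp: tuples_def\<close>)

lemma term_op_Pol:
  assumes S: "finite_rel_structure S"
  shows "term_op (Pol S) n t \<Longrightarrow> polymorphism S n t"
proof (induction rule: term_op.induct)
  case (proj i)
  then show ?case using polymorphism_proj[OF S] by blast
next
  case (comp m f gs)
  then have f: "polymorphism S m f" by (simp add: Pol_def)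
  then have "gs \<noteq> []" using comp by (auto simp: polymorphism_def)
  then have "0 < n" using comp(3) by (cases gs) (auto simp: polymorphism_def)
  then show ?case using polymorphism_comp[OF f] comp by blast
qed

text \<open>Basic operations enter \<open>term_op\<close> only through composition, so
  \<open>f\<close> is composed with the projections; the result agrees with \<open>f\<close> on
  lists of length \<open>n\<close>.\<close>

lemma polymorphism_term_op:
  assumes "polymorphism S n f"
  shows "term_op (Pol S) n (\<lambda>xs. f (map (\<lambda>g. g xs) (map (\<lambda>i xs. xs ! i) [0..<n])))"
  using assms by (intro term_op.comp[of n]) (auto simp: Pol_def intro: term_op.proj)

definition absorbing_op :: "'a set \<Rightarrow> 'a set \<Rightarrow> nat \<Rightarrow> ('a list \<Rightarrow> 'a) \<Rightarrow> bool" where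
  "absorbing_op A B n t \<longleftrightarrow> idempotent_op A n t \<and>
     (\<forall>xs\<in>tuples A n. card {i. i < n \<and> xs ! i \<notin> B} \<le> 1 \<longrightarrow> t xs \<in> B)"

lemma absorbing_op_cong:
  assumes "absorbing_op A B n f" "\<And>xs. length xs = n \<Longrightarrow> f xs = g xs" shows "absorbing_op A B n g"
  using assms by (simp add: absorbing_op_def idempotent_op_def tuples_def)

lemma absorbing_subuniverse_Pol:
  assumes S: "finite_rel_structure S"
  shows "absorbing_subuniverse B (Pol S) \<longleftrightarrow> subuniverse B (Pol S) \<and>
    (\<exists>n t. polymorphism S n t \<and> absorbing_op (universe S) B n t)"
proof -
  have "(\<exists>n t. term_op (Pol S) n t \<and> absorbing_op (universe S) B n t) \<longleftrightarrow>
    (\<exists>n t. polymorphism S n t \<and> absorbing_op (universe S) B n t)"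
  proof
    assume "\<exists>n t. polymorphism S n t \<and> absorbing_op (universe S) B n t"
    then obtain n t where t: "polymorphism S n t" "absorbing_op (universe S) B n t" by blast
    have "map (\<lambda>g. g xs) (map (\<lambda>i xs. xs ! i) [0..<n]) = xs" if "length xs = n" for xs :: "'a list"
      using that by (intro nth_equalityI) auto
    then have "absorbing_op (universe S) B n (\<lambda>xs. t (map (\<lambda>g. g xs) (map (\<lambda>i xs. xs ! i) [0..<n])))"
      by (intro absorbing_op_cong[OF t(2)]) simp
    then show "\<exists>n t. term_op (Pol S) n t \<and> absorbing_op (universe S) B n t"
      using polymorphism_term_op[OF t(1)] by blast
  qed (use term_op_Pol[OF S] in blast)
  then show ?thesis
    by (simp add: absorbing_subuniverse_def absorbing_op_def Pol_def)
qed

text \<open>The chain is \<open>d i (x, y, z) = t (x, \<dots>, x, y, z, \<dots>, z)\<close> with \<open>i\<close> entries \<open>z\<close>.\<close>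

lemma absorbing_op_imp_jonsson:
  assumes S: "finite_rel_structure S" and t: "polymorphism S n t" and abs: "absorbing_op (universe S) B n t"
    and B: "B \<subseteq> universe S"
  shows "\<exists>d. (\<forall>i<n. polymorphism S 3 (d i)) \<and> jonsson_on (universe S) n (\<lambda>i a b c. d i [a, b, c]) \<and>
    (\<forall>i<n. \<forall>b\<in>B. \<forall>a\<in>universe S. \<forall>c\<in>B. d i [b, a, c] \<in> B)"
proof -
  \<comment> \<open>The letters 0, 1, 2 stand for \<open>x\<close>, \<open>y\<close>,
    \<open>z\<close>. The only \<open>y\<close> is at position \<open>n - 1 - i\<close>, the one
    place where an argument may leave \<open>B\<close>.\<close>
  define w :: "nat \<Rightarrow> nat list" where "w i = replicate (n - 1 - i) 0 @ [1] @ replicate i 2" for i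
  define d where "d i = (\<lambda>xs. t (map (\<lambda>g. g xs) (map (\<lambda>k xs. xs ! k) (w i))))" for i
  have n: "0 < n" using t by (simp add: polymorphism_def)
  have len: "length (w i) = n" if "i < n" for i using that by (simp add: w_def)
  have "polymorphism S 3 (d i)" if "i < n" for i
    unfolding d_def using that polymorphism_proj[OF S, of _ 3]
    by (intro polymorphism_comp[OF t]) (auto simp: len, auto simp: w_def)
  moreover have d3: "d i [a, b, c] = t (replicate (n - 1 - i) a @ [b] @ replicate i c)" for i a b c
    by (simp add: d_def w_def)
  have "jonsson_on (universe S) n (\<lambda>i a b c. d i [a, b, c])"
    unfolding jonsson_on_def
  proof (intro conjI ballI allI impI)
    fix a b assume a: "a \<in> universe S" "b \<in> universe S"
    have idem: "t (replicate n c) = c" if "c \<in> universe S" for c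
      using abs that by (simp add: absorbing_op_def idempotent_op_def)
    have "replicate (n - 1) a @ [a] = replicate n a" using n by (metis Suc_pred' replicate_Suc replicate_append_same)
    then show "d 0 [a, a, b] = a" using idem a by (simp add: d3)
    have "b # replicate (n - 1) b = replicate n b" using n by (metis Suc_pred' replicate_Suc)
    then show "d (n - 1) [a, b, b] = b" using idem a by (simp add: d3)
    fix i assume i: "Suc i < n"
    have "replicate (n - Suc i) a = replicate (n - Suc (Suc i)) a @ [a]"
      using i by (metis Suc_diff_Suc replicate_Suc replicate_append_same)
    then show "d i [a, b, b] = d (Suc i) [a, a, b]" by (simp add: d3)
  qed (rule n)
  moreover have "d i [b, a, c] \<in> B" if i: "i < n" and bac: "b \<in> B" "a \<in> universe S" "c \<in> B" for i a b c
  proof -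
    let ?xs = "replicate (n - 1 - i) b @ [a] @ replicate i c"
    have "?xs \<in> tuples (universe S) n" using i bac B by (auto simp: tuples_def)
    moreover have "{j. j < n \<and> ?xs ! j \<notin> B} \<subseteq> {n - 1 - i}"
    proof
      fix j assume j: "j \<in> {j. j < n \<and> ?xs ! j \<notin> B}"
      consider "j < n - 1 - i" | "j = n - 1 - i" | k where "j = n - 1 - i + Suc k"
        by (metis less_imp_Suc_add add_Suc_right nat_neq_iff)
      then show "j \<in> {n - 1 - i}"
      proof cases
        case (3 k)
        then have "k < i" using j i by auto
        then have "?xs ! j = c" using 3 by (simp add: nth_append)
        then show ?thesis using j bac by simp
      qed (use j bac in \<open>auto simp: nth_append\<close>)
    qed
    then have "card {j. j < n \<and> ?xs ! j \<notin> B} \<le> card {n - 1 - i}" by (intro card_mono) auto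
    ultimately show ?thesis using abs by (simp add: absorbing_op_def d3)
  qed
  ultimately show ?thesis by blast
qed

text \<open>The universe is added as a unary relation so that argument words of the wanted operation
  are variables of the network too.\<close>

definition rel_sets :: "'a rel_structure \<Rightarrow> 'a list set set" where
  "rel_sets S = insert ((\<lambda>a. [a]) ` universe S) (snd ` set (rels S))"

lemma rel_sets_arity:
  assumes "finite_rel_structure S" "R \<in> rel_sets S"
  shows "\<exists>k. R \<subseteq> tuples (universe S) k"
proof -
  have "(\<lambda>a. [a]) ` universe S \<subseteq> tuples (universe S) 1" by (auto simp: tuples_def)
  then show ?thesis using assms by (fastforce simp: rel_sets_def finite_rel_structure_def)
qed

lemma finite_tuples: "finite A \<Longrightarrow> finite (tuples A n)"
  using finite_lists_length_eq[of A n] by (simp add: tuples_def conj_commute)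

lemma finite_Union_rel_sets:
  assumes "finite_rel_structure S" shows "finite (\<Union> (rel_sets S))"
proof (rule finite_Union)
  show "finite (rel_sets S)" by (simp add: rel_sets_def)
  fix R assume "R \<in> rel_sets S"
  then obtain k where "R \<subseteq> tuples (universe S) k" using rel_sets_arity[OF assms] by blast
  then show "finite R" using finite_tuples assms finite_subset by (metis finite_rel_structure_def)
qed

definition eval_op :: "('a list \<Rightarrow> 'a) \<Rightarrow> 'a list list \<Rightarrow> 'a list" where
  "eval_op f v = map (\<lambda>j. f (map (\<lambda>t. t ! j) v)) [0..<length (hd v)]"

text \<open>Letters become singleton lists, which makes a column an \<open>N\<close>-tuple over the
  unary relation added in \<open>rel_sets\<close>.\<close>

definition column :: "'a list list \<Rightarrow> nat \<Rightarrow> 'a list list" where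
  "column v j = map (\<lambda>t. [t ! j]) v"

lemma eval_op_column: "v \<noteq> [] \<Longrightarrow> j < length (hd v) \<Longrightarrow> eval_op f (column v j) = [eval_op f v ! j]"
  by (simp add: eval_op_def column_def hd_map comp_def)

lemma eval_op_in:
  assumes S: "finite_rel_structure S" and f: "polymorphism S n f" and R: "R \<in> rel_sets S" "v \<in> tuples R n"
  shows "eval_op f v \<in> R"
proof (cases "R = (\<lambda>a. [a]) ` universe S")
  case True
  have "hd v \<in> R" using f R by (cases v) (auto simp: tuples_def polymorphism_def)
  moreover have "map (\<lambda>t. t ! 0) v \<in> tuples (universe S) n" using R True by (auto simp: tuples_def)
  ultimately show ?thesis using f True by (auto simp: eval_op_def polymorphism_def)
next
  case False
  then have "R \<in> snd ` set (rels S)" using R(1) by (simp add: rel_sets_def)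
  then obtain k where k: "(k, R) \<in> set (rels S)" by auto
  have "hd v \<in> R" using f R by (cases v) (auto simp: tuples_def polymorphism_def)
  then have "length (hd v) = k" using S k by (fastforce simp: finite_rel_structure_def tuples_def)
  then show ?thesis using f k R(2) by (fastforce simp: eval_op_def polymorphism_def preserves_def)
qed

text \<open>The values at words define \<open>t\<close>. The edges to columns force the value at a
  tuple over \<open>R\<close> to be \<open>t\<close> applied coordinatewise, and it lies in
  \<open>R\<close> because \<open>P v \<subseteq> R\<close>: so \<open>t\<close> is a polymorphism.
  It is idempotent because its value at a constant word is attained by some idempotent
  polymorphism.\<close>

lemma jonsson_imp_absorbing_op:
  fixes S :: "'a rel_structure"
  assumes S: "finite_rel_structure S" and B: "B \<subseteq> universe S"
    and d: "\<And>i. i < n \<Longrightarrow> polymorphism S 3 (d i)"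
    and J: "jonsson_on (universe S) n (\<lambda>i a b c. d i [a, b, c])"
    and dB: "\<And>i a b c. i < n \<Longrightarrow> b \<in> B \<Longrightarrow> a \<in> universe S \<Longrightarrow> c \<in> B \<Longrightarrow> d i [b, a, c] \<in> B"
    and N: "2 ^ card (Pow (\<Union> (rel_sets S)) \<times> Pow (\<Union> (rel_sets S))) < N"
  shows "\<exists>t. polymorphism S N t \<and> absorbing_op (universe S) B N t"
proof -
  let ?A = "universe S"
  define V where "V = (\<Union>R\<in>rel_sets S. tuples R N)"
  define Ed0 where "Ed0 = {(v, column v j) | v j. v \<in> V \<and> j < length (hd v)}"
  define Ed where "Ed = Ed0 \<union> Ed0\<inverse>"
  define Sol where "Sol = eval_op ` {f. polymorphism S N f \<and> idempotent_op ?A N f}"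
  define D where "D i r1 r2 r3 = map (\<lambda>j. d i [r1 ! j, r2 ! j, r3 ! j]) [0..<length r1]" for i r1 r2 r3
  define word where "word = map (\<lambda>a :: 'a. [a])"
  define L where "L = {xs \<in> tuples ?A N. card {i. i < N \<and> xs ! i \<notin> B} \<le> 1}"
  define Labs where "Labs = word ` L"
  \<comment> \<open>The position of the letter outside \<open>B\<close>. If there is none, the
    colour is arbitrary, and every projection respects the label.\<close>
  define col where "col v = (SOME i. i < N \<and> v ! i \<notin> (\<lambda>b. [b]) ` B)" for v
  have N0: "0 < N" using N by simp
  have word_V: "word xs \<in> V" if "xs \<in> tuples ?A N" for xs
    using that by (auto simp: V_def rel_sets_def word_def tuples_def intro!: bexI[of _ "(\<lambda>a. [a]) ` ?A"])
  have V: "\<exists>R k. R \<in> rel_sets S \<and> v \<in> tuples R N \<and> R \<subseteq> tuples ?A k \<and> length (hd v) = k"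
    if v: "v \<in> V" for v
  proof -
    obtain R where R: "R \<in> rel_sets S" "v \<in> tuples R N" using v unfolding V_def by blast
    then obtain k where k: "R \<subseteq> tuples ?A k" using rel_sets_arity[OF S] by blast
    have "hd v \<in> R" using R(2) N0 by (cases v) (auto simp: tuples_def)
    then have "length (hd v) = k" using k by (auto simp: tuples_def)
    then show ?thesis using R k by blast
  qed
  have ne: "v \<noteq> []" if "v \<in> V" for v using that N0 by (auto simp: V_def tuples_def)
  have column_word: "column v j = word (map (\<lambda>t. t ! j) v)" for v j by (simp add: column_def word_def)
  have column_A: "map (\<lambda>t. t ! j) v \<in> tuples ?A N" if vj: "v \<in> V" "j < length (hd v)" for v j
  proof -
    obtain R k where "v \<in> tuples R N" "R \<subseteq> tuples ?A k" "length (hd v) = k" using V vj(1) by blast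
    then show ?thesis using vj(2) by (force simp: tuples_def)
  qed
  have column_V: "column v j \<in> V" if "v \<in> V" "j < length (hd v)" for v j
    using word_V column_A that column_word by metis
  have finV: "finite V"
  proof -
    have "finite (tuples R N)" if "R \<in> rel_sets S" for R
      using finite_Union_rel_sets[OF S] that by (intro finite_tuples) (meson Union_upper finite_subset)
    then show ?thesis unfolding V_def by (auto simp: rel_sets_def)
  qed
  have Sol_R: "s v \<in> R" if "s \<in> Sol" "R \<in> rel_sets S" "v \<in> tuples R N" for s v R
    using that eval_op_in[OF S] by (auto simp: Sol_def)
  have Sol_sub: "(\<lambda>s. s v) ` Sol \<subseteq> \<Union> (rel_sets S)" if "v \<in> V" for v
    using Sol_R that unfolding V_def by blast
  interpret csp V Ed Sol
  proof
    show "finite V" by (rule finV)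
    show "Ed \<subseteq> V \<times> V" using column_V by (auto simp: Ed_def Ed0_def)
    show "sym Ed" by (auto simp: Ed_def sym_Un_converse)
    show "finite ((\<lambda>s. s v) ` Sol)" if "v \<in> V" for v
      using Sol_sub[OF that] finite_Union_rel_sets[OF S] finite_subset by blast
  qed
  have P_R: "P v \<subseteq> R" if "R \<in> rel_sets S" "v \<in> tuples R N" for v R
    using Sol_R that by (auto simp: P_def)
  have P_word: "\<exists>a\<in>?A. r = [a]" if "r \<in> P (word xs)" "xs \<in> tuples ?A N" for r xs
  proof -
    have "word xs \<in> tuples ((\<lambda>a. [a]) ` ?A) N" using that(2) by (auto simp: word_def tuples_def)
    then show ?thesis using P_R[of "(\<lambda>a. [a]) ` ?A"] that(1) by (auto simp: rel_sets_def)
  qed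
  have chainP: "jonsson_on (P v) n D" if "v \<in> V" for v
  proof -
    obtain R k where R: "R \<in> rel_sets S" "v \<in> tuples R N" "R \<subseteq> tuples ?A k" using V \<open>v \<in> V\<close> by blast
    have "jonsson_on (tuples ?A k) n D"
      unfolding jonsson_on_def
    proof (intro conjI ballI allI impI)
      show "0 < n" using J by (simp add: jonsson_on_def)
      fix a b assume "a \<in> tuples ?A k" "b \<in> tuples ?A k"
      then have ab: "length a = k" "length b = k" "\<And>j. j < k \<Longrightarrow> a ! j \<in> ?A \<and> b ! j \<in> ?A" by (auto simp: tuples_def)
      show "D 0 a a b = a" using ab J by (intro nth_equalityI) (auto simp: D_def jonsson_on_def)
      show "D (n - 1) a b b = b" using ab J by (intro nth_equalityI) (auto simp: D_def jonsson_on_def)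
      show "D i a b b = D (Suc i) a a b" if "Suc i < n" for i
        using ab J that by (intro nth_equalityI) (auto simp: D_def jonsson_on_def)
    qed
    then show ?thesis using jonsson_on_subset P_R R by (meson subset_trans)
  qed
  interpret labelled_csp V Ed Sol n D "\<Union> (rel_sets S)" Labs "\<lambda>v. (\<lambda>b. [b]) ` B" col N
  proof
    show "finite (\<Union> (rel_sets S))" by (rule finite_Union_rel_sets[OF S])
    show "P v \<subseteq> \<Union> (rel_sets S)" if "v \<in> V" for v using Sol_sub[OF that] by (simp add: P_def)
    show "jonsson_on (P v) n D" if "v \<in> V" for v using chainP that .
  next
    fix i s1 s2 s3 assume i: "i < n" and "s1 \<in> Sol" "s2 \<in> Sol" "s3 \<in> Sol"
    then obtain f1 f2 f3 where s: "s1 = eval_op f1" "s2 = eval_op f2" "s3 = eval_op f3"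
      and f: "polymorphism S N f1" "polymorphism S N f2" "polymorphism S N f3"
      and id: "idempotent_op ?A N f1" "idempotent_op ?A N f2" "idempotent_op ?A N f3" by (auto simp: Sol_def)
    define g where "g = (\<lambda>xs. d i (map (\<lambda>g. g xs) [f1, f2, f3]))"
    have "polymorphism S N g" unfolding g_def using f N0 by (intro polymorphism_comp[OF d[OF i]]) auto
    moreover have "idempotent_op ?A N g" using id jonsson_on_idem[OF J _ i] by (simp add: idempotent_op_def g_def)
    ultimately have "eval_op g \<in> Sol" by (auto simp: Sol_def)
    moreover have "eval_op g v = D i (s1 v) (s2 v) (s3 v)" for v by (simp add: eval_op_def D_def s g_def)
    ultimately show "\<exists>s\<in>Sol. \<forall>v\<in>V. s v = D i (s1 v) (s2 v) (s3 v)" by blast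
  next
    show "Labs \<subseteq> V" using word_V by (auto simp: Labs_def L_def)
  next
    fix v i a b c assume v: "v \<in> Labs" and i: "i < n" and a: "a \<in> (\<lambda>b. [b]) ` B \<inter> P v" and b: "b \<in> P v"
      and c: "c \<in> (\<lambda>b. [b]) ` B \<inter> P v"
    obtain x where "x \<in> ?A" "b = [x]" using P_word b v by (auto simp: Labs_def L_def)
    then show "D i a b c \<in> (\<lambda>b. [b]) ` B" using a c dB[OF i] by (auto simp: D_def)
  next
    fix k assume k: "k < N"
    have "eval_op (\<lambda>xs. xs ! k) \<in> Sol"
      using polymorphism_proj[OF S k] k by (auto simp: Sol_def idempotent_op_def)
    moreover have "eval_op (\<lambda>xs. xs ! k) v \<in> (\<lambda>b. [b]) ` B" if v: "v \<in> Labs" "col v \<noteq> k" for v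
    proof -
      obtain xs where xs: "v = word xs" "xs \<in> tuples ?A N" "card {i. i < N \<and> xs ! i \<notin> B} \<le> 1"
        using v by (auto simp: Labs_def L_def)
      have len: "length xs = N" using xs(2) by (simp add: tuples_def)
      have "xs ! k \<in> B"
      proof (rule ccontr)
        assume nB: "xs ! k \<notin> B"
        have iff: "v ! i \<notin> (\<lambda>b. [b]) ` B \<longleftrightarrow> xs ! i \<notin> B" if "i < N" for i
          using that len xs(1) by (auto simp: word_def)
        have "col v < N \<and> v ! col v \<notin> (\<lambda>b. [b]) ` B"
          unfolding col_def by (rule someI[of _ k]) (use k nB iff in blast)
        then have "{col v, k} \<subseteq> {i. i < N \<and> xs ! i \<notin> B}" using iff k nB by auto
        then have "card {col v, k} \<le> 1" using xs(3) card_mono[of "{i. i < N \<and> xs ! i \<notin> B}" "{col v, k}"] by simp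
        then show False using v(2) by simp
      qed
      moreover have "hd (word xs) = [xs ! 0]" using len N0 by (cases xs) (auto simp: word_def)
      ultimately show ?thesis using xs(1) len k by (simp add: eval_op_def word_def)
    qed
    ultimately show "\<exists>s\<in>Sol. \<forall>v\<in>Labs. col v \<noteq> k \<longrightarrow> s v \<in> (\<lambda>b. [b]) ` B" by blast
  next
    show "2 ^ card (Pow (\<Union> (rel_sets S)) \<times> Pow (\<Union> (rel_sets S))) < N" by (rule N)
  qed
  obtain q where qP: "\<forall>v\<in>V. q v \<in> P v" and qB: "\<forall>v\<in>Labs. q v \<in> (\<lambda>b. [b]) ` B"
    and qC: "\<forall>(u, v)\<in>Ed. (q u, q v) \<in> C u v" using labelled_solution by blast
  define t where "t xs = hd (q (word xs))" for xs
  have q_word: "q (word xs) = [t xs] \<and> t xs \<in> ?A" if "xs \<in> tuples ?A N" for xs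
    using P_word[OF _ that] qP word_V[OF that] unfolding t_def by fastforce
  have q_column: "t (map (\<lambda>t. t ! j) v) = q v ! j" if v: "v \<in> V" "j < length (hd v)" for v j
  proof -
    have "(q v, q (column v j)) \<in> C v (column v j)" using qC v by (fastforce simp: Ed_def Ed0_def)
    then obtain s where "s \<in> Sol" "q v = s v" "q (column v j) = s (column v j)" by (auto simp: C_def)
    then obtain f where "q v = eval_op f v" "q (column v j) = eval_op f (column v j)" by (auto simp: Sol_def)
    then have "q (column v j) = [q v ! j]" using eval_op_column ne v by metis
    then show ?thesis using q_word[OF column_A[OF v]] by (simp add: column_word)
  qed
  have "polymorphism S N t"
    unfolding polymorphism_def
  proof (intro conjI ballI)
    fix kR assume "kR \<in> set (rels S)"
    then obtain k R where kR: "kR = (k, R)" "(k, R) \<in> set (rels S)" by (metis surj_pair)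
    then have R: "R \<in> rel_sets S" by (force simp: rel_sets_def)
    have "preserves N t k R"
      unfolding preserves_def
    proof
      fix v assume v: "v \<in> tuples R N"
      then have vV: "v \<in> V" using R by (auto simp: V_def)
      have "R \<subseteq> tuples ?A k" using S kR(2) by (auto simp: finite_rel_structure_def)
      moreover have "hd v \<in> R" using v ne[OF vV] by (cases v) (auto simp: tuples_def)
      moreover have qR: "q v \<in> R" using qP vV P_R[OF R v] by blast
      ultimately have "length (hd v) = k" "length (q v) = k" by (auto simp: tuples_def)
      then have "map (\<lambda>j. t (map (\<lambda>t. t ! j) v)) [0..<k] = q v"
        using q_column[OF vV] by (intro nth_equalityI) auto
      then show "map (\<lambda>j. t (map (\<lambda>t. t ! j) v)) [0..<k] \<in> R" using qR by simp
    qed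
    then show "case kR of (k, R) \<Rightarrow> preserves N t k R" using kR by simp
  qed (use N0 q_word in auto)
  moreover have "idempotent_op ?A N t"
    unfolding idempotent_op_def
  proof
    fix a assume a: "a \<in> ?A"
    have r: "replicate N a \<in> tuples ?A N" using a by (auto simp: tuples_def)
    then have "q (word (replicate N a)) \<in> P (word (replicate N a))" using qP word_V by blast
    then obtain s where "s \<in> Sol" "q (word (replicate N a)) = s (word (replicate N a))" by (auto simp: P_def)
    then obtain f where f: "idempotent_op ?A N f" "q (word (replicate N a)) = eval_op f (word (replicate N a))"
      by (auto simp: Sol_def)
    have "hd (word (replicate N a)) = [a]" using N0 by (cases N) (auto simp: word_def)
    then have "eval_op f (word (replicate N a)) = [a]"
      using f(1) a by (simp add: eval_op_def word_def idempotent_op_def)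
    then show "t (replicate N a) = a" using f(2) by (simp add: t_def)
  qed
  moreover have "t xs \<in> B" if "xs \<in> tuples ?A N" "card {i. i < N \<and> xs ! i \<notin> B} \<le> 1" for xs
  proof -
    have "word xs \<in> Labs" using that by (auto simp: Labs_def L_def)
    then show ?thesis using qB q_word[OF that(1)] by auto
  qed
  ultimately show ?thesis unfolding absorbing_op_def by blast
qed

theorem absorbing_subuniverse_Pol_iff:
  assumes S: "finite_rel_structure S" and N: "2 ^ card (Pow (\<Union> (rel_sets S)) \<times> Pow (\<Union> (rel_sets S))) < N"
  shows "absorbing_subuniverse B (Pol S) \<longleftrightarrow> subuniverse B (Pol S) \<and>
    (\<exists>t. polymorphism S N t \<and> absorbing_op (universe S) B N t)"
proof -
  have "\<exists>t. polymorphism S N t \<and> absorbing_op (universe S) B N t"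
    if B: "subuniverse B (Pol S)" and t: "polymorphism S n t" "absorbing_op (universe S) B n t" for n t
  proof -
    have B: "B \<subseteq> universe S" using B by (simp add: subuniverse_def Pol_def)
    obtain d where "\<forall>i<n. polymorphism S 3 (d i)" "jonsson_on (universe S) n (\<lambda>i a b c. d i [a, b, c])"
      "\<forall>i<n. \<forall>b\<in>B. \<forall>a\<in>universe S. \<forall>c\<in>B. d i [b, a, c] \<in> B"
      using absorbing_op_imp_jonsson[OF S t B] by blast
    then show ?thesis using jonsson_imp_absorbing_op[OF S B _ _ _ N] by blast
  qed
  then show ?thesis unfolding absorbing_subuniverse_Pol[OF S] by blast
qed

section \<open>Computable functions\<close>

definition computable :: "nat \<Rightarrow> (nat list \<Rightarrow> nat) \<Rightarrow> bool" where
  "computable k f \<longleftrightarrow> (\<exists>r. \<forall>xs. length xs = k \<longrightarrow> rec_apply r xs = Some (f xs))"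

lemma computable_cong:
  "computable k f \<Longrightarrow> (\<And>xs. length xs = k \<Longrightarrow> f xs = g xs) \<Longrightarrow> computable k g"
  by (auto simp: computable_def)

lemma computable_nth: "i < k \<Longrightarrow> computable k (\<lambda>xs. xs ! i)"
  unfolding computable_def by (intro exI[of _ "Proj i"]) simp

lemma those_map_Some: "(\<And>x. x \<in> set xs \<Longrightarrow> f x = Some (g x)) \<Longrightarrow> those (map f xs) = Some (map g xs)"
  by (induction xs) auto

lemma computable_map:
  assumes "computable n f" "length gs = n" "\<And>g. g \<in> set gs \<Longrightarrow> computable k g"
  shows "computable k (\<lambda>xs. f (map (\<lambda>g. g xs) gs))"
proof -
  obtain r where r: "\<And>xs. length xs = n \<Longrightarrow> rec_apply r xs = Some (f xs)"
    using assms(1) by (auto simp: computable_def)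
  have "\<forall>g\<in>set gs. \<exists>q. \<forall>xs. length xs = k \<longrightarrow> rec_apply q xs = Some (g xs)"
    using assms(3) by (auto simp: computable_def)
  then obtain q where q: "\<And>g xs. g \<in> set gs \<Longrightarrow> length xs = k \<Longrightarrow> rec_apply (q g) xs = Some (g xs)" by metis
  have "rec_apply (Comp r (map q gs)) xs = Some (f (map (\<lambda>g. g xs) gs))" if "length xs = k" for xs
  proof -
    have "those (map (\<lambda>g. rec_apply g xs) (map q gs)) = Some (map (\<lambda>g. g xs) gs)"
      using q that by (simp add: comp_def those_map_Some)
    then show ?thesis using r assms(2) by simp
  qed
  then show ?thesis unfolding computable_def by blast
qed

lemma computable_rec:
  assumes "computable k f" "computable (Suc (Suc k)) g"
  shows "computable (Suc k) (\<lambda>xs. rec_nat (f (tl xs)) (\<lambda>m v. g (m # v # tl xs)) (hd xs))"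
proof -
  obtain p q where p: "\<And>xs. length xs = k \<Longrightarrow> rec_apply p xs = Some (f xs)"
    and q: "\<And>xs. length xs = Suc (Suc k) \<Longrightarrow> rec_apply q xs = Some (g xs)"
    using assms by (auto simp: computable_def)
  have "rec_apply (PrimRec p q) xs = Some (rec_nat (f (tl xs)) (\<lambda>m v. g (m # v # tl xs)) (hd xs))"
    if len: "length xs = Suc k" for xs
  proof -
    obtain n ys where xs: "xs = n # ys" "length ys = k" using len by (cases xs) auto
    have "rec_nat (rec_apply p ys) (\<lambda>m r. Option.bind r (\<lambda>v. rec_apply q (m # v # ys))) n =
      Some (rec_nat (f ys) (\<lambda>m v. g (m # v # ys)) n)"
      by (induction n) (use p q xs in auto)
    then show ?thesis using xs by simp
  qed
  then show ?thesis unfolding computable_def by blast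
qed

lemma computable_Cons:
  assumes "computable (Suc k) f" "computable n a" "\<And>i. i < k \<Longrightarrow> computable n (b i)"
  shows "computable n (\<lambda>xs. f (a xs # map (\<lambda>i. b i xs) [0..<k]))"
proof -
  have "computable n (\<lambda>xs. f (map (\<lambda>g. g xs) (a # map b [0..<k])))"
    using assms by (intro computable_map[OF assms(1)]) auto
  then show ?thesis by (rule computable_cong) (simp add: comp_def)
qed

definition "fun1 F \<longleftrightarrow> computable 1 (\<lambda>xs. F (xs ! 0))"
definition "fun2 F \<longleftrightarrow> computable 2 (\<lambda>xs. F (xs ! 0) (xs ! 1))"
definition "fun3 F \<longleftrightarrow> computable 3 (\<lambda>xs. F (xs ! 0) (xs ! 1) (xs ! 2))"

lemma fun1_app: "fun1 F \<Longrightarrow> computable k f \<Longrightarrow> computable k (\<lambda>xs. F (f xs))"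
  unfolding fun1_def using computable_map[of 1 _ "[f]" k] by fastforce

lemma fun2_app: "fun2 F \<Longrightarrow> computable k f \<Longrightarrow> computable k g \<Longrightarrow> computable k (\<lambda>xs. F (f xs) (g xs))"
  unfolding fun2_def using computable_map[of 2 _ "[f, g]" k] by fastforce

lemma fun1_Suc: "fun1 Suc"
  unfolding fun1_def computable_def
proof (intro exI allI impI)
  fix xs :: "nat list" assume "length xs = 1"
  then show "rec_apply Succ xs = Some (Suc (xs ! 0))" by (cases xs) auto
qed

lemma computable_const: "computable k (\<lambda>xs. c)"
proof (induction c)
  case 0
  show ?case unfolding computable_def by (intro exI[of _ Zero]) simp
next
  case (Suc c)
  then show ?case by (rule fun1_app[OF fun1_Suc])
qed

lemma fun1_rec:
  assumes "fun2 g" "\<And>m. F (Suc m) = g m (F m)" shows "fun1 F"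
proof -
  have "computable (Suc 0) (\<lambda>xs. rec_nat (F 0) (\<lambda>m v. g ((m # v # tl xs) ! 0) ((m # v # tl xs) ! 1)) (hd xs))"
    by (rule computable_rec[of 0 "\<lambda>xs. F 0" "\<lambda>xs. g (xs ! 0) (xs ! 1)", OF computable_const])
      (use assms(1) in \<open>simp add: fun2_def numeral_2_eq_2\<close>)
  moreover have "rec_nat (F 0) g m = F m" for m by (induction m) (simp_all add: assms(2))
  ultimately show ?thesis unfolding fun1_def
    by (auto elim!: computable_cong simp: length_Suc_conv)
qed

lemma fun2_rec:
  assumes "fun1 f" "fun3 g" "\<And>y. F 0 y = f y" "\<And>m y. F (Suc m) y = g m (F m y) y" shows "fun2 F"
proof -
  have "computable (Suc 1) (\<lambda>xs. rec_nat (f (tl xs ! 0))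
      (\<lambda>m v. g ((m # v # tl xs) ! 0) ((m # v # tl xs) ! 1) ((m # v # tl xs) ! 2)) (hd xs))"
    by (rule computable_rec[of 1 "\<lambda>xs. f (xs ! 0)" "\<lambda>xs. g (xs ! 0) (xs ! 1) (xs ! 2)"])
      (use assms(1,2) in \<open>simp_all add: fun1_def fun3_def numeral_3_eq_3\<close>)
  moreover have "rec_nat (f y) (\<lambda>m v. g m v y) m = F m y" for m y by (induction m) (simp_all add: assms(3,4))
  ultimately show ?thesis unfolding fun2_def
    by (auto elim!: computable_cong simp: length_Suc_conv numeral_2_eq_2)
qed

lemma fun2_flip: "fun2 F \<Longrightarrow> fun2 (\<lambda>x y. F y x)"
  unfolding fun2_def[of "\<lambda>x y. F y x"] by (rule fun2_app[OF _ computable_nth computable_nth]) auto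

lemma fun1_id: "fun1 (\<lambda>x. x)"
  unfolding fun1_def by (intro computable_nth) simp

named_theorems computable_intros

lemmas [computable_intros] = computable_nth computable_const fun1_app[OF fun1_Suc]

lemma fun2_add: "fun2 (+)"
  by (rule fun2_rec[of "\<lambda>y. y" "\<lambda>m v y. Suc v"])
    (auto simp: fun3_def fun1_id intro!: computable_intros)
lemmas [computable_intros] = fun2_app[OF fun2_add]

lemma fun2_mult: "fun2 (*)"
  by (rule fun2_rec[of "\<lambda>y. 0" "\<lambda>m v y. v + y"])
    (auto simp: fun1_def fun3_def intro!: computable_intros)
lemmas [computable_intros] = fun2_app[OF fun2_mult]

lemma fun1_pred: "fun1 (\<lambda>x. x - Suc 0)"
  by (rule fun1_rec[of "\<lambda>m v. m"]) (auto simp: fun2_def intro!: computable_intros)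
lemmas [computable_intros] = fun1_app[OF fun1_pred]

lemma fun2_diff: "fun2 (-)"
proof -
  have "fun2 (\<lambda>x y. y - x)"
    by (rule fun2_rec[of "\<lambda>y. y" "\<lambda>m v y. v - Suc 0"])
      (auto simp: fun1_id fun3_def intro!: computable_intros)
  then show ?thesis by (rule fun2_flip)
qed
lemmas [computable_intros] = fun2_app[OF fun2_diff]

lemma fun1_power: "fun1 (\<lambda>x. 2 ^ x)"
  by (rule fun1_rec[of "\<lambda>m v. 2 * v"]) (auto simp: fun2_def intro!: computable_intros)
lemmas [computable_intros] = fun1_app[OF fun1_power]

definition "dec k p \<longleftrightarrow> computable k (\<lambda>xs. if p xs then 1 else 0)"

lemma dec_eq: "computable k f \<Longrightarrow> computable k g \<Longrightarrow> dec k (\<lambda>xs. f xs = g xs)"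
proof -
  assume "computable k f" "computable k g"
  then have "computable k (\<lambda>xs. 1 - ((f xs - g xs) + (g xs - f xs)))" by (intro computable_intros)
  then show ?thesis unfolding dec_def by (rule computable_cong) auto
qed

lemma dec_not: "dec k p \<Longrightarrow> dec k (\<lambda>xs. \<not> p xs)"
proof -
  assume "dec k p"
  then have "computable k (\<lambda>xs. 1 - (if p xs then 1 else 0))" unfolding dec_def by (intro computable_intros)
  then show ?thesis unfolding dec_def by (rule computable_cong) auto
qed

lemma dec_conj: "dec k p \<Longrightarrow> dec k q \<Longrightarrow> dec k (\<lambda>xs. p xs \<and> q xs)"
proof -
  assume "dec k p" "dec k q"
  then have "computable k (\<lambda>xs. (if p xs then 1 else 0) * (if q xs then 1 else 0))"
    unfolding dec_def by (intro computable_intros)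
  then show ?thesis unfolding dec_def by (rule computable_cong) auto
qed

lemma computable_if:
  assumes "dec k p" "computable k f" "computable k g" shows "computable k (\<lambda>xs. if p xs then f xs else g xs)"
proof -
  have "computable k (\<lambda>xs. (if p xs then 1 else 0) * f xs + (1 - (if p xs then 1 else 0)) * g xs)"
    using assms unfolding dec_def by (intro computable_intros)
  then show ?thesis by (rule computable_cong) auto
qed

lemma computable_hd_tl:
  assumes "computable (Suc k) f" "computable k a" shows "computable k (\<lambda>xs. f (a xs # xs))"
proof -
  have "computable k (\<lambda>xs. f (a xs # map (\<lambda>i. xs ! i) [0..<k]))"
    by (rule computable_Cons[OF assms, of "\<lambda>i xs. xs ! i"]) (rule computable_nth)
  then show ?thesis by (rule computable_cong) (metis map_nth)
qed

text \<open>A bounded quantifier is a product of truth values, computed by primitive recursion on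
  the bound.\<close>

lemma dec_all:
  assumes p: "dec (Suc k) p" and b: "computable k b"
  shows "dec k (\<lambda>xs. \<forall>z<b xs. p (z # xs))"
proof -
  \<comment> \<open>The recursion passes the counter, the accumulator and the parameters; the
    accumulator has to be skipped before \<open>p\<close> is evaluated.\<close>
  have "computable (Suc (Suc k)) (\<lambda>xs. (\<lambda>xs. if p xs then 1 else 0) (xs ! 0 # map (\<lambda>i. xs ! Suc (Suc i)) [0..<k]))"
    using p unfolding dec_def by (rule computable_Cons) (auto intro: computable_nth)
  then have "computable (Suc (Suc k)) (\<lambda>xs. xs ! 1 * (if p (xs ! 0 # map (\<lambda>i. xs ! Suc (Suc i)) [0..<k]) then 1 else 0))"
    by (intro computable_intros) auto
  from computable_rec[OF computable_const[of k 1] this]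
  have "computable k (\<lambda>xs. rec_nat 1 (\<lambda>m v. v * (if p (m # map (\<lambda>i. xs ! i) [0..<k]) then 1 else 0)) (b xs))"
    by (auto dest!: computable_hd_tl[OF _ b])
  moreover have "rec_nat 1 (\<lambda>m v. v * (if q m then 1 else 0)) n = (if \<forall>z<n. q z then 1 else (0 :: nat))" for q n
    by (induction n) (auto simp: less_Suc_eq)
  ultimately show ?thesis unfolding dec_def
    by (elim computable_cong) (auto simp: map_nth)
qed

section \<open>Coding of pairs and lists\<close>

lemma fun1_triangle: "fun1 triangle"
  by (rule fun1_rec[of "\<lambda>m v. v + Suc m"]) (auto simp: fun2_def intro!: computable_intros)
lemmas [computable_intros] = fun1_app[OF fun1_triangle]

lemma triangle_mono: "m \<le> n \<Longrightarrow> triangle m \<le> triangle n"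
  by (induction rule: dec_induct) auto

lemma prod_encode_mono: "a \<le> a' \<Longrightarrow> b \<le> b' \<Longrightarrow> prod_encode (a, b) \<le> prod_encode (a', b')"
  unfolding prod_encode_def using triangle_mono[of "a + b" "a' + b'"] by simp

text \<open>The sum of the two components of the pair coded by \<open>z\<close>, that is, the index
  of the largest triangular number not above \<open>z\<close>. Counting up in \<open>z\<close>
  avoids a search.\<close>

primrec diag :: "nat \<Rightarrow> nat" where
  "diag 0 = 0"
| "diag (Suc z) = (if Suc z = triangle (Suc (diag z)) then Suc (diag z) else diag z)"

lemma fun1_diag: "fun1 diag"
proof (rule fun1_rec)
  show "fun2 (\<lambda>m v. if Suc m = triangle (Suc v) then Suc v else v)"
    unfolding fun2_def by (intro computable_if dec_eq computable_intros) auto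
qed simp
lemmas [computable_intros] = fun1_app[OF fun1_diag]

lemma diag_bounds: "triangle (diag z) \<le> z \<and> z < triangle (Suc (diag z))"
  by (induction z) auto

lemma diag_prod_encode: "diag (prod_encode (m, n)) = m + n"
proof -
  let ?z = "prod_encode (m, n)"
  have "triangle (m + n) \<le> ?z" "?z < triangle (Suc (m + n))" by (auto simp: prod_encode_def)
  then show ?thesis
    using diag_bounds[of ?z] triangle_mono[of "Suc (diag ?z)" "m + n"] triangle_mono[of "Suc (m + n)" "diag ?z"]
    by (metis less_le_trans linorder_not_less not_less_eq_eq nle_le)
qed

lemma prod_decode_diag: "prod_decode z = (z - triangle (diag z), diag z - (z - triangle (diag z)))"
proof -
  obtain m n where "z = prod_encode (m, n)" by (metis prod_decode_inverse surj_pair)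
  moreover have "prod_encode (m, n) - triangle (m + n) = m" by (simp add: prod_encode_def)
  ultimately show ?thesis by (simp add: diag_prod_encode)
qed

definition "fstc z = fst (prod_decode z)"
definition "sndc z = snd (prod_decode z)"

lemma fun1_fstc: "fun1 fstc"
  unfolding fun1_def fstc_def prod_decode_diag fst_conv by (intro computable_intros) auto
lemmas [computable_intros] = fun1_app[OF fun1_fstc]

lemma fun1_sndc: "fun1 sndc"
  unfolding fun1_def sndc_def prod_decode_diag snd_conv by (intro computable_intros) auto
lemmas [computable_intros] = fun1_app[OF fun1_sndc]

lemma fun2_prod_encode: "fun2 (\<lambda>a b. prod_encode (a, b))"
  unfolding fun2_def prod_encode_def by (auto intro!: computable_intros)
lemmas [computable_intros] = fun2_app[OF fun2_prod_encode]

text \<open>The code of a nonempty list is the successor of a pair. At the code 0 of the empty list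
  the truncated subtraction gives 0, which decodes to \<open>(0, 0)\<close>: the tail of the empty
  list is empty, and entries out of range are 0.\<close>

definition "tlc l = sndc (l - Suc 0)"
definition "hdc l = fstc (l - Suc 0)"

lemma fun1_hdc: "fun1 hdc" and fun1_tlc: "fun1 tlc"
  unfolding fun1_def hdc_def tlc_def by (auto intro!: computable_intros)
lemmas [computable_intros] = fun1_app[OF fun1_hdc] fun1_app[OF fun1_tlc]

lemma prod_decode_0: "prod_decode 0 = (0, 0)"
  by (simp add: prod_decode_def prod_decode_aux.simps)

lemma tlc_list_encode [simp]: "tlc (list_encode xs) = list_encode (tl xs)"
  by (cases xs) (simp_all add: tlc_def sndc_def prod_decode_0)

definition "dropc i l = (tlc ^^ i) l"
definition "nthc l i = hdc (dropc i l)"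

lemma fun2_dropc: "fun2 dropc"
  by (rule fun2_rec[of "\<lambda>y. y" "\<lambda>m v y. tlc v"]) (auto simp: fun1_id fun3_def dropc_def intro!: computable_intros)
lemmas [computable_intros] = fun2_app[OF fun2_dropc]

lemma fun2_nthc: "fun2 nthc"
  unfolding fun2_def nthc_def by (auto intro!: computable_intros)
lemmas [computable_intros] = fun2_app[OF fun2_nthc]

lemma dropc_list_encode: "dropc i (list_encode xs) = list_encode (drop i xs)"
  by (induction i) (simp_all add: dropc_def drop_Suc tl_drop)

lemma nthc_list_encode: "nthc (list_encode xs) i = (if i < length xs then xs ! i else 0)"
proof (cases "i < length xs")
  case True
  then show ?thesis by (simp add: nthc_def dropc_list_encode hdc_def fstc_def flip: Cons_nth_drop_Suc)
next
  case False
  then show ?thesis by (simp add: nthc_def dropc_list_encode hdc_def fstc_def prod_decode_0)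
qed

definition "lenc l = length (list_decode l)"

lemma lenc_list_encode [simp]: "lenc (list_encode xs) = length xs"
  by (simp add: lenc_def)

lemma length_le_list_encode: "length xs \<le> list_encode xs"
proof (induction xs)
  case (Cons x xs)
  then show ?case using le_prod_encode_2[of "list_encode xs" x] by simp
qed simp

lemma fun1_lenc: "fun1 lenc"
proof -
  \<comment> \<open>\<open>G m l\<close> counts the nonempty tails among the first \<open>m\<close>.
    A list is never longer than its code, so \<open>m = l\<close> counts all of them.\<close>
  define G where "G = rec_nat (\<lambda>l. 0) (\<lambda>m h l. if dropc m l = 0 then h l else Suc (h l))"
  have "fun2 (\<lambda>m v. G m v)"
  proof (rule fun2_rec[of "\<lambda>y. 0" "\<lambda>m v y. if dropc m y = 0 then v else Suc v"])
    show "fun1 (\<lambda>y. 0)" unfolding fun1_def by (rule computable_const)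
    show "fun3 (\<lambda>m v y. if dropc m y = 0 then v else Suc v)"
      unfolding fun3_def by (intro computable_if dec_eq computable_intros) auto
  qed (simp_all add: G_def)
  then have "fun1 (\<lambda>l. G l l)" unfolding fun1_def by (rule fun2_app[OF _ computable_nth computable_nth]) auto
  moreover have "G l l = lenc l" for l
  proof -
    define xs where "xs = list_decode l"
    have l: "l = list_encode xs" by (simp add: xs_def)
    have "G m l = min m (length xs)" for m
    proof (induction m)
      case (Suc m)
      have "dropc m l = 0 \<longleftrightarrow> length xs \<le> m"
        unfolding l dropc_list_encode by (cases "drop m xs") (auto dest: arg_cong[of _ _ length])
      then show ?case using Suc by (auto simp: G_def)
    qed (simp add: G_def)
    then show ?thesis using length_le_list_encode[of xs] by (simp add: l)
  qed
  ultimately show ?thesis by simp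
qed
lemmas [computable_intros] = fun1_app[OF fun1_lenc]

text \<open>By monotonicity of the pairing, the largest code of a list of length \<open>L\<close>
  with entries at most \<open>x\<close>; it bounds the searches for words and tables.\<close>

definition "boundc L x = list_encode (replicate L x)"

lemma fun2_boundc: "fun2 boundc"
proof (rule fun2_rec)
  show "fun1 (\<lambda>y. 0)" unfolding fun1_def by (rule computable_const)
  show "fun3 (\<lambda>m v y. Suc (prod_encode (y, v)))" unfolding fun3_def by (intro computable_intros) auto
qed (simp_all add: boundc_def)
lemmas [computable_intros] = fun2_app[OF fun2_boundc]

lemma list_encode_le_boundc: "\<forall>a\<in>set xs. a \<le> x \<Longrightarrow> list_encode xs \<le> boundc (length xs) x"
  by (induction xs) (simp_all add: boundc_def prod_encode_mono)

lemma list_encode_member: "a \<in> set xs \<Longrightarrow> a < list_encode xs"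
proof (induction xs)
  case (Cons x xs)
  then show ?case using le_prod_encode_1[of x "list_encode xs"] le_prod_encode_2[of "list_encode xs" x] by auto
qed simp

definition "memc a l \<longleftrightarrow> a \<in> set (list_decode l)"

lemma memc_list_encode [simp]: "memc a (list_encode xs) \<longleftrightarrow> a \<in> set xs"
  by (simp add: memc_def)

lemma dec_memc:
  assumes "computable k f" "computable k g" shows "dec k (\<lambda>xs. memc (f xs) (g xs))"
proof -
  have eq: "memc a l \<longleftrightarrow> \<not> (\<forall>i<lenc l. nthc l i \<noteq> a)" for a l
    using nthc_list_encode[of "list_decode l"] by (auto simp: memc_def lenc_def in_set_conv_nth)
  have "dec 2 (\<lambda>xs. \<not> (\<forall>i<lenc (xs ! 1). (\<lambda>ys. \<not> nthc (ys ! 2) (ys ! 0) = ys ! 1) (i # xs)))"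
    by (intro dec_not dec_all dec_eq computable_intros) auto
  then have "computable 2 (\<lambda>xs. if memc (xs ! 0) (xs ! 1) then 1 else 0)"
    unfolding dec_def eq by (rule computable_cong) simp
  then show ?thesis using fun2_app[of "\<lambda>a l. if memc a l then 1 else 0"] assms
    unfolding fun2_def dec_def by blast
qed

text \<open>Bounded formulas over the coding functions, with de Bruijn indices into the environment.\<close>

datatype tm = Var nat | Cst nat | Sc tm | Fs tm | Sn tm | Ln tm | Pw tm | Nt tm tm | Bd tm tm

primrec tmval :: "tm \<Rightarrow> nat list \<Rightarrow> nat" where
  "tmval (Var i) e = (if i < length e then e ! i else 0)"
| "tmval (Cst c) e = c"
| "tmval (Sc t) e = Suc (tmval t e)"
| "tmval (Fs t) e = fstc (tmval t e)"
| "tmval (Sn t) e = sndc (tmval t e)"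
| "tmval (Ln t) e = lenc (tmval t e)"
| "tmval (Pw t) e = 2 ^ tmval t e"
| "tmval (Nt s t) e = nthc (tmval s e) (tmval t e)"
| "tmval (Bd s t) e = boundc (tmval s e) (tmval t e)"

lemma computable_tmval: "computable k (tmval t)"
proof (induction t)
  case (Var i)
  have "computable k (\<lambda>xs. if i < k then xs ! i else 0)"
    by (cases "i < k") (auto intro!: computable_intros)
  then show ?case by (rule computable_cong) simp
qed (simp_all only: tmval.simps, (intro computable_intros; assumption?)+)

text \<open>\<open>All\<close> ranges strictly below its term, which is why inclusive bounds appear
  with \<open>Sc\<close>. \<open>Bind\<close> names a computed value.\<close>

datatype fm = Eq tm tm | Mem tm tm | Ng fm | Cj fm fm | All tm fm | Bind tm fm

primrec holds :: "fm \<Rightarrow> nat list \<Rightarrow> bool" where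
  "holds (Eq s t) e \<longleftrightarrow> tmval s e = tmval t e"
| "holds (Mem s t) e \<longleftrightarrow> memc (tmval s e) (tmval t e)"
| "holds (Ng p) e \<longleftrightarrow> \<not> holds p e"
| "holds (Cj p q) e \<longleftrightarrow> holds p e \<and> holds q e"
| "holds (All t p) e \<longleftrightarrow> (\<forall>z<tmval t e. holds p (z # e))"
| "holds (Bind t p) e \<longleftrightarrow> holds p (tmval t e # e)"

lemma dec_holds: "dec k (holds p)"
proof (induction p arbitrary: k)
  case (Bind t p)
  have "computable k (\<lambda>xs. (\<lambda>ys. if holds p ys then 1 else 0) (tmval t xs # xs))"
    using Bind[of "Suc k"] computable_tmval unfolding dec_def by (rule computable_hd_tl)
  then show ?case by (simp add: dec_def)
next
  case (All t p)
  then show ?case unfolding holds.simps[abs_def] by (intro dec_all computable_tmval)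
qed (unfold holds.simps[abs_def], intro dec_eq dec_memc dec_not dec_conj computable_tmval; blast)+

lemma decidable_holds: "decidable {x. holds p [x]}"
proof -
  obtain r where r: "\<And>xs. length xs = 1 \<Longrightarrow> rec_apply r xs = Some (if holds p xs then 1 else 0)"
    using dec_holds[of 1 p] unfolding dec_def computable_def by blast
  have "rec_apply r [x] = Some (if x \<in> {x. holds p [x]} then 1 else 0)" for x by (simp add: r)
  then show ?thesis unfolding decidable_def by blast
qed

definition "Imp p q = Ng (Cj p (Ng q))"
definition "Exi t p = Ng (All t (Ng p))"

lemma holds_Imp [simp]: "holds (Imp p q) e \<longleftrightarrow> (holds p e \<longrightarrow> holds q e)"
  by (simp add: Imp_def)

lemma holds_Exi [simp]: "holds (Exi t p) e \<longleftrightarrow> (\<exists>z<tmval t e. holds p (z # e))"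
  by (simp add: Exi_def)

section \<open>The decision procedure\<close>

text \<open>The lists \<open>bs\<close>, \<open>rs\<close>, \<open>us\<close> below stand for their codes. The formula \<open>valid_fm\<close> and the formula
  \<open>subuniverse_fm\<close> are evaluated in the environment \<open>[bs, rs, us, x]\<close>; \<open>poly_fm\<close> and \<open>absorbing_fm\<close> in
  \<open>[T, W, L, bs, rs, us, x]\<close>, where \<open>L\<close> is an arity, all codes of words of length \<open>L\<close> with entries at most \<open>x\<close> are
  below \<open>W\<close>, and \<open>T\<close> codes a list whose entry at the code of a word is the value at that word. The arity
  tested in \<open>problem_fm\<close> is justified by \<open>card_rel_sets\<close>.\<close>

definition valid_fm :: fm where
  "valid_fm = Cj
     (All (Ln (Var 1)) (Bind (Nt (Var 2) (Var 0)) (All (Ln (Sn (Var 0))) (Bind (Nt (Sn (Var 1)) (Var 0))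
        (Cj (Eq (Ln (Var 0)) (Fs (Var 2))) (All (Ln (Var 0)) (Mem (Nt (Var 1) (Var 0)) (Var 7))))))))
     (All (Ln (Var 0)) (Mem (Nt (Var 1) (Var 0)) (Var 3)))"

text \<open>No term builds a column of a list of tuples. The innermost quantifier over codes
  therefore runs through all words, and its premise singles out the column by its entries.\<close>

definition poly_fm :: fm where
  "poly_fm = Cj (Ng (Eq (Var 2) (Cst 0))) (Cj
     (All (Var 1) (Imp (Cj (Eq (Ln (Var 0)) (Var 3)) (All (Var 3) (Mem (Nt (Var 1) (Var 0)) (Var 7))))
        (Mem (Nt (Var 1) (Var 0)) (Var 6))))
     (All (Ln (Var 4)) (Bind (Nt (Var 5) (Var 0))
        (All (Var 3) (Imp (Cj (Eq (Ln (Var 0)) (Var 5)) (All (Var 5) (Mem (Nt (Var 1) (Var 0)) (Sn (Var 2)))))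
          (Exi (Ln (Sn (Var 1))) (All (Fs (Var 2)) (All (Var 6)
            (Imp (Cj (Eq (Ln (Var 0)) (Var 8))
                (All (Var 8) (Eq (Nt (Var 1) (Var 0)) (Nt (Nt (Var 4) (Var 0)) (Var 2)))))
              (Eq (Nt (Nt (Sn (Var 4)) (Var 2)) (Var 1)) (Nt (Var 6) (Var 0))))))))))))"

text \<open>The code of \<open>bs\<close> is at once the list of elements of the subset and the
  position of the word \<open>bs\<close> in the table.\<close>

definition subuniverse_fm :: fm where
  "subuniverse_fm = Bind (Ln (Var 0)) (Bind (Sc (Bd (Var 0) (Var 4)))
     (All (Sc (Bd (Var 0) (Var 5))) (Imp poly_fm (Mem (Nt (Var 0) (Var 3)) (Var 3)))))"

definition absorbing_fm :: fm where
  "absorbing_fm = Cj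
     (All (Sc (Var 6)) (Imp (Mem (Var 0) (Var 6)) (All (Var 2)
       (Imp (Cj (Eq (Ln (Var 0)) (Var 4)) (All (Var 4) (Eq (Nt (Var 1) (Var 0)) (Var 2))))
         (Eq (Nt (Var 2) (Var 0)) (Var 1))))))
     (All (Var 1) (Imp (Cj (Eq (Ln (Var 0)) (Var 3))
         (Cj (All (Var 3) (Mem (Nt (Var 1) (Var 0)) (Var 7)))
           (All (Var 3) (All (Var 4)
             (Imp (Cj (Ng (Mem (Nt (Var 2) (Var 1)) (Var 6))) (Ng (Mem (Nt (Var 2) (Var 0)) (Var 6))))
               (Eq (Var 1) (Var 0)))))))
       (Mem (Nt (Var 1) (Var 0)) (Var 4))))"

definition problem_fm :: fm where
  "problem_fm = Bind (Fs (Var 0)) (Bind (Fs (Sn (Var 1))) (Bind (Sn (Sn (Var 2)))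
     (Cj valid_fm (Cj subuniverse_fm
       (Bind (Sc (Pw (Pw (Pw (Sc (Sc (Var 3))))))) (Bind (Sc (Bd (Var 0) (Var 4)))
         (Exi (Sc (Bd (Var 0) (Var 5))) (Cj poly_fm absorbing_fm))))))))"

text \<open>A condition that bounds all entries by \<open>x\<close> keeps the codes of words of
  length \<open>L\<close> within \<open>boundc L x\<close>, so the bounded quantifier misses none of
  them.\<close>

lemma words_below_bound:
  assumes "\<And>i a. i < L \<Longrightarrow> p i a \<Longrightarrow> a \<le> x"
  shows "(\<forall>w<Suc (boundc L x). lenc w = L \<and> (\<forall>i<L. p i (nthc w i)) \<longrightarrow> q w) \<longleftrightarrow>
    (\<forall>ws. length ws = L \<and> (\<forall>i<L. p i (ws ! i)) \<longrightarrow> q (list_encode ws))" (is "?l \<longleftrightarrow> ?r")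
proof
  assume l: ?l
  show ?r
  proof (intro allI impI)
    fix ws assume ws: "length ws = L \<and> (\<forall>i<L. p i (ws ! i))"
    then have "\<forall>a\<in>set ws. a \<le> x" using assms by (auto simp: in_set_conv_nth)
    then have "list_encode ws < Suc (boundc L x)" using list_encode_le_boundc ws by fastforce
    then show "q (list_encode ws)" using l ws by (simp add: nthc_list_encode)
  qed
next
  assume r: ?r
  show ?l
  proof (intro allI impI)
    fix w assume "lenc w = L \<and> (\<forall>i<L. p i (nthc w i))"
    then show "q w" using r[rule_format, of "list_decode w"] nthc_list_encode[of "list_decode w"] by (simp add: lenc_def)
  qed
qed

lemma all_nth_in_iff: "length ws = L \<Longrightarrow> (\<forall>i<L. ws ! i \<in> X) \<longleftrightarrow> set ws \<subseteq> X"
  by (auto simp: in_set_conv_nth subset_iff)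

definition table_op :: "nat \<Rightarrow> nat list \<Rightarrow> nat" where
  "table_op T ws = nthc T (list_encode ws)"

text \<open>Columns of tuples of a relation consist of elements of the universe, so other arguments
  never matter; a table agrees with its operation only on these words.\<close>

lemma polymorphism_cong_on:
  assumes "polymorphism S n f" "finite_rel_structure S" "\<And>xs. xs \<in> tuples (universe S) n \<Longrightarrow> f xs = g xs"
  shows "polymorphism S n g"
  unfolding polymorphism_def
proof (intro conjI ballI)
  fix kR assume "kR \<in> set (rels S)"
  then obtain k R where kR: "kR = (k, R)" "(k, R) \<in> set (rels S)" by (metis surj_pair)
  then have pres: "preserves n f k R" using assms(1) by (auto simp: polymorphism_def)
  have "preserves n g k R"
    unfolding preserves_def
  proof
    fix ts assume ts: "ts \<in> tuples R n"
    have "map (\<lambda>t. t ! j) ts \<in> tuples (universe S) n" if "j < k" for j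
      using ts that assms(2) kR(2) by (fastforce simp: finite_rel_structure_def tuples_def)
    then have "map (\<lambda>j. g (map (\<lambda>t. t ! j) ts)) [0..<k] = map (\<lambda>j. f (map (\<lambda>t. t ! j) ts)) [0..<k]"
      using assms(3) by simp
    then show "map (\<lambda>j. g (map (\<lambda>t. t ! j) ts)) [0..<k] \<in> R"
      using pres ts unfolding preserves_def by metis
  qed
  then show "case kR of (k, R) \<Rightarrow> preserves n g k R" using kR by simp
qed (use assms in \<open>auto simp: polymorphism_def\<close>)

lemma fstc_prod_encode [simp]: "fstc (prod_encode (a, b)) = a"
  and sndc_prod_encode [simp]: "sndc (prod_encode (a, b)) = b"
  by (simp_all add: fstc_def sndc_def)

section \<open>Correctness of the formulas\<close>

locale input =
  fixes us :: "nat list" and rs :: "(nat \<times> nat list list) list" and bs :: "nat list" and x :: nat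
  assumes x: "x = encode_input us rs bs"
begin

abbreviation "S \<equiv> input_structure us rs"
abbreviation "env \<equiv> [list_encode bs, list_encode (map encode_rel rs), list_encode us, x]"

lemma us_le: "a \<in> set us \<Longrightarrow> a \<le> x"
  using list_encode_member[of a us] le_prod_encode_1[of "list_encode us"] unfolding x encode_input_def
  by (meson le_trans less_imp_le)

lemma tuple_le: "(k, ts) \<in> set rs \<Longrightarrow> t \<in> set ts \<Longrightarrow> list_encode t \<le> x"
proof -
  assume "(k, ts) \<in> set rs" "t \<in> set ts"
  then have "list_encode t < list_encode (map list_encode ts)" by (intro list_encode_member) auto
  also have "\<dots> \<le> encode_rel (k, ts)" by (simp add: encode_rel_def le_prod_encode_2)
  also have "\<dots> < list_encode (map encode_rel rs)" using \<open>(k, ts) \<in> set rs\<close> by (intro list_encode_member) auto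
  also have "\<dots> \<le> x" unfolding x encode_input_def by (meson le_prod_encode_1 le_prod_encode_2 le_trans)
  finally show ?thesis by simp
qed

lemma nthc_rel: "\<rho> < length rs \<Longrightarrow> nthc (list_encode (map encode_rel rs)) \<rho> =
    prod_encode (fst (rs ! \<rho>), list_encode (map list_encode (snd (rs ! \<rho>))))"
  by (simp add: nthc_list_encode encode_rel_def)

lemma universe_S: "universe S = set us"
  by (simp add: input_structure_def)

lemma rels_S: "set (rels S) = (\<lambda>(k, ts). (k, set ts)) ` set rs"
  by (simp add: input_structure_def)

lemma holds_valid: "holds valid_fm env \<longleftrightarrow> finite_rel_structure S \<and> set bs \<subseteq> set us"
proof -
  have t: "(\<forall>i<length ts. length (ts ! i) = k \<and> (\<forall>j<length (ts ! i). ts ! i ! j \<in> set us)) \<longleftrightarrow>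
    set ts \<subseteq> tuples (set us) k" for ts k
  proof -
    have "(\<forall>i<length ts. length (ts ! i) = k \<and> (\<forall>j<length (ts ! i). ts ! i ! j \<in> set us)) \<longleftrightarrow>
      (\<forall>t\<in>set ts. length t = k \<and> (\<forall>j<length t. t ! j \<in> set us))" by (simp add: all_set_conv_all_nth)
    also have "\<dots> \<longleftrightarrow> set ts \<subseteq> tuples (set us) k" by (auto simp: tuples_def all_nth_in_iff[OF refl])
    finally show ?thesis .
  qed
  have "holds valid_fm env \<longleftrightarrow> (\<forall>\<rho><length rs. \<forall>i<length (snd (rs ! \<rho>)).
      length (snd (rs ! \<rho>) ! i) = fst (rs ! \<rho>) \<and> (\<forall>j<length (snd (rs ! \<rho>) ! i). snd (rs ! \<rho>) ! i ! j \<in> set us)) \<and>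
      (\<forall>i<length bs. bs ! i \<in> set us)"
    by (simp add: valid_fm_def nthc_list_encode encode_rel_def cong: conj_cong)
  also have "\<dots> \<longleftrightarrow> (\<forall>\<rho><length rs. set (snd (rs ! \<rho>)) \<subseteq> tuples (set us) (fst (rs ! \<rho>))) \<and> set bs \<subseteq> set us"
    unfolding t by (simp add: all_nth_in_iff)
  also have "\<dots> \<longleftrightarrow> finite_rel_structure S \<and> set bs \<subseteq> set us"
    by (simp add: finite_rel_structure_def universe_S rels_S all_set_conv_all_nth split_beta)
  finally show ?thesis .
qed

context
  assumes S: "finite_rel_structure S"
begin

lemma rel_tuple: "(k, ts) \<in> set rs \<Longrightarrow> t \<in> set ts \<Longrightarrow> length t = k \<and> set t \<subseteq> set us"
  using S by (force simp: finite_rel_structure_def rels_S universe_S tuples_def)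

text \<open>Bridge to \<open>poly_fm\<close>, which sees codes of tuples and cannot form the result
  tuple: the result is compared coordinate by coordinate with the \<open>z\<close>-th tuple of the
  relation, which decides equality as that tuple has length \<open>k\<close>.\<close>

lemma preserves_code:
  assumes k: "(k, ts) \<in> set rs"
  shows "preserves L f k (set ts) \<longleftrightarrow>
    (\<forall>cs. length cs = L \<and> (\<forall>i<L. cs ! i \<in> list_encode ` set ts) \<longrightarrow>
      (\<exists>z<length ts. \<forall>j<k. ts ! z ! j = f (map (\<lambda>c. nthc c j) cs)))" (is "?l \<longleftrightarrow> ?r")
proof -
  have eq: "map (\<lambda>j. f (map (\<lambda>t. t ! j) us)) [0..<k] \<in> set ts \<longleftrightarrow>
    (\<exists>z<length ts. \<forall>j<k. ts ! z ! j = f (map (\<lambda>c. nthc c j) (map list_encode us)))"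
    if us: "set us \<subseteq> set ts" for us
  proof -
    have m: "map (\<lambda>c. nthc c j) (map list_encode us) = map (\<lambda>t. t ! j) us" if "j < k" for j
      using rel_tuple[OF k] us that by (auto simp: nthc_list_encode)
    have "map (\<lambda>j. f (map (\<lambda>t. t ! j) us)) [0..<k] \<in> set ts \<longleftrightarrow>
      (\<exists>z<length ts. ts ! z = map (\<lambda>j. f (map (\<lambda>t. t ! j) us)) [0..<k])" by (rule in_set_conv_nth)
    also have "\<dots> \<longleftrightarrow> (\<exists>z<length ts. \<forall>j<k. ts ! z ! j = f (map (\<lambda>t. t ! j) us))"
    proof (rule ex_cong1, rule conj_cong[OF refl])
      fix z assume "z < length ts"
      then show "ts ! z = map (\<lambda>j. f (map (\<lambda>t. t ! j) us)) [0..<k] \<longleftrightarrow> (\<forall>j<k. ts ! z ! j = f (map (\<lambda>t. t ! j) us))"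
        using rel_tuple[OF k, of "ts ! z"] by (auto simp: list_eq_iff_nth_eq)
    qed
    also have "\<dots> \<longleftrightarrow> (\<exists>z<length ts. \<forall>j<k. ts ! z ! j = f (map (\<lambda>c. nthc c j) (map list_encode us)))"
    proof (rule ex_cong1, rule conj_cong[OF refl], rule all_cong1, rule imp_cong[OF refl])
      fix z j assume "j < k"
      then show "ts ! z ! j = f (map (\<lambda>t. t ! j) us) \<longleftrightarrow> ts ! z ! j = f (map (\<lambda>c. nthc c j) (map list_encode us))"
        by (simp only: m)
    qed
    finally show ?thesis .
  qed
  have "?r \<longleftrightarrow> (\<forall>us. length us = L \<and> set us \<subseteq> set ts \<longrightarrow>
    (\<exists>z<length ts. \<forall>j<k. ts ! z ! j = f (map (\<lambda>c. nthc c j) (map list_encode us))))" (is "_ \<longleftrightarrow> ?m")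
  proof
    assume r: ?r
    show ?m
    proof (intro allI impI)
      fix us assume "length us = L \<and> set us \<subseteq> set ts"
      then show "\<exists>z<length ts. \<forall>j<k. ts ! z ! j = f (map (\<lambda>c. nthc c j) (map list_encode us))"
        by (intro r[rule_format]) (auto simp: subset_iff)
    qed
  next
    assume m: ?m
    show ?r
    proof (intro allI impI)
      fix cs assume cs: "length cs = L \<and> (\<forall>i<L. cs ! i \<in> list_encode ` set ts)"
      then have "set cs \<subseteq> list_encode ` set ts" by (auto simp: in_set_conv_nth)
      then have "set (map list_decode cs) \<subseteq> set ts" by auto
      from m[rule_format, of "map list_decode cs", OF conjI[OF _ this]]
      show "\<exists>z<length ts. \<forall>j<k. ts ! z ! j = f (map (\<lambda>c. nthc c j) cs)" using cs by (simp add: comp_def)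
    qed
  qed
  also have "\<dots> \<longleftrightarrow> ?l" unfolding preserves_def tuples_def using eq by auto
  finally show ?thesis by simp
qed

lemma holds_poly:
  "holds poly_fm (T # Suc (boundc L x) # L # env) \<longleftrightarrow> polymorphism S L (table_op T)"
proof -
  let ?W = "Suc (boundc L x)"
  have 1: "(\<forall>w<?W. lenc w = L \<and> (\<forall>i<L. nthc w i \<in> set us) \<longrightarrow> nthc T w \<in> set us) \<longleftrightarrow>
    (\<forall>ws\<in>tuples (universe S) L. table_op T ws \<in> universe S)"
    unfolding universe_S by (subst words_below_bound)
      (auto simp: us_le tuples_def table_op_def all_nth_in_iff)
  have 2: "(\<forall>w<?W. lenc w = L \<and> (\<forall>i<L. nthc w i \<in> list_encode ` set (snd (rs ! \<rho>))) \<longrightarrow>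
      (\<exists>z<length (snd (rs ! \<rho>)). \<forall>j<fst (rs ! \<rho>). \<forall>v<?W. lenc v = L \<and> (\<forall>i<L. nthc v i = nthc (nthc w i) j) \<longrightarrow>
        nthc (list_encode (snd (rs ! \<rho>) ! z)) j = nthc T v)) \<longleftrightarrow>
    preserves L (table_op T) (fst (rs ! \<rho>)) (set (snd (rs ! \<rho>)))" (is "?l \<longleftrightarrow> _") if \<rho>: "\<rho> < length rs" for \<rho>
  proof -
    let ?k = "fst (rs ! \<rho>)" and ?ts = "snd (rs ! \<rho>)"
    have k: "(?k, ?ts) \<in> set rs" using \<rho> by simp
    have "?l \<longleftrightarrow> (\<forall>cs. length cs = L \<and> (\<forall>i<L. cs ! i \<in> list_encode ` set ?ts) \<longrightarrow>
      (\<exists>z<length ?ts. \<forall>j<?k. \<forall>v<?W. lenc v = L \<and> (\<forall>i<L. nthc v i = nthc (nthc (list_encode cs) i) j) \<longrightarrow>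
        nthc (list_encode (?ts ! z)) j = nthc T v))"
      using tuple_le[OF k] by (intro words_below_bound) auto
    also have "\<dots> \<longleftrightarrow> (\<forall>cs. length cs = L \<and> (\<forall>i<L. cs ! i \<in> list_encode ` set ?ts) \<longrightarrow>
      (\<exists>z<length ?ts. \<forall>j<?k. ?ts ! z ! j = table_op T (map (\<lambda>c. nthc c j) cs)))"
    proof (rule all_cong1, rule imp_cong[OF refl], rule ex_cong1, rule conj_cong[OF refl], rule all_cong1,
        rule imp_cong[OF refl])
      fix cs z j assume cs: "length cs = L \<and> (\<forall>i<L. cs ! i \<in> list_encode ` set ?ts)"
        and z: "z < length ?ts" and j: "j < ?k"
      \<comment> \<open>The entries of the column are elements of the structure, so its code is
        below \<open>?W\<close> and the premise on \<open>v\<close> is met by exactly this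
        code.\<close>
      have le: "nthc (nthc (list_encode cs) i) j \<le> x" if i: "i < L" for i
      proof -
        obtain t where t: "t \<in> set ?ts" "cs ! i = list_encode t" using cs i by blast
        then have "t ! j \<in> set us" using rel_tuple[OF k t(1)] j by (auto simp: subset_iff)
        then show ?thesis using t us_le cs i j rel_tuple[OF k t(1)] by (simp add: nthc_list_encode)
      qed
      have "(\<forall>v<?W. lenc v = L \<and> (\<forall>i<L. nthc v i = nthc (nthc (list_encode cs) i) j) \<longrightarrow>
          nthc (list_encode (?ts ! z)) j = nthc T v) \<longleftrightarrow>
        (\<forall>ws. length ws = L \<and> (\<forall>i<L. ws ! i = nthc (nthc (list_encode cs) i) j) \<longrightarrow>
          nthc (list_encode (?ts ! z)) j = nthc T (list_encode ws))"
        using le by (intro words_below_bound) auto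
      also have "\<dots> \<longleftrightarrow> (\<forall>ws. ws = map (\<lambda>c. nthc c j) cs \<longrightarrow>
          nthc (list_encode (?ts ! z)) j = nthc T (list_encode ws))"
      proof (rule all_cong1)
        fix ws
        have "length ws = L \<and> (\<forall>i<L. ws ! i = nthc (nthc (list_encode cs) i) j) \<longleftrightarrow> ws = map (\<lambda>c. nthc c j) cs"
          using cs by (auto simp: list_eq_iff_nth_eq nthc_list_encode)
        then show "(length ws = L \<and> (\<forall>i<L. ws ! i = nthc (nthc (list_encode cs) i) j) \<longrightarrow>
            nthc (list_encode (?ts ! z)) j = nthc T (list_encode ws)) \<longleftrightarrow>
          (ws = map (\<lambda>c. nthc c j) cs \<longrightarrow> nthc (list_encode (?ts ! z)) j = nthc T (list_encode ws))" by simp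
      qed
      finally show "(\<forall>v<?W. lenc v = L \<and> (\<forall>i<L. nthc v i = nthc (nthc (list_encode cs) i) j) \<longrightarrow>
          nthc (list_encode (?ts ! z)) j = nthc T v) \<longleftrightarrow> ?ts ! z ! j = table_op T (map (\<lambda>c. nthc c j) cs)"
        using rel_tuple[OF k, of "?ts ! z"] z j by (simp add: nthc_list_encode table_op_def)
    qed
    also have "\<dots> \<longleftrightarrow> preserves L (table_op T) ?k (set ?ts)" using preserves_code[OF k] by simp
    finally show ?thesis .
  qed
  have "holds poly_fm (T # ?W # L # env) \<longleftrightarrow> L \<noteq> 0 \<and>
    (\<forall>w<?W. lenc w = L \<and> (\<forall>i<L. nthc w i \<in> set us) \<longrightarrow> nthc T w \<in> set us) \<and>
    (\<forall>\<rho><length rs. \<forall>w<?W. lenc w = L \<and> (\<forall>i<L. nthc w i \<in> list_encode ` set (snd (rs ! \<rho>))) \<longrightarrow>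
      (\<exists>z<length (snd (rs ! \<rho>)). \<forall>j<fst (rs ! \<rho>). \<forall>v<?W. lenc v = L \<and> (\<forall>i<L. nthc v i = nthc (nthc w i) j) \<longrightarrow>
        nthc (list_encode (snd (rs ! \<rho>) ! z)) j = nthc T v))"
    by (simp add: poly_fm_def nthc_rel nthc_list_encode[of "map list_encode _"] cong: conj_cong)
  also have "\<dots> \<longleftrightarrow> polymorphism S L (table_op T)"
    unfolding 1 polymorphism_def rels_S using 2 by (auto simp: all_set_conv_all_nth split: prod.splits)
  finally show ?thesis .
qed

lemma table_exists:
  assumes "\<forall>ws\<in>tuples (set us) L. f ws \<in> set us"
  shows "\<exists>T<Suc (boundc (Suc (boundc L x)) x). \<forall>ws\<in>tuples (set us) L. table_op T ws = f ws"
proof -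
  let ?W = "Suc (boundc L x)"
  \<comment> \<open>Positions that are not codes of words over \<open>us\<close> get the value 0,
    which respects the bound \<open>x\<close> on the entries.\<close>
  define vs where "vs = map (\<lambda>c. if list_decode c \<in> tuples (set us) L then f (list_decode c) else 0) [0..<?W]"
  have "\<forall>a\<in>set vs. a \<le> x" using assms us_le by (auto simp: vs_def)
  moreover have "length vs = ?W" by (simp add: vs_def)
  ultimately have "list_encode vs < Suc (boundc ?W x)" using list_encode_le_boundc by (metis le_imp_less_Suc)
  moreover have "table_op (list_encode vs) ws = f ws" if ws: "ws \<in> tuples (set us) L" for ws
  proof -
    have "list_encode ws < ?W" using ws us_le list_encode_le_boundc[of ws x] by (auto simp: tuples_def less_Suc_eq_le)
    then show ?thesis using ws by (simp add: table_op_def nthc_list_encode vs_def del: upt_Suc)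
  qed
  ultimately show ?thesis by blast
qed

lemma polymorphism_table:
  assumes "polymorphism S L f"
  shows "\<exists>T<Suc (boundc (Suc (boundc L x)) x). polymorphism S L (table_op T) \<and>
    (\<forall>ws\<in>tuples (set us) L. table_op T ws = f ws)"
proof -
  obtain T where T: "T < Suc (boundc (Suc (boundc L x)) x)" "\<forall>ws\<in>tuples (set us) L. table_op T ws = f ws"
    using table_exists[of L f] assms by (auto simp: polymorphism_def universe_S)
  moreover have "polymorphism S L (table_op T)"
    using polymorphism_cong_on[OF assms S] T(2) by (simp add: universe_S)
  ultimately show ?thesis by blast
qed

text \<open>It suffices to test operations whose arity is the length of \<open>bs\<close> on the word \<open>bs\<close>: every word over
  \<open>bs\<close> arises from it by identifying, permuting and adding variables.\<close>

lemma holds_subuniverse: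
  assumes bs: "set bs \<subseteq> set us"
  shows "holds subuniverse_fm env \<longleftrightarrow> subuniverse (set bs) (Pol S)"
proof -
  let ?L = "length bs"
  have "holds subuniverse_fm env \<longleftrightarrow>
    (\<forall>T<Suc (boundc (Suc (boundc ?L x)) x). polymorphism S ?L (table_op T) \<longrightarrow> table_op T bs \<in> set bs)"
    by (simp add: subuniverse_fm_def table_op_def flip: holds_poly)
  also have "\<dots> \<longleftrightarrow> subuniverse (set bs) (Pol S)" (is "?l \<longleftrightarrow> ?r")
  proof
    assume r: ?r
    have "bs \<in> tuples (set bs) ?L" by (simp add: tuples_def)
    then show ?l using r by (auto simp: subuniverse_def Pol_def)
  next
    assume l: ?l
    have "f xs \<in> set bs" if f: "polymorphism S n f" and xs: "xs \<in> tuples (set bs) n" for n f xs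
    proof -
      have "\<forall>i<n. \<exists>k<?L. xs ! i = bs ! k" using xs by (auto simp: tuples_def in_set_conv_nth subset_iff) (metis nth_mem)
      then obtain \<sigma> where \<sigma>: "\<And>i. i < n \<Longrightarrow> \<sigma> i < ?L \<and> xs ! i = bs ! \<sigma> i" by metis
      define gs where "gs = map (\<lambda>i ys. ys ! \<sigma> i :: nat) [0..<n]"
      have "0 < n" using f by (simp add: polymorphism_def)
      then have "0 < ?L" using \<sigma>[of 0] by linarith
      then have g: "polymorphism S ?L (\<lambda>ys. f (map (\<lambda>g. g ys) gs))"
        using \<sigma> polymorphism_proj[OF S] by (intro polymorphism_comp[OF f]) (auto simp: gs_def)
      obtain T where T: "T < Suc (boundc (Suc (boundc ?L x)) x)" "polymorphism S ?L (table_op T)"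
        "\<forall>ws\<in>tuples (set us) ?L. table_op T ws = f (map (\<lambda>g. g ws) gs)" using polymorphism_table[OF g] by blast
      have "map (\<lambda>g. g bs) gs = xs" using \<sigma> xs by (intro nth_equalityI) (auto simp: gs_def tuples_def)
      moreover have "bs \<in> tuples (set us) ?L" using bs by (simp add: tuples_def)
      ultimately have "table_op T bs = f xs" using T(3) by simp
      then show ?thesis using l T by metis
    qed
    then show ?r using bs by (auto simp: subuniverse_def Pol_def universe_S)
  qed
  finally show ?thesis .
qed

lemma holds_absorbing:
  assumes bs: "set bs \<subseteq> set us"
  shows "holds absorbing_fm (T # Suc (boundc L x) # L # env) \<longleftrightarrow> absorbing_op (set us) (set bs) L (table_op T)"
proof -
  let ?W = "Suc (boundc L x)"
  have 1: "(\<forall>w<?W. lenc w = L \<and> (\<forall>i<L. nthc w i = a) \<longrightarrow> nthc T w = a) \<longleftrightarrow> table_op T (replicate L a) = a"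
    if "a \<in> set us" for a
  proof -
    have "(\<forall>w<?W. lenc w = L \<and> (\<forall>i<L. nthc w i = a) \<longrightarrow> nthc T w = a) \<longleftrightarrow>
      (\<forall>ws. length ws = L \<and> (\<forall>i<L. ws ! i = a) \<longrightarrow> nthc T (list_encode ws) = a)"
      using us_le[OF that] by (intro words_below_bound) auto
    moreover have "length ws = L \<and> (\<forall>i<L. ws ! i = a) \<longleftrightarrow> ws = replicate L a" for ws
      by (auto simp: list_eq_iff_nth_eq)
    ultimately show ?thesis by (simp add: table_op_def)
  qed
  have 2: "(\<forall>w<?W. lenc w = L \<and> (\<forall>i<L. nthc w i \<in> set us) \<longrightarrow>
      (\<forall>i<L. \<forall>j<L. nthc w i \<notin> set bs \<and> nthc w j \<notin> set bs \<longrightarrow> i = j) \<longrightarrow> nthc T w \<in> set bs) \<longleftrightarrow>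
    (\<forall>ws\<in>tuples (set us) L. card {i. i < L \<and> ws ! i \<notin> set bs} \<le> 1 \<longrightarrow> table_op T ws \<in> set bs)"
  proof -
    have card: "card {i. i < L \<and> ws ! i \<notin> set bs} \<le> 1 \<longleftrightarrow>
      (\<forall>i<L. \<forall>j<L. nthc (list_encode ws) i \<notin> set bs \<and> nthc (list_encode ws) j \<notin> set bs \<longrightarrow> i = j)"
      if "length ws = L" for ws
      using that by (auto simp: card_le_Suc0_iff_eq nthc_list_encode)
    show ?thesis
      by (subst words_below_bound) (use us_le card in \<open>auto simp: tuples_def table_op_def all_nth_in_iff\<close>)
  qed
  have "holds absorbing_fm (T # ?W # L # env) \<longleftrightarrow>
    (\<forall>a<Suc x. a \<in> set us \<longrightarrow> (\<forall>w<?W. lenc w = L \<and> (\<forall>i<L. nthc w i = a) \<longrightarrow> nthc T w = a)) \<and>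
    (\<forall>w<?W. lenc w = L \<and> (\<forall>i<L. nthc w i \<in> set us) \<longrightarrow>
      (\<forall>i<L. \<forall>j<L. nthc w i \<notin> set bs \<and> nthc w j \<notin> set bs \<longrightarrow> i = j) \<longrightarrow> nthc T w \<in> set bs)"
    by (simp add: absorbing_fm_def imp_conjL)
  also have "\<dots> \<longleftrightarrow> (\<forall>a\<in>set us. table_op T (replicate L a) = a) \<and>
    (\<forall>ws\<in>tuples (set us) L. card {i. i < L \<and> ws ! i \<notin> set bs} \<le> 1 \<longrightarrow> table_op T ws \<in> set bs)"
    unfolding 2 using 1 us_le by (simp add: less_Suc_eq_le) blast
  also have "\<dots> \<longleftrightarrow> absorbing_op (set us) (set bs) L (table_op T)"
    by (simp add: absorbing_op_def idempotent_op_def)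
  finally show ?thesis .
qed

end

text \<open>Every tuple is a singleton of an element at most \<open>x\<close> or has a code at most
  \<open>x\<close>, so there are at most \<open>2 * Suc x\<close> tuples. Of the three powers of 2,
  the outer one is the bound on labels, the middle one counts pairs of subsets, and the inner one
  replaces the product \<open>4 * Suc x\<close>, for which \<open>tm\<close> has no term.\<close>

lemma card_rel_sets:
  assumes "finite_rel_structure S"
  shows "2 ^ card (Pow (\<Union> (rel_sets S)) \<times> Pow (\<Union> (rel_sets S))) < Suc (2 ^ 2 ^ 2 ^ Suc (Suc x))"
proof -
  let ?V = "\<Union> (rel_sets S)"
  have fin: "finite ?V" using finite_Union_rel_sets[OF assms] .
  have "?V \<subseteq> (\<lambda>a. [a]) ` {..x} \<union> list_decode ` {..x}"
  proof
    fix t assume "t \<in> ?V"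
    then consider a where "a \<in> set us" "t = [a]" | k ts where "(k, ts) \<in> set rs" "t \<in> set ts"
      by (auto simp: rel_sets_def universe_S rels_S)
    then show "t \<in> (\<lambda>a. [a]) ` {..x} \<union> list_decode ` {..x}"
    proof cases
      case 1
      then show ?thesis using us_le by auto
    next
      case 2
      then have "list_decode (list_encode t) \<in> list_decode ` {..x}" using tuple_le by blast
      then show ?thesis by simp
    qed
  qed
  then have "card ?V \<le> card ((\<lambda>a. [a]) ` {..x} \<union> list_decode ` {..x})" by (intro card_mono) auto
  also have "\<dots> \<le> card ((\<lambda>a. [a]) ` {..x}) + card (list_decode ` {..x})" by (rule card_Un_le)
  also have "\<dots> \<le> Suc x + Suc x" by (intro add_mono) (metis card_atMost card_image_le finite_atMost)+
  finally have "card ?V + card ?V \<le> 4 * Suc x" by simp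
  also have "\<dots> \<le> 4 * 2 ^ x" using Suc_leI[OF less_exp[of x]] by (intro mult_left_mono) simp_all
  finally have "card ?V + card ?V \<le> 2 ^ Suc (Suc x)" by simp
  then have "card (Pow ?V \<times> Pow ?V) \<le> 2 ^ 2 ^ Suc (Suc x)"
    using fin by (simp add: card_cartesian_product card_Pow flip: power_add del: power_Suc)
  then show ?thesis by (simp add: less_Suc_eq_le del: power_Suc)
qed

lemma holds_problem: "holds problem_fm [x] \<longleftrightarrow> finite_rel_structure S \<and> set bs \<subseteq> universe S \<and>
    absorbing_subuniverse (set bs) (Pol S)"
proof -
  define N where "N = Suc (2 ^ 2 ^ 2 ^ Suc (Suc x))"
  have "holds problem_fm [x] \<longleftrightarrow> holds valid_fm env \<and> holds subuniverse_fm env \<and>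
    (\<exists>T<Suc (boundc (Suc (boundc N x)) x). holds poly_fm (T # Suc (boundc N x) # N # env) \<and>
      holds absorbing_fm (T # Suc (boundc N x) # N # env))"
    by (simp add: problem_fm_def x encode_input_def N_def del: power_Suc)
  also have "\<dots> \<longleftrightarrow> finite_rel_structure S \<and> set bs \<subseteq> set us \<and> absorbing_subuniverse (set bs) (Pol S)"
  proof (cases "finite_rel_structure S \<and> set bs \<subseteq> set us")
    case True
    then have S: "finite_rel_structure S" and bs: "set bs \<subseteq> set us" by auto
    have "(\<exists>T<Suc (boundc (Suc (boundc N x)) x). polymorphism S N (table_op T) \<and>
        absorbing_op (set us) (set bs) N (table_op T)) \<longleftrightarrow>
      (\<exists>t. polymorphism S N t \<and> absorbing_op (set us) (set bs) N t)"
    proof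
      assume "\<exists>t. polymorphism S N t \<and> absorbing_op (set us) (set bs) N t"
      then obtain t where t: "polymorphism S N t" "absorbing_op (set us) (set bs) N t" by blast
      obtain T where T: "T < Suc (boundc (Suc (boundc N x)) x)" "polymorphism S N (table_op T)"
        "\<forall>ws\<in>tuples (set us) N. table_op T ws = t ws" using polymorphism_table[OF S t(1)] by blast
      have "replicate N a \<in> tuples (set us) N" if "a \<in> set us" for a using that by (auto simp: tuples_def)
      then have "absorbing_op (set us) (set bs) N (table_op T)"
        using t(2) T(3) by (simp add: absorbing_op_def idempotent_op_def)
      then show "\<exists>T<Suc (boundc (Suc (boundc N x)) x). polymorphism S N (table_op T) \<and>
        absorbing_op (set us) (set bs) N (table_op T)" using T by blast
    qed blast
    then show ?thesis
      using absorbing_subuniverse_Pol_iff[OF S card_rel_sets[OF S], of "set bs"] True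
      by (simp add: holds_valid holds_subuniverse[OF S bs] holds_poly[OF S] holds_absorbing[OF S bs] N_def universe_S
        del: power_Suc)
  qed (use holds_valid in blast)
  finally show ?thesis by (simp add: universe_S)
qed

end

text \<open>Every number codes an input, so the procedure never has to recognise codes.\<close>

lemma encode_input_surj: "\<exists>us rs bs. x = encode_input us rs bs"
proof -
  have "\<exists>r. c = encode_rel r" for c
    by (rule exI[of _ "(fst (prod_decode c), map list_decode (list_decode (snd (prod_decode c))))"])
      (simp add: encode_rel_def comp_def)
  then have "surj encode_rel" by (auto simp: surj_def)
  then have rel: "map encode_rel (map (inv encode_rel) cs) = cs" for cs
    by (simp add: comp_def surj_f_inv_f)
  let ?y = "snd (prod_decode x)"
  have "x = encode_input (list_decode (fst (prod_decode x)))
    (map (inv encode_rel) (list_decode (fst (prod_decode ?y)))) (list_decode (snd (prod_decode ?y)))"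
    unfolding encode_input_def rel by simp
  then show ?thesis by blast
qed

theorem mainTheorem3:
  shows "decidable absorption_problem"
proof -
  have "x \<in> absorption_problem \<longleftrightarrow> holds problem_fm [x]" for x
  proof -
    obtain us rs bs where x: "x = encode_input us rs bs" using encode_input_surj by blast
    then interpret input us rs bs x by unfold_locales
    show ?thesis unfolding holds_problem by (auto simp: absorption_problem_def x encode_input_eq_iff)
  qed
  then have "absorption_problem = {x. holds problem_fm [x]}" by blast
  then show ?thesis using decidable_holds by metis
qed

end
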